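(* Let $d\in\mathbb{N}$. For every $\mathbf{r}=(r_1,\dots,r_d)$ with $r_j>0$, $j=1,\dots,d$, there is a constant $C(\mathbf{r},d)>0$, depending only on $\mathbf{r}$ and $d$, such that the following holds. Let $m,N\in\mathbb{N}$ and $\mathbf{h}\in\mathbb{Z}^d$ be such that the Korobov cubature formula $P_m(\cdot,\mathbf{h})$ is exact on $\mathcal{T}(N,d)$, suppose $N\ge2\cdot3^d$, and let $\ell\in\mathbb{N}$ be the largest natural number satisfying $2^\ell\le3^{-d}N$. Then for any function $f\in\mathcal{C}(\mathbb{T}^d)$ which belongs to either $W^{\mathbf{r}}_{\infty,\alpha}$ (for some $\alpha\in\mathbb{R}^d$) or $H^{\mathbf{r}}_\infty$, we have $$\|f-V^\ell(f)\|_\infty\le C(\mathbf{r},d)\,N^{-g(\mathbf{r})}.$$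
   Context: $\mathbb{T}^d=[0,2\pi]^d$ with normalized Lebesgue measure; $\mathcal{C}(\mathbb{T}^d)$ is the space of continuous functions with $\|f\|_\infty=\max_{\mathbf{x}\in\mathbb{T}^d}|f(\mathbf{x})|$; functions in the classes below are $2\pi$-periodic in each variable. $g(\mathbf{r}):=\left(\sum_{j=1}^d1/r_j\right)^{-1}$. Korobov formulas: for $m\in\mathbb{N}$, $\mathbf{h}=(h_1,\dots,h_d)\in\mathbb{Z}^d$, let $\mathbf{w}^\nu:=(2\pi\{\nu h_1/m\},\dots,2\pi\{\nu h_d/m\})$, $\nu=1,\dots,m$, where $\{a\}$ is the fractional part of $a$, and $P_m(f,\mathbf{h}):=m^{-1}\sum_{\nu=1}^mf(\mathbf{w}^\nu)$. Let $\Gamma(N,d):=\{\mathbf{k}\in\mathbb{Z}^d:\prod_{j=1}^d\max(|k_j|,1)\le N\}$ and let $\mathcal{T}(N,d)$ be the space of trigonometric polynomials $\sum_{\mathbf{k}\in\Gamma(N,d)}c_{\mathbf{k}}e^{i(\mathbf{k},\mathbf{x})}$, $c_{\mathbf{k}}\in\mathbb{C}$. $P_m(\cdot,\mathbf{h})$ is exact on $\mathcal{T}(N,d)$ if $P_m(f,\mathbf{h})=(2\pi)^{-d}\int_{\mathbb{T}^d}f(\mathbf{x})\,d\mathbf{x}$ for all $f\in\mathcal{T}(N,d)$. De la Vallée Poussin kernels: $\mathcal{D}_l(x):=\sum_{|k|\le l}e^{ikx}$, $\mathcal{V}_j(x):=j^{-1}\sum_{l=j}^{2j-1}\mathcal{D}_l(x)$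 for $j\in\mathbb{N}$, and $\mathcal{V}_{\mathbf{j}}(\mathbf{x}):=\prod_{i=1}^d\mathcal{V}_{j_i}(x_i)$ for $\mathbf{j}=(j_1,\dots,j_d)$. Recovery operators: for $\mathbf{s}\in\mathbb{Z}_+^d$ (nonnegative integer vectors), with $2^{\mathbf{s}}:=(2^{s_1},\dots,2^{s_d})$ and $\|\mathbf{s}\|_1=s_1+\dots+s_d$, let $V_{\mathbf{s}}(f)(\mathbf{x}):=\frac1m\sum_{\nu=1}^mf(\mathbf{w}^\nu)\mathcal{V}_{2^{\mathbf{s}}}(\mathbf{x}-\mathbf{w}^\nu)$, $\mathbf{s}^o(f):=\arg\min_{\mathbf{s}:\|\mathbf{s}\|_1=\ell}\|f-V_{\mathbf{s}}(f)\|_\infty$ (any minimizer), and $V^\ell(f):=V_{\mathbf{s}^o(f)}(f)$. Sobolev class: for $r>0$, $\alpha\in\mathbb{R}$ let $F_r(x,\alpha):=1+2\sum_{k=1}^\infty k^{-r}\cos(kx-\alpha\pi/2)$. For $\alpha=(\alpha_1,\dots,\alpha_d)\in\mathbb{R}^d$, $W^{\mathbf{r}}_{\infty,\alpha}$ is the set of functions $f$ that for each $1\le j\le d$ have a representation $$f(\mathbf{x})=(2\pi)^{-1}\int_0^{2\pi}\varphi_j(x_1,\dots,x_{j-1},y,x_{j+1},\dots,x_d)F_{r_j}(x_j-y,\alpha_j)\,dy,\qquad\|\varphi_j\|_\infty\le1.$$ Nikol'skii class: $H^{\mathbf{r}}_\infty$ is the set of $f\in L_\infty$ such that, with $l_j:=[r_j]+1$,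 $\|f\|_\infty\le1$ and $\|\Delta_h^{l_j,j}f\|_\infty\le|h|^{r_j}$ for all $h$ and all $j=1,\dots,d$, where $\Delta_h^{l,j}$ is the $l$-th difference with step $h$ in the variable $x_j$. *)

theory Defs
  imports "HOL-Probability.Essential_Supremum"
begin

section \<open>The torus, periodic functions and norms\<close>

text \<open>
  The dimension is \<open>d = CARD('n)\<close>. Functions on the torus are complex-valued functions on
  \<open>real ^ 'n\<close> that are \<open>2 * pi\<close>-periodic in each variable; real-valued functions are included as
  a special case.
\<close>

abbreviation torus :: "(real ^ 'n) set" where
  "torus \<equiv> cbox 0 (\<chi> i. 2 * pi)"

definition periodic_torus :: "(real ^ 'n \<Rightarrow> complex) \<Rightarrow> bool" where
  "periodic_torus f \<longleftrightarrow> (\<forall>x j. f (x + axis j (2 * pi)) = f x)"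

definition C_torus :: "(real ^ 'n \<Rightarrow> complex) set" where
  "C_torus = {f. periodic_torus f \<and> continuous_on UNIV f}"

text \<open>The maximum norm; it is only applied to continuous functions, for which the supremum over
  the compact set \<open>torus\<close> is attained.\<close>

definition sup_norm :: "(real ^ 'n \<Rightarrow> complex) \<Rightarrow> real" where
  "sup_norm f = (SUP x\<in>torus. norm (f x))"

text \<open>The norm of \<open>L\<^sub>\<infinity>\<close>, used in the definitions of the function classes.\<close>

definition Linf_norm :: "(real ^ 'n \<Rightarrow> complex) \<Rightarrow> ereal" where
  "Linf_norm f = esssup (lebesgue_on torus) (\<lambda>x. ereal (norm (f x)))"

definition g :: "real ^ 'n \<Rightarrow> real" where
  "g r = inverse (\<Sum>j\<in>UNIV. 1 / r $ j)"

section \<open>Korobov cubature formulas\<close>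

definition korobov_node :: "nat \<Rightarrow> int ^ 'n \<Rightarrow> nat \<Rightarrow> real ^ 'n" where
  "korobov_node m h \<nu> = (\<chi> j. 2 * pi * frac (real \<nu> * real_of_int (h $ j) / real m))"

definition korobov :: "nat \<Rightarrow> (real ^ 'n \<Rightarrow> complex) \<Rightarrow> int ^ 'n \<Rightarrow> complex" where
  "korobov m f h = (\<Sum>\<nu>=1..m. f (korobov_node m h \<nu>)) / of_nat m"

definition hyperbolic_cross :: "nat \<Rightarrow> (int ^ 'n) set" where
  "hyperbolic_cross N = {k. (\<Prod>j\<in>UNIV. max \<bar>k $ j\<bar> 1) \<le> int N}"

definition trig_poly :: "nat \<Rightarrow> (real ^ 'n \<Rightarrow> complex) set" where
  "trig_poly N = {\<lambda>x. \<Sum>k\<in>hyperbolic_cross N.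
      c k * exp (\<i> * of_real (\<Sum>j\<in>UNIV. real_of_int (k $ j) * x $ j)) | c. True}"

lemma finite_hyperbolic_cross: "finite (hyperbolic_cross N :: (int ^ 'n) set)"
proof -
  have "k $ i \<in> {- int N..int N}" if k: "k \<in> hyperbolic_cross N" for k :: "int ^ 'n" and i
  proof -
    have "max \<bar>k $ i\<bar> 1 * 1 \<le> max \<bar>k $ i\<bar> 1 * (\<Prod>j\<in>UNIV - {i}. max \<bar>k $ j\<bar> 1)"
      by (intro mult_left_mono prod_ge_1) auto
    also have "\<dots> = (\<Prod>j\<in>UNIV. max \<bar>k $ j\<bar> 1)"
      by (simp add: prod.remove[of UNIV i])
    also have "\<dots> \<le> int N"
      using k by (simp add: hyperbolic_cross_def)
    finally show ?thesis by auto
  qed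
  then have "hyperbolic_cross N \<subseteq> vec_lambda ` (UNIV \<rightarrow>\<^sub>E {- int N..int N} :: ('n \<Rightarrow> int) set)"
    by (auto simp: image_iff intro!: bexI[where x = "vec_nth _"])
  moreover have "finite (UNIV \<rightarrow>\<^sub>E {- int N..int N} :: ('n \<Rightarrow> int) set)"
    by (intro finite_PiE) auto
  ultimately show ?thesis
    by (meson finite_imageI finite_subset)
qed

definition korobov_exact :: "nat \<Rightarrow> int ^ 'n \<Rightarrow> nat \<Rightarrow> bool" where
  "korobov_exact m h N \<longleftrightarrow>
    (\<forall>f\<in>trig_poly N. korobov m f h = (LINT x|lebesgue_on torus. f x) / (2 * pi) ^ CARD('n))"

section \<open>De la Vallee Poussin kernels and recovery operators\<close>

definition dirichlet :: "nat \<Rightarrow> real \<Rightarrow> complex" where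
  "dirichlet l x = (\<Sum>k\<in>{- int l..int l}. exp (\<i> * of_int k * of_real x))"

definition vallee_poussin1 :: "nat \<Rightarrow> real \<Rightarrow> complex" where
  "vallee_poussin1 j x = (\<Sum>l=j..2 * j - 1. dirichlet l x) / of_nat j"

definition vallee_poussin :: "nat ^ 'n \<Rightarrow> real ^ 'n \<Rightarrow> complex" where
  "vallee_poussin j x = (\<Prod>i\<in>UNIV. vallee_poussin1 (j $ i) (x $ i))"

definition V :: "nat \<Rightarrow> int ^ 'n \<Rightarrow> nat ^ 'n \<Rightarrow> (real ^ 'n \<Rightarrow> complex) \<Rightarrow> real ^ 'n \<Rightarrow> complex" where
  "V m h s f x = (\<Sum>\<nu>=1..m. f (korobov_node m h \<nu>) *
      vallee_poussin (\<chi> i. 2 ^ (s $ i)) (x - korobov_node m h \<nu>)) / of_nat m"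

text \<open>Minimizers \<open>s\<close> need not be unique, so the optimal choice is a predicate; a
  recovery \<open>V\<^sup>l(f)\<close> is \<open>V m h s f\<close> for any \<open>s\<close> satisfying it.\<close>

definition optimal_s :: "nat \<Rightarrow> int ^ 'n \<Rightarrow> nat \<Rightarrow> (real ^ 'n \<Rightarrow> complex) \<Rightarrow> nat ^ 'n \<Rightarrow> bool" where
  "optimal_s m h l f s \<longleftrightarrow>
    is_arg_min (\<lambda>s. sup_norm (\<lambda>x. f x - V m h s f x)) (\<lambda>s. (\<Sum>i\<in>UNIV. s $ i) = l) s"

lemma optimal_s_exists: "\<exists>s. optimal_s m h l f (s :: nat ^ 'n)"
proof -
  let ?S = "{s :: nat ^ 'n. (\<Sum>i\<in>UNIV. s $ i) = l}"
  have "?S \<subseteq> vec_lambda ` (UNIV \<rightarrow>\<^sub>E {..l} :: ('n \<Rightarrow> nat) set)"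
    by (auto simp: image_iff member_le_sum intro!: bexI[where x = "vec_nth _"])
  moreover have "finite (UNIV \<rightarrow>\<^sub>E {..l} :: ('n \<Rightarrow> nat) set)"
    by (intro finite_PiE) auto
  ultimately have "finite ?S"
    by (meson finite_imageI finite_subset)
  moreover have "(\<chi> i. if i = undefined then l else 0) \<in> ?S"
    by simp
  ultimately show ?thesis
    unfolding optimal_s_def by (metis (no_types, lifting) ex_is_arg_min_if_finite empty_iff
        is_arg_min_def mem_Collect_eq)
qed

section \<open>Function classes\<close>

text \<open>For \<open>r \<le> 1\<close> the series converges only conditionally, and it may diverge for
  \<open>x \<in> 2 * pi * \<int>\<close>; the value \<open>suminf\<close> assigns on this null set does not affect the integrals
  below.\<close>

definition bernoulli_kernel :: "real \<Rightarrow> real \<Rightarrow> real \<Rightarrow> real" where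
  "bernoulli_kernel r x \<alpha> =
    1 + 2 * (\<Sum>k. real (Suc k) powr (- r) * cos (real (Suc k) * x - \<alpha> * pi / 2))"

text \<open>As usual for \<open>L\<^sub>\<infinity>\<close>, the densities \<open>\<phi>\<close> are measurable functions with essential bound 1,
  and the representation holds almost everywhere.\<close>

definition sobolev_W :: "real ^ 'n \<Rightarrow> real ^ 'n \<Rightarrow> (real ^ 'n \<Rightarrow> complex) set" where
  "sobolev_W r \<alpha> = {f. periodic_torus f \<and>
    (\<forall>j. \<exists>\<phi>. \<phi> \<in> borel_measurable (lebesgue_on torus) \<and> Linf_norm \<phi> \<le> 1 \<and>
      (AE x in lebesgue_on torus.
        f x = (LINT y|lebesgue_on {0..2 * pi}.
                \<phi> (\<chi> i. if i = j then y else x $ i) *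
                of_real (bernoulli_kernel (r $ j) (x $ j - y) (\<alpha> $ j))) / (2 * pi)))}"

definition difference :: "'n \<Rightarrow> real \<Rightarrow> (real ^ 'n \<Rightarrow> complex) \<Rightarrow> real ^ 'n \<Rightarrow> complex" where
  "difference j h f x = f (x + axis j h) - f x"

definition nikolskii_H :: "real ^ 'n \<Rightarrow> (real ^ 'n \<Rightarrow> complex) set" where
  "nikolskii_H r = {f. periodic_torus f \<and> f \<in> borel_measurable lebesgue \<and> Linf_norm f \<le> 1 \<and>
    (\<forall>h j. Linf_norm ((difference j h ^^ (nat \<lfloor>r $ j\<rfloor> + 1)) f) \<le> ereal (\<bar>h\<bar> powr (r $ j)))}"

end

theory Submission
  imports Defs
begin

text \<open>
  Because \<open>V\<^sup>l\<close> uses a minimizer among all \<open>s\<close> with coordinate sum \<open>l\<close>, it is enough to exhibit one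
  such \<open>s\<close> with a small error. The right one makes all \<open>2 powr (- s i * r i)\<close> comparable: the real
  solution \<open>s i = l * g r / r i\<close> has sum \<open>l\<close> by the definition of \<open>g\<close>, and rounding costs only a
  constant (\<open>balanced_exponents\<close>). The common value is then of order \<open>2 powr (- l * g r)\<close>, that
  is \<open>N powr - g r\<close>, since \<open>2 ^ l\<close> is comparable to \<open>N\<close>.

  Let \<open>d = CARD('n)\<close>. For a fixed \<open>s\<close> the recovery operator behaves like the continuous convolution with the de la Vallee
  Poussin kernel. The product of the kernel with an exponential of degrees \<open>2 ^ s i\<close> has degrees at most
  \<open>3 * 2 ^ s i\<close>, and the product of these degrees is \<open>3 ^ d * 2 ^ l \<le> N\<close>. So all its frequencies lie in
  the hyperbolic cross, where the cubature formula is exact (\<open>korobov_prod\<close>). Consequently the operator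
  reproduces trigonometric polynomials of degree \<open>2 ^ s i\<close> in \<open>x i\<close> (\<open>V_character\<close>). Its norm is at
  most \<open>3 ^ d\<close> (\<open>V_bounded\<close>), because the kernel is dominated by a positive one of mean \<open>3 ^ d\<close>.
  Hence the error is at most \<open>1 + 3 ^ d\<close> times the distance of \<open>f\<close> to these polynomials.

  That distance is estimated one variable at a time. Convolving successively in each variable gives a
  polynomial whose error is bounded by the errors of the single convolutions
  (\<open>exists_partial_trig\<close>). Each univariate convolution is near-best (\<open>vallee_poussin_near_best\<close>), so along
  every coordinate line any univariate approximation of order \<open>n powr - r\<close> will do. For the
  Nikol'skii class it comes from averaging the higher difference against a Jackson kernel
  (\<open>jackson_trig_approximation\<close>). For the Sobolev class it comes from splitting the Bernoulli kernel into
  a polynomial of degree less than \<open>n\<close> and a tail of mean modulus of order \<open>n powr - r\<close>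
  (\<open>bernoulli_kernel_split\<close>, \<open>kernel_tail_bound\<close>, \<open>sobolev_trig_approximation\<close>). The tail is estimated
  by summing by parts twice away from \<open>0\<close> and once near \<open>0\<close>. The convolutions
  do not depend on how the approximants were found, so unrelated approximants on different lines, and
  unrelated Sobolev densities in different directions, lead to one polynomial in all variables.
\<close>

section \<open>Trigonometric polynomials and means over a period\<close>

text \<open>
  The parameter \<open>n\<close> bounds the degree from above; it need not be attained.
\<close>

definition trig1 :: "nat \<Rightarrow> (real \<Rightarrow> complex) \<Rightarrow> bool" where
  "trig1 n p \<longleftrightarrow> (\<exists>c. \<forall>x. p x = (\<Sum>k\<in>{- int n..int n}. c k * cis (of_int k * x)))"

lemma trig1_zero: "trig1 n (\<lambda>x. 0)"
  unfolding trig1_def by (rule exI[of _ "\<lambda>k. 0"]) simp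

lemma trig1_cis: "\<bar>k\<bar> \<le> int n \<Longrightarrow> trig1 n (\<lambda>x. c * cis (of_int k * x))"
  unfolding trig1_def
  by (rule exI[of _ "\<lambda>j. if j = k then c else 0"]) (auto simp: if_distrib [of "\<lambda>c. c * _"] cong: if_cong)

lemma trig1_add:
  assumes "trig1 n p" "trig1 n q" shows "trig1 n (\<lambda>x. p x + q x)"
proof -
  obtain c d where "\<And>x. p x = (\<Sum>k\<in>{- int n..int n}. c k * cis (of_int k * x))"
    "\<And>x. q x = (\<Sum>k\<in>{- int n..int n}. d k * cis (of_int k * x))"
    using assms unfolding trig1_def by blast
  then show ?thesis unfolding trig1_def
    by (intro exI[of _ "\<lambda>k. c k + d k"]) (simp add: sum.distrib distrib_right)
qed

lemma trig1_sum:
  assumes "\<And>i. i \<in> A \<Longrightarrow> trig1 n (p i)" shows "trig1 n (\<lambda>x. \<Sum>i\<in>A. p i x)"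
  using assms by (induction A rule: infinite_finite_induct) (auto intro: trig1_zero trig1_add)

lemma trig1_mono: "trig1 n p \<Longrightarrow> n \<le> m \<Longrightarrow> trig1 m p"
proof -
  assume "trig1 n p" "n \<le> m"
  then obtain c where "p = (\<lambda>x. \<Sum>k\<in>{- int n..int n}. c k * cis (of_int k * x))"
    unfolding trig1_def by blast
  then show ?thesis using \<open>n \<le> m\<close> by (auto intro!: trig1_sum trig1_cis)
qed

lemma trig1_mult:
  assumes "trig1 n p" "trig1 m q" shows "trig1 (n + m) (\<lambda>x. p x * q x)"
proof -
  obtain c d where "\<And>x. p x = (\<Sum>k\<in>{- int n..int n}. c k * cis (of_int k * x))"
    "\<And>x. q x = (\<Sum>k\<in>{- int m..int m}. d k * cis (of_int k * x))"
    using assms unfolding trig1_def by blast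
  then have "(\<lambda>x. p x * q x) = (\<lambda>x. \<Sum>k\<in>{- int n..int n}. \<Sum>l\<in>{- int m..int m}.
      (c k * d l) * cis (of_int (k + l) * x))"
    by (simp add: sum_product cis_mult[symmetric] algebra_simps)
  then show ?thesis by (simp only:) (intro trig1_sum trig1_cis, auto)
qed

lemma trig1_const: "trig1 n (\<lambda>x. c)"
  using trig1_cis[of 0 n c] by simp

lemma trig1_cmult: "trig1 n p \<Longrightarrow> trig1 n (\<lambda>x. c * p x)"
  using trig1_mult[OF trig1_const[of 0 c], of n p] by simp

lemma trig1_power: "trig1 n p \<Longrightarrow> trig1 (n * k) (\<lambda>x. p x ^ k)"
proof (induction k)
  case 0 then show ?case using trig1_const[of 0 1] by simp
next
  case (Suc k) then show ?case using trig1_mult[of n p "n*k"] by simp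
qed

lemma continuous_cis [continuous_intros]: "continuous_on S f \<Longrightarrow> continuous_on S (\<lambda>x. cis (f x))"
  by (simp add: cis_conv_exp continuous_intros)

lemma trig1_continuous:
  assumes "trig1 n p" shows "continuous_on S p"
proof -
  obtain c where "p = (\<lambda>x. \<Sum>k\<in>{- int n..int n}. c k * cis (of_int k * x))"
    using assms unfolding trig1_def by blast
  then show ?thesis by (simp only:) (intro continuous_intros)
qed

definition mean :: "(real \<Rightarrow> complex) \<Rightarrow> complex" where
  "mean p = integral {0..2 * pi} p / (2 * pi)"

lemma mean_add: "continuous_on UNIV p \<Longrightarrow> continuous_on UNIV q \<Longrightarrow> mean (\<lambda>t. p t + q t) = mean p + mean q"
  unfolding mean_def
  by (subst integral_add) (simp_all add: add_divide_distrib integrable_continuous_real continuous_on_subset[of UNIV])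

lemma mean_cmult: "mean (\<lambda>t. c * p t) = c * mean p"
  unfolding mean_def by simp

lemma mean_sum:
  assumes "finite A" "\<And>i. i \<in> A \<Longrightarrow> continuous_on UNIV (p i)"
  shows "mean (\<lambda>t. \<Sum>i\<in>A. p i t) = (\<Sum>i\<in>A. mean (p i))"
  unfolding mean_def
  by (subst integral_sum)
    (simp_all add: assms sum_divide_distrib integrable_continuous_real continuous_on_subset[of UNIV])

lemma mean_diff: "continuous_on UNIV p \<Longrightarrow> continuous_on UNIV q \<Longrightarrow> mean (\<lambda>t. p t - q t) = mean p - mean q"
  unfolding mean_def
  by (subst integral_diff) (simp_all add: diff_divide_distrib integrable_continuous_real continuous_on_subset[of UNIV])

lemma mean_const [simp]: "mean (\<lambda>t. c) = c"
  unfolding mean_def by (simp add: scaleR_conv_of_real)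

lemma mean_mono_norm:
  assumes "continuous_on UNIV p" "continuous_on UNIV q" "\<And>t. 0 \<le> t \<Longrightarrow> t \<le> 2 * pi \<Longrightarrow> norm (p t) \<le> q t"
  shows "norm (mean p) \<le> Re (mean (\<lambda>t. of_real (q t)))"
proof -
  have iq: "q integrable_on {0..2*pi}"
    by (intro integrable_continuous_real continuous_on_subset[OF assms(2)]) auto
  have "norm (integral {0..2*pi} p) \<le> integral {0..2*pi} q"
    by (intro integral_norm_bound_integral iq integrable_continuous_real continuous_on_subset[OF assms(1)] assms(3)) auto
  moreover have "integral {0..2*pi} (\<lambda>t. complex_of_real (q t)) = of_real (integral {0..2*pi} q)"
    using has_integral_of_real[OF integrable_integral[OF iq]] by (rule integral_unique)
  ultimately show ?thesis unfolding mean_def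
    by (simp add: norm_divide divide_right_mono)
qed

lemma mean_cis: "mean (\<lambda>t. cis (of_int k * t)) = (if k = 0 then 1 else 0)"
proof (cases "k = 0")
  case False
  have "((\<lambda>t. cis (of_int k * t)) has_integral
      (cis (of_int k * (2*pi)) / (\<i> * of_int k) - cis (of_int k * 0) / (\<i> * of_int k))) {0..2*pi}"
  proof (rule fundamental_theorem_of_calculus)
    fix x :: real
    have "((\<lambda>z. exp (\<i> * (of_int k * z)) / (\<i> * of_int k)) has_field_derivative exp (\<i> * (of_int k * of_real x)))
       (at (of_real x))"
      using False by (auto intro!: derivative_eq_intros simp: mult.commute[of _ \<i>])
    then have "((\<lambda>z. exp (\<i> * (of_int k * complex_of_real z)) / (\<i> * of_int k)) has_vector_derivative exp (\<i> * (of_int k * of_real x)))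
       (at x within {0..2*pi})"
      by (rule has_vector_derivative_real_field)
    then show "((\<lambda>t. cis (of_int k * t) / (\<i> * of_int k)) has_vector_derivative cis (of_int k * x)) (at x within {0..2*pi})"
      by (simp add: cis_conv_exp)
  qed simp
  moreover have "cis (of_int k * (2*pi)) = 1"
    using cis_multiple_2pi[of "of_int k"] by (simp add: mult.commute)
  ultimately show ?thesis using False by (auto simp: mean_def integral_unique)
qed (simp)

lemma periodic_int:
  fixes H :: "real \<Rightarrow> 'a"
  assumes "\<And>t. H (t + 2 * pi) = H t"
  shows "H (t + of_int k * (2 * pi)) = H t"
proof (induction k rule: int_induct[where k = 0])
  case (step1 i) then show ?case using assms[of "t + of_int i * (2 * pi)"] by (simp add: algebra_simps)
next
  case (step2 i) then show ?case using assms[of "t + of_int (i - 1) * (2 * pi)"] by (simp add: algebra_simps)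
qed simp

lemma periodic_reduce:
  fixes H :: "real \<Rightarrow> 'a"
  assumes "\<And>t. H (t + 2 * pi) = H t"
  obtains s where "s \<in> {0..2 * pi}" "H t = H s"
proof
  have "t = 2 * pi * frac (t / (2 * pi)) + of_int \<lfloor>t / (2 * pi)\<rfloor> * (2 * pi)"
    by (simp add: frac_def field_simps)
  then show "H t = H (2 * pi * frac (t / (2 * pi)))" using periodic_int[of H, OF assms] by metis
  show "2 * pi * frac (t / (2 * pi)) \<in> {0..2 * pi}"
    using frac_ge_0[of "t / (2*pi)"] frac_lt_1[of "t / (2*pi)"] by (simp add: mult_left_le)
qed

text \<open>
  The integral over a period does not depend on where the period starts: two windows of length
  \<open>2 * pi\<close> differ by two pieces that are translates of each other by the period.
\<close>

lemma mean_shift: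
  assumes c: "continuous_on UNIV p" and per: "\<And>t. p (t + 2 * pi) = p t"
  shows "mean (\<lambda>t. p (t + u)) = mean p"
proof -
  have int: "p integrable_on {a..b}" for a b
    by (intro integrable_continuous_real continuous_on_subset[OF c]) auto
  have sh: "integral {a..b} (\<lambda>t. p (t + u)) = integral {a+u..b+u} p" for a b u
    using integral_shift_Icc_real[of a b p u] by (simp add: o_def add.commute)
  have comb: "integral {a..b} p = integral {a..c} p + integral {c..b} p" if "a \<le> c" "c \<le> b" for a b c
    using Henstock_Kurzweil_Integration.integral_combine[OF that int] by simp
  have pos: "integral {v..v+2*pi} p = integral {0..2*pi} p" if v: "v \<ge> 0" for v
  proof -
    have "integral {0..v} p + integral {v..v+2*pi} p = integral {0..2*pi} p + integral {2*pi..v+2*pi} p"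
      using comb[of 0 v "v + 2*pi"] comb[of 0 "2*pi" "v+2*pi"] v by simp
    moreover have "integral {2*pi..v+2*pi} p = integral {0..v} p"
      using sh[of 0 v "2*pi"] per by simp
    ultimately show ?thesis by simp
  qed
  have "integral {u..u+2*pi} p = integral {0..2*pi} p"
  proof (cases "u \<ge> 0")
    case False
    obtain N :: nat where N: "u + of_nat N * (2*pi) \<ge> 0"
      using reals_Archimedean3[of "2*pi"] pi_gt_zero
      by (metis add.commute less_eq_real_def mult_pos_pos neg_le_iff_le real_0_le_add_iff zero_less_numeral)
    have "p (t + of_nat N * (2*pi)) = p t" for t
      using periodic_int[of p t "int N", OF per] by simp
    then have "integral {u..u+2*pi} p = integral {u + of_nat N * (2*pi)..u+2*pi + of_nat N * (2*pi)} p"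
      using sh[of u "u+2*pi" "of_nat N * (2*pi)"] by simp
    also have "\<dots> = integral {0..2*pi} p"
      using pos[OF N] by (simp add: algebra_simps)
    finally show ?thesis .
  qed (rule pos)
  then show ?thesis
    unfolding mean_def using sh[of 0 "2*pi" u] by (simp add: add.commute)
qed

lemma cis_periodic: "cis (of_int k * (t + 2 * pi)) = cis (of_int k * t)"
  using cis_multiple_2pi[of "of_int k"] by (simp add: algebra_simps flip: cis_mult)

lemma trig1_periodic: "trig1 n p \<Longrightarrow> p (t + 2 * pi) = p t"
  unfolding trig1_def by (auto simp: cis_periodic)

text \<open>
  Kernels enter the recovery operators as \<open>p (a - y)\<close> and are averaged in \<open>y\<close>. As a function
  of \<open>y\<close> this is a trigonometric polynomial of the same degree with the same constant
  coefficient.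
\<close>

lemma trig1_reflect:
  assumes "trig1 n p"
  shows "trig1 n (\<lambda>y. p (a - y))" and "mean (\<lambda>y. p (a - y)) = mean p"
proof -
  obtain c where c: "\<And>x. p x = (\<Sum>k\<in>{- int n..int n}. c k * cis (of_int k * x))"
    using assms unfolding trig1_def by blast
  have "cis (of_int k * (a - y)) = cis (of_int k * a) * cis (of_int (- k) * y)" for k y
    by (simp add: cis_mult algebra_simps)
  then have e: "p (a - y) = (\<Sum>k\<in>{- int n..int n}. (c k * cis (of_int k * a)) * cis (of_int (- k) * y))" for y
    unfolding c by (intro sum.cong refl) simp
  show "trig1 n (\<lambda>y. p (a - y))" unfolding e by (intro trig1_sum trig1_cis) auto
  have "mean (\<lambda>y. p (a - y)) = (\<Sum>k\<in>{- int n..int n}. (c k * cis (of_int k * a)) * mean (\<lambda>t. cis (of_int (- k) * t)))"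
    unfolding e by (subst mean_sum) (auto simp: mean_cmult intro!: continuous_intros)
  also have "\<dots> = (\<Sum>k\<in>{- int n..int n}. c k * mean (\<lambda>t. cis (of_int k * t)))"
    unfolding mean_cis by (intro sum.cong refl) auto
  also have "\<dots> = mean p"
    unfolding c by (subst mean_sum) (auto simp: mean_cmult intro!: continuous_intros)
  finally show "mean (\<lambda>y. p (a - y)) = mean p" .
qed

lemma trig1_shift: "trig1 n p \<Longrightarrow> trig1 n (\<lambda>t. p (t + a))"
  using trig1_reflect(1)[OF trig1_reflect(1), of n p a 0] by (simp add: add.commute)

section \<open>Fejer and de la Vallee Poussin kernels\<close>

text \<open>
  The Fejer kernel, written as the square of a Dirichlet sum over nonnegative frequencies: this form
  shows positivity and gives the decay away from \<open>0\<close>.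
\<close>

definition fejer :: "nat \<Rightarrow> real \<Rightarrow> real" where
  "fejer n t = (cmod (\<Sum>k<n. cis (of_nat k * t)))\<^sup>2 / n"

lemma fejer_nonneg: "fejer n t \<ge> 0" by (simp add: fejer_def)

lemma dirichlet_cis: "dirichlet l x = (\<Sum>k\<in>{- int l..int l}. cis (of_int k * x))"
  unfolding dirichlet_def by (simp add: cis_conv_exp mult.assoc)

lemma trig1_dirichlet: "l \<le> n \<Longrightarrow> trig1 n (dirichlet l)"
proof -
  have "dirichlet l = (\<lambda>x. \<Sum>k\<in>{- int l..int l}. 1 * cis (of_int k * x))"
    by (simp add: dirichlet_cis fun_eq_iff)
  then show "l \<le> n \<Longrightarrow> ?thesis" by (simp only:) (intro trig1_sum trig1_cis, auto)
qed

lemma dirichlet_nat: "dirichlet n x = 1 + (\<Sum>k<n. cis (of_nat (n - k) * x) + cis (- (of_nat (n - k) * x)))"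
proof (induction n)
  case 0 then show ?case by (simp add: dirichlet_cis)
next
  case (Suc n)
  have "{- int (Suc n)..int (Suc n)} = insert (- int (Suc n)) (insert (int (Suc n)) {- int n..int n})"
    by auto
  then have "dirichlet (Suc n) x = cis (- (of_nat (Suc n) * x)) + (cis (of_nat (Suc n) * x) + dirichlet n x)"
    unfolding dirichlet_cis by (simp add: algebra_simps)
  then show ?case using Suc by (simp add: sum.lessThan_Suc_shift del: sum.lessThan_Suc)
qed

text \<open>
  Expanding \<open>\<bar>S + z ^ n\<bar>\<^sup>2\<close>, where \<open>S\<close> is the sum over the frequencies below \<open>n\<close>, adds to
  \<open>\<bar>S\<bar>\<^sup>2\<close> exactly the frequencies from \<open>- n\<close> to \<open>n\<close>, each once. So the square is the sum of the
  first \<open>n\<close> Dirichlet kernels.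
\<close>

lemma norm_sum_cis_eq_dirichlet:
  "of_real ((cmod (\<Sum>k<n. cis (of_nat k * x)))\<^sup>2) = (\<Sum>l<n. dirichlet l x)"
proof (induction n)
  case (Suc n)
  let ?S = "\<Sum>k<n. cis (of_nat k * x)"
  have c: "cnj ?S = (\<Sum>k<n. cis (- (of_nat k * x)))"
    by (simp add: cis_cnj)
  have "of_real ((cmod (\<Sum>k<Suc n. cis (of_nat k * x)))\<^sup>2) =
      (?S + cis (of_nat n * x)) * (cnj ?S + cis (- (of_nat n * x)))"
    by (simp add: complex_norm_square cis_cnj del: of_real_power)
  also have "\<dots> = ?S * cnj ?S + (?S * cis (- (of_nat n * x)) + cis (of_nat n * x) * cnj ?S
      + cis (of_nat n * x) * cis (- (of_nat n * x)))"
    by (simp only: ring_distribs add_ac)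
  also have "?S * cis (- (of_nat n * x)) = (\<Sum>k<n. cis (- (of_nat (n - k) * x)))"
    unfolding sum_distrib_right by (intro sum.cong refl) (simp add: cis_mult of_nat_diff algebra_simps)
  also have "cis (of_nat n * x) * cnj ?S = (\<Sum>k<n. cis (of_nat (n - k) * x))"
    unfolding c sum_distrib_left by (intro sum.cong refl) (simp add: cis_mult of_nat_diff algebra_simps)
  also have "?S * cnj ?S = (\<Sum>l<n. dirichlet l x)"
    using Suc by (simp add: complex_norm_square del: of_real_power)
  finally show ?case
    by (simp add: dirichlet_nat[of n] cis_mult sum.distrib add_ac)
qed simp

lemma fejer_dirichlet: "of_real (fejer n x) = (\<Sum>l<n. dirichlet l x) / of_nat n"
  unfolding fejer_def of_real_divide norm_sum_cis_eq_dirichlet by simp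

lemma trig1_fejer: "n \<le> Suc m \<Longrightarrow> trig1 m (\<lambda>x. of_real (fejer n x))"
proof -
  assume "n \<le> Suc m"
  have "(\<lambda>x. of_real (fejer n x)) = (\<lambda>x. (1 / of_nat n) * (\<Sum>l<n. dirichlet l x))"
    by (simp add: fejer_dirichlet)
  then show ?thesis using \<open>n \<le> Suc m\<close> by (simp only:) (intro trig1_cmult trig1_sum trig1_dirichlet, auto)
qed

text \<open>
  The sum of the Dirichlet kernels of orders \<open>n\<close> to \<open>2 * n - 1\<close> is a difference of two Fejer sums.
  Replacing the difference by a sum gives a positive kernel of mean \<open>3\<close> above the modulus of the
  de la Vallee Poussin kernel; every operator norm below is computed from this kernel.
\<close>

lemma vallee_poussin1_fejer:
  assumes "n \<ge> 1"
  shows "vallee_poussin1 n x = of_real (2 * fejer (2 * n) x - fejer n x)"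
proof -
  have e: "{..<2*n} = {..<n} \<union> {n..2*n-1}" using assms by auto
  have "(\<Sum>l<2*n. dirichlet l x) = (\<Sum>l<n. dirichlet l x) + (\<Sum>l\<in>{n..2*n-1}. dirichlet l x)"
    unfolding e by (rule sum.union_disjoint) auto
  then have "vallee_poussin1 n x = ((\<Sum>l<2*n. dirichlet l x) - (\<Sum>l<n. dirichlet l x)) / of_nat n"
    by (simp add: vallee_poussin1_def)
  also have "\<dots> = 2 * ((\<Sum>l<2*n. dirichlet l x) / of_nat (2 * n)) - (\<Sum>l<n. dirichlet l x) / of_nat n"
    using assms by (simp add: diff_divide_distrib)
  finally show ?thesis by (simp add: fejer_dirichlet)
qed

lemma norm_vallee_poussin1_le: "n \<ge> 1 \<Longrightarrow> norm (vallee_poussin1 n x) \<le> 2 * fejer (2 * n) x + fejer n x"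
  using fejer_nonneg[of n x] fejer_nonneg[of "2*n" x]
  unfolding vallee_poussin1_fejer norm_of_real by linarith

lemma trig1_vallee_poussin1: "trig1 (2 * n - 1) (vallee_poussin1 n)"
proof -
  have "vallee_poussin1 n = (\<lambda>x. (1 / of_nat n) * (\<Sum>l=n..2*n-1. dirichlet l x))"
    by (simp add: vallee_poussin1_def fun_eq_iff)
  then show ?thesis by (simp only:) (intro trig1_cmult trig1_sum trig1_dirichlet, auto)
qed

lemma continuous_dirichlet: "continuous_on S (dirichlet l)"
  using trig1_continuous[OF trig1_dirichlet[OF order_refl]] .

lemma continuous_cis_dirichlet: "continuous_on S (\<lambda>t. cis (of_int k * t) * dirichlet l t)"
  by (intro continuous_intros continuous_dirichlet)

lemma mean_cis_dirichlet: "mean (\<lambda>t. cis (of_int k * t) * dirichlet l t) = (if \<bar>k\<bar> \<le> int l then 1 else 0)"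
proof -
  have "mean (\<lambda>t. cis (of_int k * t) * dirichlet l t) = mean (\<lambda>t. \<Sum>a\<in>{- int l..int l}. cis (of_int (k + a) * t))"
    by (simp add: dirichlet_cis sum_distrib_left cis_mult algebra_simps)
  also have "\<dots> = (\<Sum>a\<in>{- int l..int l}. if k + a = 0 then 1 else 0)"
    by (subst mean_sum) (simp_all add: mean_cis continuous_intros del: of_int_add)
  also have "\<dots> = (\<Sum>a\<in>{- int l..int l}. if a = - k then 1 else 0)"
    by (intro sum.cong) auto
  finally show ?thesis by auto
qed

lemma mean_fejer: "n \<ge> 1 \<Longrightarrow> mean (\<lambda>t. of_real (fejer n t)) = 1"
proof -
  assume n: "n \<ge> 1"
  have "mean (\<lambda>t. of_real (fejer n t)) = mean (\<lambda>t. (1 / of_nat n) * (\<Sum>l<n. dirichlet l t))"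
    by (simp add: fejer_dirichlet)
  also have "\<dots> = 1 / of_nat n * (\<Sum>l<n. mean (dirichlet l))"
    by (simp only: mean_cmult mean_sum finite_lessThan continuous_dirichlet)
  also have "\<dots> = 1" using n mean_cis_dirichlet[of 0] by simp
  finally show ?thesis .
qed

text \<open>
  All Dirichlet kernels that are averaged have order at least \<open>n\<close>, so each of them has coefficient
  \<open>1\<close> at every frequency up to \<open>n\<close>.
\<close>

lemma mean_cis_vallee_poussin1:
  assumes "n \<ge> 1" "\<bar>k\<bar> \<le> int n"
  shows "mean (\<lambda>t. cis (of_int k * t) * vallee_poussin1 n t) = 1"
proof -
  have "mean (\<lambda>t. cis (of_int k * t) * vallee_poussin1 n t) =
    mean (\<lambda>t. (1 / of_nat n) * (\<Sum>l=n..2*n-1. cis (of_int k * t) * dirichlet l t))"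
    by (simp add: vallee_poussin1_def sum_distrib_left sum_divide_distrib)
  also have "\<dots> = 1 / of_nat n * (\<Sum>l=n..2*n-1. mean (\<lambda>t. cis (of_int k * t) * dirichlet l t))"
    by (simp only: mean_cmult mean_sum finite_atLeastAtMost continuous_cis_dirichlet)
  also have "\<dots> = 1"
  proof -
    have "(\<Sum>l=n..2*n-1. mean (\<lambda>t. cis (of_int k * t) * dirichlet l t)) = (\<Sum>l=n..2*n-1. 1)"
      using assms by (intro sum.cong) (auto simp: mean_cis_dirichlet)
    then show ?thesis using assms by simp
  qed
  finally show ?thesis .
qed

lemma continuous_fejer: "continuous_on S (fejer n)"
  unfolding fejer_def divide_inverse by (intro continuous_intros)

lemma continuous_vallee_poussin1: "continuous_on S (vallee_poussin1 n)"
  using trig1_continuous[OF trig1_vallee_poussin1] .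

lemma norm_vallee_poussin_mean_le:
  assumes c: "continuous_on UNIV F" and n: "n \<ge> 1" and b: "\<And>t. norm (F t) \<le> B"
  shows "norm (mean (\<lambda>t. F t * vallee_poussin1 n t)) \<le> 3 * B"
proof -
  have B: "B \<ge> 0" using b[of 0] norm_ge_zero order_trans by blast
  have "norm (mean (\<lambda>t. F t * vallee_poussin1 n t)) \<le> Re (mean (\<lambda>t. of_real (B * (2 * fejer (2*n) t + fejer n t))))"
  proof (rule mean_mono_norm)
    show "norm (F t * vallee_poussin1 n t) \<le> B * (2 * fejer (2*n) t + fejer n t)" for t
      unfolding norm_mult by (intro mult_mono b norm_vallee_poussin1_le n norm_ge_zero B)
  qed (intro continuous_intros c continuous_vallee_poussin1 continuous_fejer)+
  also have "mean (\<lambda>t. of_real (B * (2 * fejer (2*n) t + fejer n t))) = of_real B * (2 * mean (\<lambda>t. of_real (fejer (2*n) t)) + mean (\<lambda>t. of_real (fejer n t)))"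
    unfolding of_real_mult of_real_add of_real_numeral
    by (subst mean_cmult, subst mean_add) (auto simp: mean_cmult intro!: continuous_intros continuous_fejer)
  finally show ?thesis using n by (simp add: mean_fejer)
qed

text \<open>
  Convolution with the kernel fixes every polynomial of degree \<open>n\<close> and has norm at most \<open>3\<close>.
  Applied to \<open>F - p\<close> it shows that the convolution of \<open>F\<close> misses \<open>F\<close> by at most \<open>1 + 3\<close> times
  the error of any competitor \<open>p\<close>, however that competitor was found. The statement is at the
  point \<open>0\<close> since a translate of \<open>F\<close> may be taken for \<open>F\<close>.
\<close>

lemma vallee_poussin_near_best:
  assumes c: "continuous_on UNIV F" and p: "trig1 n p" and n: "n \<ge> 1"
    and e: "\<And>t. norm (F t - p t) \<le> \<epsilon>"
  shows "norm (F 0 - mean (\<lambda>t. F t * vallee_poussin1 n t)) \<le> 4 * \<epsilon>"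
proof -
  obtain c' where pc: "\<And>x. p x = (\<Sum>k\<in>{- int n..int n}. c' k * cis (of_int k * x))"
    using p unfolding trig1_def by blast
  have cp: "continuous_on UNIV p" by (rule trig1_continuous[OF p])
  have "mean (\<lambda>t. p t * vallee_poussin1 n t) =
      mean (\<lambda>t. \<Sum>k\<in>{- int n..int n}. c' k * (cis (of_int k * t) * vallee_poussin1 n t))"
    by (simp add: pc sum_distrib_right mult.assoc)
  also have "\<dots> = (\<Sum>k\<in>{- int n..int n}. c' k * mean (\<lambda>t. cis (of_int k * t) * vallee_poussin1 n t))"
    by (subst mean_sum) (simp_all add: mean_cmult continuous_intros continuous_vallee_poussin1)
  also have "\<dots> = (\<Sum>k\<in>{- int n..int n}. c' k * 1)"
    using n by (intro sum.cong refl) (subst mean_cis_vallee_poussin1, auto)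
  also have "\<dots> = p 0" by (simp add: pc)
  finally have p0: "mean (\<lambda>t. p t * vallee_poussin1 n t) = p 0" .
  have "F 0 - mean (\<lambda>t. F t * vallee_poussin1 n t) =
      (F 0 - p 0) - mean (\<lambda>t. (F t - p t) * vallee_poussin1 n t)"
    unfolding left_diff_distrib
    by (subst mean_diff) (auto simp: p0 intro!: continuous_intros c cp continuous_vallee_poussin1)
  also have "norm \<dots> \<le> \<epsilon> + 3 * \<epsilon>"
    by (rule norm_triangle_le_diff) (intro add_mono e norm_vallee_poussin_mean_le continuous_intros c cp n)
  finally show ?thesis by simp
qed

section \<open>Approximation of functions with small differences\<close>

text \<open>
  The modulus is \<open>2 * \<bar>sin (x / 2)\<bar>\<close>. On \<open>{0..pi / 2}\<close> the sine is at least a quarter of its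
  argument: up to \<open>pi / 3\<close> because its derivative is at least \<open>1 / 2\<close>, beyond because it is at least
  \<open>1 / 2\<close> and \<open>pi < 4\<close>.
\<close>

lemma norm_one_minus_cis:
  assumes "\<bar>x\<bar> \<le> pi" shows "\<bar>x\<bar> / 4 \<le> norm (1 - cis x)"
proof -
  have sin: "y / 4 \<le> sin y" if "0 \<le> y" "y \<le> pi / 2" for y
  proof (cases "y \<le> pi / 3")
    case True
    have "sin 0 - 0 / 4 \<le> sin y - y / 4"
    proof (rule DERIV_nonneg_imp_nondecreasing[OF that(1)])
      fix t assume t: "0 \<le> t" "t \<le> y"
      then have "cos (pi / 3) \<le> cos t" using True pi_gt_zero by (intro cos_monotone_0_pi_le) auto
      then have "cos t - 1 / 4 \<ge> 0" by (simp add: cos_60)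
      then show "\<exists>z. ((\<lambda>t. sin t - t / 4) has_real_derivative z) (at t) \<and> 0 \<le> z"
        by (intro exI[of _ "cos t - 1 / 4"]) (auto intro!: derivative_eq_intros)
    qed
    then show ?thesis by simp
  next
    case False
    then have "sin (pi / 6) \<le> sin y" using that pi_gt_zero by (intro sin_monotone_2pi_le) auto
    then show ?thesis using that pi_less_4 by (simp add: sin_30)
  qed
  have "norm (1 - cis x) = 2 * \<bar>sin (x / 2)\<bar>"
    using dist_exp_i_1[of x] by (simp add: cis_conv_exp norm_minus_commute)
  moreover have "\<bar>sin (x / 2)\<bar> \<ge> \<bar>x\<bar> / 8"
    using sin[of "x / 2"] sin[of "- x / 2"] assms by (cases "x \<ge> 0") auto
  ultimately show ?thesis by simp
qed

definition diff1 :: "real \<Rightarrow> (real \<Rightarrow> complex) \<Rightarrow> real \<Rightarrow> complex" where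
  "diff1 h F x = F (x + h) - F x"

text \<open>
  The \<open>d k\<close> are signed binomial coefficients. Only \<open>d 0\<close>, the coefficient of the undisplaced value,
  matters below: since it is a sign, averaging the difference over \<open>h\<close> recovers \<open>F x\<close> up to
  averages of the displaced values.
\<close>

lemma iterated_diff1_eq_sum:
  "\<exists>d :: nat \<Rightarrow> complex. d 0 = (-1) ^ l \<and> (\<forall>F h x. (diff1 h ^^ l) F x = (\<Sum>k\<le>l. d k * F (x + of_nat k * h)))"
proof (induction l)
  case 0
  show ?case by (rule exI[of _ "\<lambda>k. 1"]) simp
next
  case (Suc l)
  then obtain d :: "nat \<Rightarrow> complex" where d: "d 0 = (-1) ^ l" "\<And>F h x. (diff1 h ^^ l) F x = (\<Sum>k\<le>l. d k * F (x + of_nat k * h))"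
    by blast
  define d' where "d' k = (case k of 0 \<Rightarrow> 0 | Suc j \<Rightarrow> d j) - (if k \<le> l then d k else 0)" for k
  have "(diff1 h ^^ Suc l) F x = (\<Sum>k\<le>Suc l. d' k * F (x + of_nat k * h))" for F h x
  proof -
    have "(diff1 h ^^ Suc l) F x = (\<Sum>k\<le>l. d k * F (x + h + of_nat k * h)) - (\<Sum>k\<le>l. d k * F (x + of_nat k * h))"
      by (simp add: diff1_def d)
    also have "(\<Sum>k\<le>l. d k * F (x + h + of_nat k * h)) = (\<Sum>k\<le>Suc l. (case k of 0 \<Rightarrow> 0 | Suc j \<Rightarrow> d j) * F (x + of_nat k * h))"
      unfolding sum.atMost_Suc_shift by (simp add: algebra_simps)
    also have "(\<Sum>k\<le>l. d k * F (x + of_nat k * h)) = (\<Sum>k\<le>Suc l. (if k \<le> l then d k else 0) * F (x + of_nat k * h))"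
      by (simp add: sum.atMost_Suc)
    finally show ?thesis unfolding d'_def by (simp add: sum_subtractf left_diff_distrib del: sum.atMost_Suc)
  qed
  moreover have "d' 0 = (-1) ^ Suc l" by (simp add: d'_def d)
  ultimately show ?case by blast
qed

text \<open>
  Call the mean \<open>G x\<close>. Substituting \<open>t + u / k\<close> for \<open>t\<close> shows that translating \<open>x\<close> by \<open>u\<close>
  multiplies \<open>G\<close> by \<open>cis (- a * u / k)\<close>, so \<open>G\<close> is a multiple of one exponential of frequency
  \<open>- a / k\<close>. As \<open>G\<close> is also \<open>2 * pi\<close>-periodic, it vanishes unless this frequency is an
  integer; in either case the degree does not exceed \<open>\<bar>a\<bar>\<close>.
\<close>

lemma mean_dilate_cis:
  assumes c: "continuous_on UNIV F" and per: "\<And>t. F (t + 2 * pi) = F t" and k: "k \<ge> 1" and a: "\<bar>a\<bar> \<le> int n"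
  shows "trig1 n (\<lambda>x. mean (\<lambda>t. cis (of_int a * t) * F (x + of_nat k * t)))"
proof -
  define G where "G x = mean (\<lambda>t. cis (of_int a * t) * F (x + of_nat k * t))" for x
  have perk: "F (x + of_nat j * (2 * pi)) = F x" for j :: nat and x
    using periodic_int[of F x "int j", OF per] by simp
  have sh: "G (x + u) = cis (- of_int a * (u / k)) * G x" for x u
  proof -
    let ?p = "\<lambda>t. cis (of_int a * t) * F (x + of_nat k * t)"
    have "?p (t + 2 * pi) = ?p t" for t
      using perk[of "x + of_nat k * t" k] cis_multiple_2pi[of "of_int a"] by (simp add: algebra_simps flip: cis_mult)
    moreover have "continuous_on UNIV ?p" by (intro continuous_intros continuous_on_compose2[OF c]) auto
    ultimately have "mean (\<lambda>t. ?p (t + u / k)) = mean ?p" by (intro mean_shift) auto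
    moreover have "?p (t + u / k) = cis (of_int a * (u / k)) * (cis (of_int a * t) * F (x + u + of_nat k * t))" for t
      using k by (simp add: algebra_simps flip: cis_mult)
    ultimately have "cis (of_int a * (u / k)) * G (x + u) = G x"
      unfolding G_def by (simp only: mean_cmult)
    then have "cis (- of_int a * (u / k)) * (cis (of_int a * (u / k)) * G (x + u)) = cis (- of_int a * (u / k)) * G x" by simp
    then show ?thesis unfolding mult.assoc[symmetric] cis_mult by simp
  qed
  show ?thesis
  proof (cases "int k dvd a")
    case True
    then obtain b where b: "a = int k * b" ..
    define g0 where "g0 = G 0"
    have "G x = g0 * cis (of_int (- b) * x)" for x
      unfolding g0_def using sh[of 0 x] k by (simp add: b mult.commute)
    then have "(\<lambda>x. G x) = (\<lambda>x. g0 * cis (of_int (- b) * x))" ..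
    moreover have "\<bar>- b\<bar> \<le> int n"
    proof -
      have "\<bar>b\<bar> * 1 \<le> \<bar>b\<bar> * int k" using k by (intro mult_left_mono) auto
      then show ?thesis using a by (simp add: b abs_mult mult.commute)
    qed
    ultimately have "trig1 n (\<lambda>x. G x)" by (simp only: trig1_cis)
    then show ?thesis unfolding G_def .
  next
    case False
    have "G x = 0" for x
    proof (rule ccontr)
      assume "G x \<noteq> 0"
      moreover have "G (x + 2 * pi) = G x"
      proof -
        have "F (x + 2 * pi + of_nat k * t) = F (x + of_nat k * t)" for t
          using per[of "x + of_nat k * t"] by (simp add: add_ac)
        then show ?thesis unfolding G_def by simp
      qed
      ultimately have "cis (- of_int a * (2 * pi / k)) = 1" using sh[of x "2 * pi"] by simp
      then have "cos (- of_int a * (2 * pi / k)) = 1" by (metis cis.sel(1) one_complex.sel(1))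
      then obtain j :: int where "- of_int a * (2 * pi / k) = of_int j * 2 * pi"
        unfolding cos_one_2pi_int by blast
      then have "(2 * pi) * real_of_int (- a) = (2 * pi) * of_int (int k * j)" using k by (simp add: field_simps)
      then have "real_of_int (- a) = of_int (int k * j)" using pi_gt_zero by (subst (asm) mult_cancel_left) auto
      then have "a = int k * (- j)" unfolding of_int_eq_iff by simp
      then show False using False by simp
    qed
    then have "trig1 n (\<lambda>x. G x)" by (simp add: trig1_zero)
    then show ?thesis unfolding G_def .
  qed
qed

lemma mean_dilate_trig1:
  assumes c: "continuous_on UNIV F" and per: "\<And>t. F (t + 2 * pi) = F t" and k: "k \<ge> 1" and J: "trig1 n J"
  shows "trig1 n (\<lambda>x. mean (\<lambda>t. J t * F (x + of_nat k * t)))"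
proof -
  obtain b where b: "\<And>x. J x = (\<Sum>a\<in>{- int n..int n}. b a * cis (of_int a * x))"
    using J unfolding trig1_def by blast
  have "(\<lambda>x. mean (\<lambda>t. J t * F (x + of_nat k * t))) =
     (\<lambda>x. \<Sum>a\<in>{- int n..int n}. b a * mean (\<lambda>t. cis (of_int a * t) * F (x + of_nat k * t)))"
    unfolding b sum_distrib_right mult.assoc
    by (subst mean_sum) (auto simp: mean_cmult intro!: continuous_intros continuous_on_compose2[OF c])
  then show ?thesis by (simp only:) (intro trig1_sum trig1_cmult mean_dilate_cis c per k, auto)
qed

text \<open>
  Multiplying the geometric sum by \<open>1 - cis t\<close> telescopes it to \<open>1 - cis (n * t)\<close>, which has
  modulus at most \<open>2\<close>.
\<close>

lemma fejer_times_norm: "(norm (1 - cis t))\<^sup>2 * fejer n t \<le> 4 / n"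
proof -
  have "(1 - cis t) * (\<Sum>k<n. cis (of_nat k * t)) = 1 - cis (of_nat n * t)"
    using one_diff_power_eq[of "cis t" n] by (simp add: Complex.DeMoivre)
  then have "norm (1 - cis t) * norm (\<Sum>k<n. cis (of_nat k * t)) = norm (1 - cis (of_nat n * t))"
    by (metis norm_mult)
  also have "\<dots> \<le> 2" using norm_triangle_ineq4[of 1 "cis (of_nat n * t)"] by simp
  finally have "(norm (1 - cis t) * norm (\<Sum>k<n. cis (of_nat k * t)))\<^sup>2 \<le> 2\<^sup>2" by (intro power_mono) auto
  then show ?thesis by (simp add: fejer_def power_mult_distrib divide_right_mono)
qed

text \<open>
  For \<open>\<bar>t\<bar> \<le> 1 / n\<close> all \<open>n\<close> exponentials have real part at least \<open>1 / 2\<close>.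
\<close>

lemma fejer_near_0:
  assumes "\<bar>t\<bar> \<le> 1 / n" "n \<ge> 1" shows "fejer n t \<ge> n / 4"
proof -
  have "Re (\<Sum>k<n. cis (of_nat k * t)) \<ge> (\<Sum>k<n. 1 / 2)"
    unfolding Re_sum
  proof (intro sum_mono)
    fix k assume "k \<in> {..<n}"
    then have "\<bar>real k * t\<bar> \<le> real n * (1 / n)" using assms unfolding abs_mult by (intro mult_mono) auto
    also have "\<dots> = 1" using assms by simp
    finally have "\<bar>real k * t\<bar> \<le> 1" .
    then have "cos \<bar>real k * t\<bar> \<ge> cos (pi / 3)" using pi_gt3 by (intro cos_monotone_0_pi_le) auto
    then show "1 / 2 \<le> Re (cis (real k * t))" by (simp add: cos_60)
  qed
  then have "real n / 2 \<le> cmod (\<Sum>k<n. cis (of_nat k * t))" by (intro order_trans[OF _ complex_Re_le_cmod]) simp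
  then have "(real n / 2)\<^sup>2 \<le> (cmod (\<Sum>k<n. cis (of_nat k * t)))\<^sup>2" by (intro power_mono) auto
  then have "(real n / 2)\<^sup>2 / n \<le> fejer n t" unfolding fejer_def by (intro divide_right_mono) auto
  then show ?thesis using of_nat_0_le_iff by (simp add: power2_eq_square fejer_def split: if_splits)
qed

text \<open>
  The interval of length \<open>1 / M\<close> on which the Fejer kernel is at least \<open>M / 4\<close> already contributes
  the order \<open>M ^ q\<close>; this is the normalization of the Jackson kernel.
\<close>

lemma mean_fejer_power:
  assumes "M \<ge> 1"
  obtains i where "mean (\<lambda>t. of_real (fejer M t ^ Suc q)) = of_real i" "i \<ge> real M ^ q / (8 * pi * 4 ^ q)"
proof
  let ?J = "\<lambda>t. fejer M t ^ Suc q"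
  have c: "continuous_on S ?J" for S by (intro continuous_intros continuous_fejer)
  have i: "?J integrable_on {a..b}" for a b by (intro integrable_continuous_real c)
  show "mean (\<lambda>t. of_real (?J t)) = of_real (integral {0..2*pi} ?J / (2 * pi))"
    unfolding mean_def
    using integral_unique[OF has_integral_of_real[OF integrable_integral[OF i]], of 0 "2*pi"] by (simp del: of_real_power power_Suc)
  have "1 / real M \<le> 1" using assms by simp
  then have M: "1 / real M \<le> 2 * pi" using pi_gt3 by linarith
  have "integral {0..1 / real M} (\<lambda>t. (real M / 4) ^ Suc q) \<le> integral {0..1 / real M} ?J"
    using assms by (intro integral_le i power_mono fejer_near_0) auto
  also have "\<dots> \<le> integral {0..2*pi} ?J"
    using M by (intro integral_subset_le i) (auto simp: fejer_nonneg)
  finally have "real M ^ q / 4 ^ Suc q \<le> integral {0..2*pi} ?J"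
    using assms by (simp add: power_divide)
  then have "real M ^ q / 4 ^ Suc q / (2 * pi) \<le> integral {0..2*pi} ?J / (2 * pi)"
    by (intro divide_right_mono) auto
  then show "real M ^ q / (8 * pi * 4 ^ q) \<le> integral {0..2*pi} ?J / (2 * pi)" by (simp add: mult_ac)
qed

text \<open>
  Average the \<open>l\<close>-th difference of \<open>F\<close> over its step \<open>t\<close> against the Jackson kernel, the normalized
  power \<open>q + 1\<close> of a Fejer kernel of order \<open>M\<close>. The terms with displacement \<open>k * t\<close>, \<open>k \<ge> 1\<close>, are
  trigonometric polynomials by \<open>mean_dilate_trig1\<close> and form the approximant; the undisplaced term is
  \<open>F x\<close>. The error is the moment of order \<open>r\<close> of the kernel. It is of order \<open>M powr - r\<close> because
  \<open>(M * \<delta>) powr r \<le> 1 + (M * \<delta>) ^ (2 * q)\<close> and the even moment costs \<open>q\<close> of the \<open>q + 1\<close> Fejer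
  factors, leaving one of mean \<open>1\<close>.
\<close>

lemma jackson_trig_approximation:
  assumes r: "r > 0"
  shows "\<exists>C\<ge>0. \<forall>F n. n \<ge> 1 \<longrightarrow> continuous_on UNIV F \<longrightarrow> (\<forall>t. F (t + 2 * pi) = F t) \<longrightarrow>
    (\<forall>h x. norm ((diff1 h ^^ l) F x) \<le> \<bar>h\<bar> powr r) \<longrightarrow>
    (\<exists>p. trig1 n p \<and> (\<forall>x. norm (F x - p x) \<le> C * real n powr (- r)))"
proof -
  define q where "q = nat \<lceil>r\<rceil>"
  have q: "r \<le> real (2 * q)" unfolding q_def using r by linarith
  define A where "A = 1 + 64 ^ q * (8 * pi * 4 ^ q)"
  define C where "C = (real (q + 1)) powr r * A"
  have A: "A \<ge> 0" unfolding A_def by simp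
  show ?thesis
  proof (intro exI[of _ C] conjI allI impI)
    show "C \<ge> 0" unfolding C_def using A by simp
    fix F :: "real \<Rightarrow> complex" and n :: nat
    assume n: "n \<ge> 1" and c: "continuous_on UNIV F" and per': "\<forall>t. F (t + 2 * pi) = F t"
      and D: "\<forall>h x. norm ((diff1 h ^^ l) F x) \<le> \<bar>h\<bar> powr r"
    have per: "F (t + 2 * pi) = F t" for t using per' by blast
    \<comment> \<open>The largest order for which the power \<open>q + 1\<close> of the kernel still has degree at most \<open>n\<close>.\<close>
    define M where "M = n div (q + 1) + 1"
    have M1: "M \<ge> 1" by (simp add: M_def)
    have "n < M * (q + 1)" using dividend_less_div_times[of "q + 1" n] by (simp add: M_def algebra_simps)
    then have Mn: "real n / real (q + 1) \<le> real M"
    proof -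
      have "real n \<le> real (M * (q + 1))" using \<open>n < M * (q + 1)\<close> by (intro of_nat_mono) simp
      then show ?thesis unfolding of_nat_mult by (simp only: pos_divide_le_eq of_nat_0_less_iff)
    qed
    obtain i where i: "mean (\<lambda>t. of_real (fejer M t ^ Suc q)) = of_real i" "i \<ge> real M ^ q / (8 * pi * 4 ^ q)"
      using mean_fejer_power[OF M1] .
    have ip: "i > 0" using i(2) M1 by (intro less_le_trans[OF _ i(2)]) simp
    obtain d :: "nat \<Rightarrow> complex" where d: "d 0 = (-1) ^ l"
        "\<And>F h x. (diff1 h ^^ l) F x = (\<Sum>k\<le>l. d k * F (x + of_nat k * h))"
      using iterated_diff1_eq_sum[of l] by blast
    define J where "J t = complex_of_real (fejer M t ^ Suc q)" for t
    have cJ: "continuous_on S J" for S unfolding J_def by (intro continuous_intros continuous_fejer)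
    have J: "trig1 n J"
    proof -
      have "trig1 ((M - 1) * Suc q) (\<lambda>t. of_real (fejer M t) ^ Suc q)"
        by (intro trig1_power trig1_fejer) simp
      then show ?thesis unfolding J_def of_real_power
        by (rule trig1_mono) (use div_times_less_eq_dividend[of n "q + 1"] in \<open>simp only: M_def Suc_eq_plus1 add_diff_cancel_right'\<close>)
    qed
    define G where "G k x = mean (\<lambda>t. J t * F (x + of_nat k * t))" for k :: nat and x
    have G0: "G 0 x = of_real i * F x" for x
    proof -
      have "mean J = of_real i" using i(1) unfolding J_def[symmetric] by simp
      moreover have "G 0 x = mean (\<lambda>t. F x * J t)" by (simp add: G_def mult.commute)
      ultimately show ?thesis by (simp add: mean_cmult)
    qed
    define p where "p x = (\<Sum>k\<in>{1..l}. (- ((-1) ^ l * d k / of_real i)) * G k x)" for x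
    have tp: "trig1 n p"
      unfolding p_def G_def by (intro trig1_sum trig1_cmult mean_dilate_trig1 c per J) simp
    have dm: "mean (\<lambda>t. J t * (diff1 t ^^ l) F x) = (\<Sum>k\<le>l. d k * G k x)" for x
    proof -
      have "mean (\<lambda>t. J t * (diff1 t ^^ l) F x) = mean (\<lambda>t. \<Sum>k\<le>l. d k * (J t * F (x + of_nat k * t)))"
        unfolding d(2) by (simp add: sum_distrib_left mult_ac)
      also have "\<dots> = (\<Sum>k\<le>l. mean (\<lambda>t. d k * (J t * F (x + of_nat k * t))))"
        by (rule mean_sum) (auto intro!: continuous_intros cJ continuous_on_compose2[OF c])
      finally show ?thesis by (simp only: mean_cmult G_def)
    qed
    \<comment> \<open>The approximant is minus the normalized sum of the displaced terms, so only the averaged difference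
      remains.\<close>
    have Fp: "F x - p x = (-1) ^ l / of_real i * mean (\<lambda>t. J t * (diff1 t ^^ l) F x)" for x
    proof -
      have "{..l} = insert 0 {1..l}" by auto
      then have "(\<Sum>k\<le>l. d k * G k x) = (-1) ^ l * (of_real i * F x) + (\<Sum>k\<in>{1..l}. d k * G k x)"
        by (simp add: d(1) G0)
      then have "(-1) ^ l / of_real i * mean (\<lambda>t. J t * (diff1 t ^^ l) F x) =
          ((-1) ^ l * (-1) ^ l) * F x + (-1) ^ l / of_real i * (\<Sum>k\<in>{1..l}. d k * G k x)"
        unfolding dm using ip by (simp add: distrib_left)
      also have "(-1) ^ l * (-1) ^ l = (1 :: complex)" by (simp flip: power_mult_distrib)
      also have "(-1) ^ l / of_real i * (\<Sum>k\<in>{1..l}. d k * G k x) = - p x"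
        by (simp add: p_def sum_distrib_left sum_negf mult_ac)
      finally show ?thesis by simp
    qed
    have key: "norm (J t * (diff1 t ^^ l) F x) \<le> real M powr (- r) * (fejer M t ^ Suc q + (64 * real M) ^ q * fejer M t)"
      if t: "0 \<le> t" "t \<le> 2 * pi" for t x
    proof -
      \<comment> \<open>The distance of \<open>t\<close> to the nearest multiple of \<open>2 * pi\<close>, with sign: for \<open>t > pi\<close> the step \<open>t\<close>
        may be replaced by \<open>t - 2 * pi\<close> since \<open>F\<close> is periodic.\<close>
      obtain \<delta> where \<delta>: "norm ((diff1 t ^^ l) F x) \<le> \<bar>\<delta>\<bar> powr r" "\<bar>\<delta>\<bar> / 4 \<le> norm (1 - cis t)"
      proof (cases "t \<le> pi")
        case True
        show ?thesis by (rule that[of t]) (use D[rule_format, of t x] norm_one_minus_cis[of t] t True in auto)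
      next
        case False
        have "F (x + of_nat k * (t - 2 * pi)) = F (x + of_nat k * t)" for k :: nat
          using periodic_int[of F "x + of_nat k * t" "- int k", OF per] by (simp add: algebra_simps)
        then have "(diff1 t ^^ l) F x = (diff1 (t - 2 * pi) ^^ l) F x" unfolding d(2) by simp
        moreover have "cis (t - 2 * pi) = cis t" by (simp flip: cis_divide)
        ultimately show ?thesis using D[rule_format, of "t - 2 * pi" x] norm_one_minus_cis[of "t - 2 * pi"] t False
          by (intro that[of "t - 2 * pi"]) auto
      qed
      have f0: "fejer M t \<ge> 0" by (rule fejer_nonneg)
      have "\<bar>\<delta>\<bar>\<^sup>2 * fejer M t \<le> (4 * norm (1 - cis t))\<^sup>2 * fejer M t"
        using \<delta>(2) by (intro mult_right_mono power_mono f0) auto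
      also have "\<dots> = 16 * ((norm (1 - cis t))\<^sup>2 * fejer M t)" by (simp add: power_mult_distrib)
      also have "\<dots> \<le> 16 * (4 / M)" by (intro mult_left_mono fejer_times_norm) auto
      finally have "(\<bar>\<delta>\<bar>\<^sup>2 * fejer M t) ^ q \<le> (16 * (4 / M)) ^ q" by (intro power_mono) (auto simp: f0)
      then have "(real M ^ (2 * q)) * (\<bar>\<delta>\<bar>\<^sup>2 * fejer M t) ^ q \<le> (real M ^ (2 * q)) * (16 * (4 / M)) ^ q"
        by (intro mult_left_mono) auto
      also have "\<dots> = (64 * real M) ^ q"
      proof -
        have "(real M)\<^sup>2 * (16 * (4 / M)) = 64 * real M" using M1 by (simp add: power2_eq_square)
        then show ?thesis unfolding power_mult power_mult_distrib[symmetric] by simp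
      qed
      finally have e: "(real M * \<bar>\<delta>\<bar>) ^ (2 * q) * fejer M t ^ q \<le> (64 * real M) ^ q"
        unfolding power_mult power_mult_distrib by (simp only: mult_ac)
      have "(real M * \<bar>\<delta>\<bar>) powr r \<le> 1 + (real M * \<bar>\<delta>\<bar>) ^ (2 * q)"
      proof (cases "real M * \<bar>\<delta>\<bar> \<le> 1")
        case True
        then have "(real M * \<bar>\<delta>\<bar>) powr r \<le> 1" using r by (intro powr_le1) auto
        then show ?thesis by (simp add: add_increasing2)
      next
        case False
        then have "(real M * \<bar>\<delta>\<bar>) powr r \<le> (real M * \<bar>\<delta>\<bar>) powr (real (2 * q))" using q by (intro powr_mono) auto
        also have "\<dots> = (real M * \<bar>\<delta>\<bar>) ^ (2 * q)" using False by (intro powr_realpow) linarith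
        finally show ?thesis by simp
      qed
      then have "fejer M t ^ Suc q * (real M * \<bar>\<delta>\<bar>) powr r \<le> fejer M t ^ Suc q * (1 + (real M * \<bar>\<delta>\<bar>) ^ (2 * q))"
        by (intro mult_left_mono) (auto simp: f0)
      also have "\<dots> = fejer M t ^ Suc q + fejer M t * ((real M * \<bar>\<delta>\<bar>) ^ (2 * q) * fejer M t ^ q)"
        by (simp add: algebra_simps)
      also have "\<dots> \<le> fejer M t ^ Suc q + fejer M t * (64 * real M) ^ q"
        by (intro add_left_mono mult_left_mono e f0)
      finally have k2: "fejer M t ^ Suc q * (real M * \<bar>\<delta>\<bar>) powr r \<le> fejer M t ^ Suc q + (64 * real M) ^ q * fejer M t"
        by (simp add: mult.commute)
      have "norm (J t * (diff1 t ^^ l) F x) \<le> fejer M t ^ Suc q * \<bar>\<delta>\<bar> powr r"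
        unfolding norm_mult J_def norm_of_real using \<delta>(1) f0 by (intro mult_mono) auto
      also have "\<bar>\<delta>\<bar> powr r = real M powr (- r) * (real M * \<bar>\<delta>\<bar>) powr r"
        using M1 by (simp add: powr_mult powr_minus field_simps)
      also have "fejer M t ^ Suc q * \<dots> = real M powr (- r) * (fejer M t ^ Suc q * (real M * \<bar>\<delta>\<bar>) powr r)" by simp
      also have "\<dots> \<le> real M powr (- r) * (fejer M t ^ Suc q + (64 * real M) ^ q * fejer M t)"
        by (intro mult_left_mono k2) auto
      finally show ?thesis .
    qed
    have "norm (F x - p x) \<le> C * real n powr (- r)" for x
    proof -
      let ?q = "\<lambda>t. real M powr (- r) * (fejer M t ^ Suc q + (64 * real M) ^ q * fejer M t)"
      have "norm (mean (\<lambda>t. J t * (diff1 t ^^ l) F x)) \<le> Re (mean (\<lambda>t. of_real (?q t)))"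
        unfolding d(2) by (intro mean_mono_norm key[unfolded d(2)])
          (auto intro!: continuous_intros continuous_on_compose2[OF c] cJ continuous_fejer)
      also have "mean (\<lambda>t. of_real (?q t)) = mean (\<lambda>t. of_real (real M powr (- r)) * (of_real (fejer M t ^ Suc q) + of_real ((64 * real M) ^ q) * of_real (fejer M t)))"
        by (simp only: of_real_mult of_real_add)
      also have "\<dots> = of_real (real M powr (- r)) * (of_real i + of_real ((64 * real M) ^ q))"
        unfolding mean_cmult
        by (subst mean_add) (simp_all add: mean_cmult mean_fejer[OF M1] i(1) continuous_intros continuous_fejer del: of_real_power power_Suc)
      also have "Re \<dots> = real M powr (- r) * (i + (64 * real M) ^ q)"
        by (simp flip: of_real_add of_real_mult of_real_power)
      finally have m: "norm (mean (\<lambda>t. J t * (diff1 t ^^ l) F x)) \<le> real M powr (- r) * (i + (64 * real M) ^ q)" .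
      have "norm (F x - p x) = norm (mean (\<lambda>t. J t * (diff1 t ^^ l) F x)) / i"
        unfolding Fp using ip by (simp add: norm_mult norm_divide norm_power)
      also have "\<dots> \<le> real M powr (- r) * (i + (64 * real M) ^ q) / i"
        using m ip by (intro divide_right_mono) auto
      also have "\<dots> = real M powr (- r) * (1 + (64 * real M) ^ q / i)" using ip by (simp add: field_simps)
      also have "(64 * real M) ^ q / i \<le> (64 * real M) ^ q / (real M ^ q / (8 * pi * 4 ^ q))"
        using i(2) M1 ip by (intro divide_left_mono) auto
      also have "\<dots> = 64 ^ q * (8 * pi * 4 ^ q)" using M1 by (simp add: power_mult_distrib)
      finally have "norm (F x - p x) \<le> real M powr (- r) * A"
        by (simp add: A_def mult_left_mono)
      also have "real M powr (- r) \<le> (real n / real (q + 1)) powr (- r)"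
        using Mn n r by (intro powr_mono2') auto
      also have "(real n / real (q + 1)) powr (- r) = real (q + 1) powr r * real n powr (- r)"
        using n by (simp add: powr_divide powr_minus field_simps)
      finally show ?thesis by (simp add: C_def A mult_right_mono mult_ac)
    qed
    then show "\<exists>p. trig1 n p \<and> (\<forall>x. norm (F x - p x) \<le> C * real n powr (- r))" using tp by blast
  qed
qed

section \<open>Approximation of the Bernoulli kernels in the mean\<close>

text \<open>
  Multiplying the series by \<open>1 - z\<close> turns its coefficients into their differences. Bounded variation
  therefore gives convergence everywhere on the unit circle except at \<open>1\<close>, and a bound in terms of
  the variation; the middle identity allows the step to be repeated on the differences.
\<close>

lemma abel_summation:
  fixes b :: "nat \<Rightarrow> real" and z :: complex
  assumes z: "norm z = 1" "z \<noteq> 1" and b: "b \<longlonglongrightarrow> 0"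
    and W: "\<And>M. (\<Sum>k<M. \<bar>b (Suc k) - b k\<bar>) \<le> W"
  shows "summable (\<lambda>k. of_real (b k) * z ^ k)"
    and "(1 - z) * (\<Sum>k. of_real (b k) * z ^ k) = of_real (b 0) + z * (\<Sum>k. of_real (b (Suc k) - b k) * z ^ k)"
    and "norm (1 - z) * norm (\<Sum>k. of_real (b k) * z ^ k) \<le> \<bar>b 0\<bar> + W"
proof -
  let ?d = "\<lambda>k. of_real (b (Suc k) - b k) * z ^ k"
  have sa: "summable (\<lambda>k. \<bar>b (Suc k) - b k\<bar>)"
    using W[of "Suc _"] by (intro bounded_imp_summable[of _ W]) (auto simp: lessThan_Suc_atMost simp del: sum.lessThan_Suc)
  have nd: "norm (?d k) = \<bar>b (Suc k) - b k\<bar>" for k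
    by (simp only: norm_mult norm_power z norm_of_real) simp
  have sn: "summable (\<lambda>k. norm (?d k))" unfolding nd by (rule sa)
  have sd: "summable ?d" by (rule summable_norm_cancel[OF sn])
  have part: "(1 - z) * (\<Sum>k<M. of_real (b k) * z ^ k) = of_real (b 0) + z * (\<Sum>k<M. ?d k) - of_real (b M) * z ^ M" for M
  proof (induction M)
    case (Suc M)
    define X where "X = (\<Sum>k<M. ?d k)"
    have "(1 - z) * (\<Sum>k<Suc M. of_real (b k) * z ^ k) =
        (1 - z) * (\<Sum>k<M. of_real (b k) * z ^ k) + (1 - z) * (of_real (b M) * z ^ M)"
      by (simp add: distrib_left)
    also have "\<dots> = of_real (b 0) + z * X - of_real (b M) * z ^ M + (1 - z) * (of_real (b M) * z ^ M)"
      unfolding Suc X_def ..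
    also have "\<dots> = of_real (b 0) + z * (X + ?d M) - of_real (b (Suc M)) * z ^ Suc M"
      by (simp add: algebra_simps)
    finally show ?case by (simp add: X_def)
  qed simp
  have "(\<lambda>M. norm (of_real (b M) * z ^ M)) \<longlonglongrightarrow> 0"
    using tendsto_norm[OF b] by (simp add: norm_mult norm_power z)
  then have "(\<lambda>M. of_real (b M) * z ^ M) \<longlonglongrightarrow> 0" by (rule tendsto_norm_zero_cancel)
  then have "(\<lambda>M. of_real (b 0) + z * (\<Sum>k<M. ?d k) - of_real (b M) * z ^ M) \<longlonglongrightarrow> of_real (b 0) + z * (\<Sum>k. ?d k) - 0"
    by (intro tendsto_intros summable_LIMSEQ sd)
  then have "(\<lambda>M. (1 - z) * (\<Sum>k<M. of_real (b k) * z ^ k)) \<longlonglongrightarrow> of_real (b 0) + z * (\<Sum>k. ?d k)"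
    unfolding part by simp
  then have "(\<lambda>M. inverse (1 - z) * ((1 - z) * (\<Sum>k<M. of_real (b k) * z ^ k))) \<longlonglongrightarrow> inverse (1 - z) * (of_real (b 0) + z * (\<Sum>k. ?d k))"
    by (intro tendsto_mult tendsto_const)
  moreover have "inverse (1 - z) * ((1 - z) * w) = w" for w
    using z by (simp add: field_simps)
  ultimately have s: "(\<lambda>k. of_real (b k) * z ^ k) sums (inverse (1 - z) * (of_real (b 0) + z * (\<Sum>k. ?d k)))"
    unfolding sums_def by simp
  show "summable (\<lambda>k. of_real (b k) * z ^ k)" using s by (rule sums_summable)
  show eq: "(1 - z) * (\<Sum>k. of_real (b k) * z ^ k) = of_real (b 0) + z * (\<Sum>k. ?d k)"
    using sums_unique[OF s] z by (simp add: field_simps)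
  have "norm (1 - z) * norm (\<Sum>k. of_real (b k) * z ^ k) = norm (of_real (b 0) + z * (\<Sum>k. ?d k))"
    unfolding eq[symmetric] norm_mult ..
  also have "\<dots> \<le> norm (complex_of_real (b 0)) + norm (z * (\<Sum>k. ?d k))" by (rule norm_triangle_ineq)
  also have "norm (z * (\<Sum>k. ?d k)) = norm (\<Sum>k. ?d k)" by (simp add: norm_mult z)
  also have "norm (\<Sum>k. ?d k) \<le> (\<Sum>k. norm (?d k))" by (rule summable_norm[OF sn])
  also have "\<dots> \<le> W" unfolding nd by (rule suminf_le_const[OF sa W])
  finally show "norm (1 - z) * norm (\<Sum>k. of_real (b k) * z ^ k) \<le> \<bar>b 0\<bar> + W" by simp
qed

text \<open>
  A sequence that rises to its \<open>n\<close>-th term and falls afterwards has a telescoping variation.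
\<close>

lemma unimodal_variation:
  fixes c :: "nat \<Rightarrow> real"
  assumes up: "\<And>k. k < n \<Longrightarrow> c k \<le> c (Suc k)" and down: "\<And>k. k \<ge> n \<Longrightarrow> c (Suc k) \<le> c k"
    and L: "\<And>k. L \<le> c k"
  shows "(\<Sum>k<M. \<bar>c (Suc k) - c k\<bar>) \<le> 2 * c n - c 0 - L"
proof -
  have "(\<Sum>k<M. \<bar>c (Suc k) - c k\<bar>) = (if M \<le> n then c M - c 0 else 2 * c n - c 0 - c M)" for M
  proof (induction M)
    case (Suc M)
    then show ?case using up[of M] down[of M]
      by (cases "M < n"; cases "M = n") auto
  qed simp
  moreover have "c M \<le> c n" if "M \<le> n" using that
  proof (induction M rule: inc_induct)
    case (step k) then show ?case using up[of k] by linarith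
  qed simp
  ultimately show ?thesis using L[of M] L[of n] by auto
qed

lemma powr_diff_bounds:
  assumes k: "k \<ge> 1" and r: "r > 0"
  shows "r * real (Suc k) powr (- r - 1) \<le> real k powr (- r) - real (Suc k) powr (- r)"
    and "real k powr (- r) - real (Suc k) powr (- r) \<le> r * real k powr (- r - 1)"
proof -
  have "\<exists>z::real. real k < z \<and> z < real (Suc k) \<and>
     real (Suc k) powr (- r) - real k powr (- r) = (real (Suc k) - real k) * (- r * z powr (- r - 1))"
  proof (rule MVT2)
    fix x :: real assume "real k \<le> x" "x \<le> real (Suc k)"
    then show "((\<lambda>x. x powr (- r)) has_real_derivative - r * x powr (- r - 1)) (at x)"
      using k by (auto intro!: derivative_eq_intros)
  qed simp
  then obtain z where z: "real k < z" "z < real (Suc k)"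
    "real k powr (- r) - real (Suc k) powr (- r) = r * z powr (- r - 1)" by auto
  show "r * real (Suc k) powr (- r - 1) \<le> real k powr (- r) - real (Suc k) powr (- r)"
    unfolding z(3) using z(1,2) k r by (intro mult_left_mono powr_mono2') auto
  show "real k powr (- r) - real (Suc k) powr (- r) \<le> r * real k powr (- r - 1)"
    unfolding z(3) using z(1,2) k r by (intro mult_left_mono powr_mono2') auto
qed

text \<open>
  The coefficients \<open>k powr - r\<close> of the Bernoulli kernel, replaced below \<open>n\<close> by the line through
  \<open>0\<close> and their value at \<open>n\<close>. The cut at frequency \<open>n\<close> is so smooth that the second differences
  have total size \<open>n powr (- r - 1)\<close>, whereas a sharp cut would give \<open>n powr - r\<close>.
\<close>

definition ramp :: "nat \<Rightarrow> real \<Rightarrow> nat \<Rightarrow> real" where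
  "ramp n r k = (if k < n then real k * real n powr (- r - 1) else real k powr (- r))"

lemma ramp_eq_powr: "k \<ge> n \<Longrightarrow> ramp n r k = real k powr (- r)" by (simp add: ramp_def)

lemma ramp_eq_linear: "k \<le> n \<Longrightarrow> n \<ge> 1 \<Longrightarrow> ramp n r k = real k * real n powr (- r - 1)"
  by (auto simp: ramp_def powr_diff)

lemma ramp_nonneg: "ramp n r k \<ge> 0" by (simp add: ramp_def)

lemma ramp_increment_below: "k < n \<Longrightarrow> n \<ge> 1 \<Longrightarrow> ramp n r (Suc k) - ramp n r k = real n powr (- r - 1)"
  by (simp add: ramp_eq_linear algebra_simps)

lemma ramp_increment_above: "k \<ge> n \<Longrightarrow> ramp n r (Suc k) - ramp n r k = - (real k powr (- r) - real (Suc k) powr (- r))"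
  by (simp add: ramp_eq_powr)

lemma ramp_antimono: "n \<ge> 1 \<Longrightarrow> r > 0 \<Longrightarrow> k \<ge> n \<Longrightarrow> ramp n r (Suc k) \<le> ramp n r k"
  by (auto simp: ramp_eq_powr intro!: powr_mono2')

lemma ramp_tendsto: "r > 0 \<Longrightarrow> ramp n r \<longlonglongrightarrow> 0"
proof -
  assume r: "r > 0"
  have "(\<lambda>k. real k powr (- r)) \<longlonglongrightarrow> 0"
    using r by (intro tendsto_neg_powr filterlim_real_sequentially) auto
  moreover have "eventually (\<lambda>k. real k powr (- r) = ramp n r k) sequentially"
    using eventually_ge_at_top[of n] by eventually_elim (simp add: ramp_eq_powr)
  ultimately show ?thesis by (rule Lim_transform_eventually)
qed

lemma ramp_variation:
  assumes "n \<ge> 1" "r > 0"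
  shows "(\<Sum>k<M. \<bar>ramp n r (Suc k) - ramp n r k\<bar>) \<le> 2 * ramp n r n - ramp n r 0 - 0"
proof (rule unimodal_variation[where n = n])
  fix k assume "k < n"
  then show "ramp n r k \<le> ramp n r (Suc k)"
    using ramp_increment_below[of k n r] assms(1) powr_ge_zero[of "real n" "- r - 1"] by linarith
next
  fix k assume "n \<le> k"
  then show "ramp n r (Suc k) \<le> ramp n r k" by (rule ramp_antimono[OF assms])
next
  fix k show "0 \<le> ramp n r k" by (rule ramp_nonneg)
qed

text \<open>
  The negated first differences equal \<open>- n powr (- r - 1)\<close> below \<open>n\<close>, jump up at \<open>n\<close> to a value of
  the same order, and then decrease to \<open>0\<close> by convexity of the power: again a unimodal sequence.
\<close>

lemma ramp_variation2:
  assumes "n \<ge> 1" "r > 0"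
  defines "c \<equiv> (\<lambda>k. ramp n r (Suc k) - ramp n r k)"
  shows "(\<Sum>k<M. \<bar>c (Suc k) - c k\<bar>) \<le> (2 * r + 2) * real n powr (- r - 1)"
proof -
  have cn: "- c k \<le> r * real k powr (- r - 1)" "r * real (Suc k) powr (- r - 1) \<le> - c k" if "k \<ge> n" for k
    unfolding c_def ramp_increment_above[OF that] minus_minus using powr_diff_bounds[of k r] assms that by auto
  have pos: "- c k \<ge> 0" if "k \<ge> n" for k
    using cn(2)[OF that] assms order_trans[OF _ cn(2)[OF that], of 0] by auto
  have up: "c k = real n powr (- r - 1)" if "k < n" for k
    unfolding c_def using ramp_increment_below that assms by simp
  have "(\<Sum>k<M. \<bar>(- c (Suc k)) - (- c k)\<bar>) \<le> 2 * (- c n) - (- c 0) - (- (real n powr (- r - 1)))"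
  proof (rule unimodal_variation[where n = n])
    fix k assume "k < n"
    then show "- c k \<le> - c (Suc k)"
      using up[of k] up[of "Suc k"] pos[of "Suc k"] by (cases "Suc k < n") (auto simp: not_less intro: order_trans[OF _ powr_ge_zero])
  next
    fix k assume "n \<le> k"
    then show "- c (Suc k) \<le> - c k" using cn(1)[of "Suc k"] cn(2)[of k] by linarith
  next
    fix k show "- (real n powr (- r - 1)) \<le> - c k"
      using up[of k] pos[of k] powr_ge_zero[of "real n" "- r - 1"] by (cases "k < n"; linarith)
  qed
  also have "2 * (- c n) \<le> 2 * (r * real n powr (- r - 1))" using cn(1)[of n] by simp
  also have "- c 0 = - (real n powr (- r - 1))" using up[of 0] assms by simp
  finally show ?thesis by (simp add: abs_minus_commute algebra_simps)
qed

definition kernel_tail :: "nat \<Rightarrow> real \<Rightarrow> real \<Rightarrow> complex" where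
  "kernel_tail n r x = (\<Sum>k. of_real (ramp n r k) * cis x ^ k)"

lemma summable_kernel_tail: "n \<ge> 1 \<Longrightarrow> r > 0 \<Longrightarrow> cis x \<noteq> 1 \<Longrightarrow> summable (\<lambda>k. of_real (ramp n r k) * cis x ^ k)"
  by (rule abel_summation(1)[OF _ _ ramp_tendsto ramp_variation]) auto

text \<open>
  Two summations by parts. This is the useful bound for \<open>\<bar>x\<bar> \<ge> 1 / n\<close>.
\<close>

lemma kernel_tail_bound_far:
  assumes "n \<ge> 1" "r > 0" "cis x \<noteq> 1"
  shows "norm (1 - cis x) ^ 2 * norm (kernel_tail n r x) \<le> (2 * r + 3) * real n powr (- r - 1)"
proof -
  let ?c = "\<lambda>k. ramp n r (Suc k) - ramp n r k"
  have 1: "(1 - cis x) * kernel_tail n r x = of_real (ramp n r 0) + cis x * (\<Sum>k. of_real (?c k) * cis x ^ k)"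
    unfolding kernel_tail_def by (rule abel_summation(2)[OF _ _ ramp_tendsto ramp_variation]) (use assms in auto)
  have r0: "ramp n r 0 = 0" using assms by (simp add: ramp_def)
  have lim: "ramp n r \<longlonglongrightarrow> 0" by (rule ramp_tendsto[OF assms(2)])
  have "norm (1 - cis x) ^ 2 * norm (kernel_tail n r x) = norm (1 - cis x) * norm ((1 - cis x) * kernel_tail n r x)"
    by (simp add: norm_mult power2_eq_square)
  also have "\<dots> = norm (1 - cis x) * norm (\<Sum>k. of_real (?c k) * cis x ^ k)"
    unfolding 1 r0 by (simp add: norm_mult)
  also have "\<dots> \<le> \<bar>?c 0\<bar> + (2 * r + 2) * real n powr (- r - 1)"
  proof (rule abel_summation(3)[OF _ _ _ ramp_variation2])
    show "?c \<longlonglongrightarrow> 0"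
      using tendsto_diff[OF LIMSEQ_Suc[OF lim] lim] by simp
  qed (use assms in auto)
  also have "\<bar>?c 0\<bar> = real n powr (- r - 1)" using ramp_increment_below[of 0 n r] assms by simp
  finally show ?thesis by (simp add: algebra_simps)
qed

text \<open>
  Comparison with the integral of \<open>x powr - \<rho>\<close>; the factor \<open>1 / (1 - \<rho>)\<close> is at most \<open>2\<close>.
\<close>

lemma sum_powr_bound:
  assumes "0 < \<rho>" "\<rho> \<le> 1/2"
  shows "(\<Sum>k<K. real k powr (- \<rho>)) \<le> 2 * real K powr (1 - \<rho>)"
proof -
  have "(\<Sum>k<Suc K. real k powr (- \<rho>)) \<le> 2 * real K powr (1 - \<rho>)"
  proof (induction K)
    case (Suc K)
    have "real (Suc K) powr (- \<rho>) \<le> 2 * (real (Suc K) powr (1 - \<rho>) - real K powr (1 - \<rho>))"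
    proof (cases "K = 0")
      case False
      have "\<exists>z::real. real K < z \<and> z < real (Suc K) \<and>
         real (Suc K) powr (1 - \<rho>) - real K powr (1 - \<rho>) = (real (Suc K) - real K) * ((1 - \<rho>) * z powr (- \<rho>))"
      proof (rule MVT2)
        fix x :: real assume "real K \<le> x" "x \<le> real (Suc K)"
        then show "((\<lambda>x. x powr (1 - \<rho>)) has_real_derivative (1 - \<rho>) * x powr (- \<rho>)) (at x)"
          using False by (auto intro!: derivative_eq_intros)
      qed simp
      then obtain z where z: "real K < z" "z < real (Suc K)"
        "real (Suc K) powr (1 - \<rho>) - real K powr (1 - \<rho>) = (1 - \<rho>) * z powr (- \<rho>)" by auto
      have "1 / 2 * real (Suc K) powr (- \<rho>) \<le> (1 - \<rho>) * z powr (- \<rho>)"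
        using z(1,2) False assms by (intro mult_mono powr_mono2') auto
      then show ?thesis unfolding z(3) by simp
    qed simp
    with Suc show ?case by simp
  qed simp
  moreover have "(\<Sum>k<K. real k powr (- \<rho>)) \<le> (\<Sum>k<Suc K. real k powr (- \<rho>))" by simp
  ultimately show ?thesis by linarith
qed

text \<open>
  For \<open>\<bar>x\<bar> \<le> 1 / n\<close> the sum is cut at \<open>K\<close>, about \<open>1 / \<bar>x\<bar>\<close>. The terms below \<open>K\<close> do not oscillate
  and are added in modulus; the terms from \<open>K\<close> on decrease, and one summation by parts bounds
  them by a multiple of \<open>ramp n r K / \<bar>x\<bar>\<close>. The auxiliary exponent \<open>\<rho> < 1\<close> makes the partial sums grow
  like a power for every \<open>r\<close>, avoiding the logarithm at \<open>r = 1\<close>, and keeps the singularity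
  \<open>\<bar>x\<bar> powr (\<rho> - 1)\<close> integrable.
\<close>

lemma kernel_tail_bound_near:
  assumes "n \<ge> 1" "0 < \<rho>" "\<rho> \<le> 1/2" "\<rho> \<le> r" "x \<noteq> 0" "\<bar>x\<bar> \<le> 1 / n"
  shows "norm (kernel_tail n r x) \<le> 12 * real n powr (\<rho> - r) * \<bar>x\<bar> powr (\<rho> - 1)"
proof -
  have r: "r > 0" using assms by simp
  have "1 / n \<le> 1" using assms by simp
  then have xp: "\<bar>x\<bar> \<le> 1" using assms by linarith
  then have xpi: "\<bar>x\<bar> \<le> pi" using pi_gt3 by linarith
  have n1: "norm (1 - cis x) \<ge> \<bar>x\<bar> / 4" by (rule norm_one_minus_cis[OF xpi])
  then have c1: "cis x \<noteq> 1" using assms by auto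
  \<comment> \<open>From about this index on the phases \<open>k * x\<close> have passed one radian and cancellation sets in.\<close>
  define K where "K = nat \<lceil>1 / \<bar>x\<bar>\<rceil>"
  have K1: "real K \<ge> 1 / \<bar>x\<bar>" unfolding K_def by linarith
  have "real n \<le> 1 / \<bar>x\<bar>" using assms by (simp add: field_simps)
  then have Kn: "K \<ge> n" using K1 by linarith
  have "1 / \<bar>x\<bar> \<ge> 1" using xp assms by simp
  then have K2: "real K \<le> 2 / \<bar>x\<bar>" unfolding K_def by linarith
  have Kp: "real K > 0" using Kn assms by simp
  have rb: "ramp n r k \<le> real n powr (\<rho> - r) * real k powr (- \<rho>)" for k
  proof (cases "k < n")
    case True
    show ?thesis
    proof (cases "k = 0")
      case False
      have "ramp n r k = real k * real n powr (- r - 1)" using True by (simp add: ramp_def)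
      also have "\<dots> \<le> real n * real n powr (- r - 1)" using True by (intro mult_right_mono) auto
      also have "\<dots> = real n powr (\<rho> - r) * real n powr (- \<rho>)" using assms(1) by (simp add: powr_diff powr_minus field_simps)
      also have "\<dots> \<le> real n powr (\<rho> - r) * real k powr (- \<rho>)"
        using True False assms by (intro mult_left_mono powr_mono2') auto
      finally show ?thesis .
    qed (use assms in \<open>simp add: ramp_def\<close>)
  next
    case False
    then have "ramp n r k = real k powr (\<rho> - r) * real k powr (- \<rho>)"
      using assms(1) by (simp add: ramp_def flip: powr_add)
    also have "\<dots> \<le> real n powr (\<rho> - r) * real k powr (- \<rho>)"
      using False assms by (intro mult_right_mono powr_mono2') auto
    finally show ?thesis .
  qed
  have split: "kernel_tail n r x = (\<Sum>k. of_real (ramp n r (k + K)) * cis x ^ (k + K)) + (\<Sum>k<K. of_real (ramp n r k) * cis x ^ k)"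
    unfolding kernel_tail_def by (rule suminf_split_initial_segment[OF summable_kernel_tail[OF assms(1) r c1]])
  have "norm (\<Sum>k<K. of_real (ramp n r k) * cis x ^ k) \<le> (\<Sum>k<K. real n powr (\<rho> - r) * real k powr (- \<rho>))"
    by (intro sum_norm_le) (use rb ramp_nonneg in \<open>simp add: norm_mult norm_power\<close>)
  also have "\<dots> \<le> real n powr (\<rho> - r) * (2 * real K powr (1 - \<rho>))"
    unfolding sum_distrib_left[symmetric] using assms by (intro mult_left_mono sum_powr_bound) auto
  also have "real K powr (1 - \<rho>) \<le> (2 / \<bar>x\<bar>) powr (1 - \<rho>)"
    using assms K2 by (intro powr_mono2) auto
  also have "(2 / \<bar>x\<bar>) powr (1 - \<rho>) = 2 powr (1 - \<rho>) * \<bar>x\<bar> powr (\<rho> - 1)"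
    using assms by (simp add: powr_divide powr_diff field_simps)
  also have "2 powr (1 - \<rho>) \<le> (2::real) powr 1" using assms by (intro powr_mono) auto
  finally have A: "norm (\<Sum>k<K. of_real (ramp n r k) * cis x ^ k) \<le> real n powr (\<rho> - r) * (4 * \<bar>x\<bar> powr (\<rho> - 1))"
    by (simp add: mult_left_mono mult_right_mono)
  have t0: "summable (\<lambda>k. of_real (ramp n r (k + K)) * cis x ^ k)"
    "norm (1 - cis x) * norm (\<Sum>k. of_real (ramp n r (k + K)) * cis x ^ k) \<le> \<bar>ramp n r (0 + K)\<bar> + (2 * ramp n r (0 + K) - ramp n r (0 + K) - 0)"
  proof -
    have v: "(\<Sum>k<M. \<bar>ramp n r (Suc k + K) - ramp n r (k + K)\<bar>) \<le> 2 * ramp n r (0 + K) - ramp n r (0 + K) - 0" for M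
      by (rule unimodal_variation[where n = 0]) (use ramp_nonneg ramp_antimono[of n r] Kn assms r in auto)
    have l: "(\<lambda>k. ramp n r (k + K)) \<longlonglongrightarrow> 0"
      using ramp_tendsto[OF r] by (rule LIMSEQ_ignore_initial_segment)
    show "summable (\<lambda>k. of_real (ramp n r (k + K)) * cis x ^ k)"
      by (rule abel_summation(1)[OF _ c1 l v]) simp
    show "norm (1 - cis x) * norm (\<Sum>k. of_real (ramp n r (k + K)) * cis x ^ k) \<le> \<bar>ramp n r (0 + K)\<bar> + (2 * ramp n r (0 + K) - ramp n r (0 + K) - 0)"
      by (rule abel_summation(3)[OF _ c1 l v]) simp
  qed
  have "(\<Sum>k. of_real (ramp n r (k + K)) * cis x ^ (k + K)) = (\<Sum>k. of_real (ramp n r (k + K)) * cis x ^ k) * cis x ^ K"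
    unfolding suminf_mult2[OF t0(1)] by (simp add: power_add mult.assoc)
  then have e: "norm (\<Sum>k. of_real (ramp n r (k + K)) * cis x ^ (k + K)) = norm (\<Sum>k. of_real (ramp n r (k + K)) * cis x ^ k)" (is "?N = _")
    by (simp add: norm_mult norm_power)
  have "\<bar>x\<bar> / 4 * ?N \<le> norm (1 - cis x) * ?N" using n1 by (intro mult_right_mono) auto
  also have "\<dots> \<le> 2 * ramp n r K" using t0(2) ramp_nonneg[of n r K] unfolding e by simp
  also have "\<dots> \<le> 2 * (real n powr (\<rho> - r) * real K powr (- \<rho>))" using rb by simp
  also have "real K powr (- \<rho>) \<le> (1 / \<bar>x\<bar>) powr (- \<rho>)" using K1 assms by (intro powr_mono2') auto
  also have "(1 / \<bar>x\<bar>) powr (- \<rho>) = \<bar>x\<bar> powr \<rho>" using assms by (simp add: powr_divide powr_minus)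
  finally have "\<bar>x\<bar> / 4 * ?N \<le> 2 * (real n powr (\<rho> - r) * \<bar>x\<bar> powr \<rho>)" by (simp add: mult_left_mono)
  then have "?N \<le> real n powr (\<rho> - r) * (8 * (\<bar>x\<bar> powr \<rho> / \<bar>x\<bar>))" using assms by (simp add: field_simps)
  also have "\<bar>x\<bar> powr \<rho> / \<bar>x\<bar> = \<bar>x\<bar> powr (\<rho> - 1)" using assms by (simp add: powr_diff)
  finally have "norm (kernel_tail n r x) \<le> real n powr (\<rho> - r) * (8 * \<bar>x\<bar> powr (\<rho> - 1)) + real n powr (\<rho> - r) * (4 * \<bar>x\<bar> powr (\<rho> - 1))"
    unfolding split by (intro norm_triangle_le add_mono A)
  then show ?thesis by (simp add: algebra_simps)
qed

definition kernel_poly :: "nat \<Rightarrow> real \<Rightarrow> real \<Rightarrow> real \<Rightarrow> real" where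
  "kernel_poly n r \<alpha> x = 1 + 2 * Re (cis (- \<alpha> * pi / 2) *
     (\<Sum>k<n. of_real (real k powr (- r) - ramp n r k) * cis (of_nat k * x)))"

text \<open>
  Off the multiples of \<open>2 * pi\<close> the kernel is \<open>1\<close> plus twice the real part of a rotated power series
  on the unit circle; replacing its coefficients by the ramp changes only those below \<open>n\<close>. The
  parameter \<open>\<alpha>\<close> enters only through the rotation, so all bounds are uniform in \<open>\<alpha>\<close>.
\<close>

lemma bernoulli_kernel_split:
  assumes n: "n \<ge> 1" and r: "r > 0" and x: "cis x \<noteq> 1"
  shows "bernoulli_kernel r x \<alpha> = kernel_poly n r \<alpha> x + 2 * Re (cis (- \<alpha> * pi / 2) * kernel_tail n r x)"
proof -
  let ?w = "cis (- \<alpha> * pi / 2)"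
  have r1: "ramp 1 r k = real k powr (- r)" for k by (simp add: ramp_def)
  have s1: "summable (\<lambda>k. of_real (ramp 1 r k) * cis x ^ k)" by (rule summable_kernel_tail[OF _ r x]) simp
  have sn: "summable (\<lambda>k. of_real (ramp n r k) * cis x ^ k)" by (rule summable_kernel_tail[OF n r x])
  have "kernel_tail 1 r x - kernel_tail n r x = (\<Sum>k. of_real (ramp 1 r k) * cis x ^ k - of_real (ramp n r k) * cis x ^ k)"
    unfolding kernel_tail_def by (rule suminf_diff[OF s1 sn])
  also have "\<dots> = (\<Sum>k<n. of_real (ramp 1 r k) * cis x ^ k - of_real (ramp n r k) * cis x ^ k)"
    by (intro suminf_finite) (auto simp: r1[unfolded One_nat_def] ramp_eq_powr)
  also have "\<dots> = (\<Sum>k<n. of_real (real k powr (- r) - ramp n r k) * cis (of_nat k * x))"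
    by (intro sum.cong refl) (simp only: r1 Complex.DeMoivre of_real_diff left_diff_distrib)
  finally have t1: "kernel_tail 1 r x = (\<Sum>k<n. of_real (real k powr (- r) - ramp n r k) * cis (of_nat k * x)) + kernel_tail n r x"
    by (simp add: algebra_simps)
  have "(\<lambda>k. of_real (ramp 1 r (Suc k)) * cis x ^ Suc k) sums (kernel_tail 1 r x - of_real (ramp 1 r 0) * cis x ^ 0)"
    unfolding kernel_tail_def using summable_sums[OF s1] by (subst sums_Suc_iff) simp
  then have "(\<lambda>k. of_real (ramp 1 r (Suc k)) * cis x ^ Suc k) sums kernel_tail 1 r x" by (simp add: ramp_def)
  then have "(\<lambda>k. Re (?w * (of_real (ramp 1 r (Suc k)) * cis x ^ Suc k))) sums Re (?w * kernel_tail 1 r x)"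
    by (intro sums_Re sums_mult)
  moreover have "Re (?w * (of_real (ramp 1 r (Suc k)) * cis x ^ Suc k)) = real (Suc k) powr (- r) * cos (real (Suc k) * x - \<alpha> * pi / 2)" for k
  proof -
    have "?w * (of_real a * cis b) = of_real a * cis (b - \<alpha> * pi / 2)" for a b
      using cis_mult[of "- \<alpha> * pi / 2" b] by (simp add: algebra_simps)
    then have eq: "?w * (of_real (ramp 1 r (Suc k)) * cis x ^ Suc k) =
        of_real (real (Suc k) powr (- r)) * cis (real (Suc k) * x - \<alpha> * pi / 2)"
      unfolding r1 Complex.DeMoivre .
    show ?thesis unfolding eq by (simp del: of_nat_Suc)
  qed
  ultimately have "(\<Sum>k. real (Suc k) powr (- r) * cos (real (Suc k) * x - \<alpha> * pi / 2)) = Re (?w * kernel_tail 1 r x)"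
    by (simp only: sums_unique[symmetric])
  then show ?thesis
    unfolding bernoulli_kernel_def kernel_poly_def t1 by (simp add: ring_distribs)
qed

lemma trig1_kernel_poly: "trig1 n (\<lambda>x. of_real (kernel_poly n r \<alpha> x))"
proof -
  let ?w = "cis (- \<alpha> * pi / 2)"
  let ?c = "\<lambda>k. complex_of_real (real k powr (- r) - ramp n r k)"
  have "(\<lambda>x. complex_of_real (kernel_poly n r \<alpha> x)) = (\<lambda>x. 1 +
      ((\<Sum>k<n. (?w * ?c k) * cis (of_int (int k) * x)) + (\<Sum>k<n. (cnj ?w * ?c k) * cis (of_int (- int k) * x))))"
  proof
    fix x
    let ?S = "?w * (\<Sum>k<n. ?c k * cis (of_nat k * x))"
    have "complex_of_real (kernel_poly n r \<alpha> x) = 1 + (?S + cnj ?S)"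
      unfolding kernel_poly_def complex_add_cnj by simp
    also have "?S = (\<Sum>k<n. (?w * ?c k) * cis (of_int (int k) * x))"
      by (simp add: sum_distrib_left mult.assoc)
    also have "cnj \<dots> = (\<Sum>k<n. (cnj ?w * ?c k) * cis (of_int (- int k) * x))"
      by (simp add: cis_cnj)
    finally show "complex_of_real (kernel_poly n r \<alpha> x) = 1 +
      ((\<Sum>k<n. (?w * ?c k) * cis (of_int (int k) * x)) + (\<Sum>k<n. (cnj ?w * ?c k) * cis (of_int (- int k) * x)))" .
  qed
  then show ?thesis
    by (simp only:) (intro trig1_add trig1_const trig1_sum trig1_cis, auto)
qed

text \<open>
  The common shape, in the variable \<open>n * x\<close>, of the two bounds for the tail: an integrable
  singularity at \<open>0\<close> and integrable decay at infinity.
\<close>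

definition majorant :: "real \<Rightarrow> real \<Rightarrow> real" where
  "majorant \<rho> v = (if \<bar>v\<bar> \<le> 1 then \<bar>v\<bar> powr (\<rho> - 1) else \<bar>v\<bar> powr (- 2))"

lemma majorant_nonneg: "majorant \<rho> v \<ge> 0" by (simp add: majorant_def)
lemma majorant_measurable [measurable]: "majorant \<rho> \<in> borel_measurable borel" unfolding majorant_def[abs_def] by measurable

lemma integrable_majorant:
  assumes "\<rho> > 0" shows "integrable lborel (majorant \<rho>)"
proof -
  have 1: "(\<integral>\<^sup>+v. ennreal (indicator {0..1} v * v powr (\<rho> - 1)) \<partial>lborel) = ennreal (1 powr (\<rho> - 1 + 1) / (\<rho> - 1 + 1))"
    using assms by (intro nn_integral_has_integral_lebesgue has_integral_powr_from_0) auto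
  have 2: "(\<integral>\<^sup>+v. ennreal (indicator {1..} v * v powr (- 2)) \<partial>lborel) = ennreal (- (1 powr (- 2 + 1)) / (- 2 + 1))"
    by (intro nn_integral_has_integral_lebesgue has_integral_powr_to_inf) auto
  define h where "h v = ennreal (indicator {0..1} v * v powr (\<rho> - 1)) + ennreal (indicator {1..} v * v powr (- 2))" for v :: real
  have hm [measurable]: "h \<in> borel_measurable borel" unfolding h_def[abs_def] by measurable
  have hI: "(\<integral>\<^sup>+v. h v \<partial>lborel) < \<infinity>"
    unfolding h_def by (subst nn_integral_add) (auto simp: 1 2)
  have hI': "(\<integral>\<^sup>+v. h (- v) \<partial>lborel) = (\<integral>\<^sup>+v. h v \<partial>lborel)"
    using nn_integral_real_affine[of h "-1" 0] by simp
  have "ennreal (norm (majorant \<rho> v)) \<le> h v + h (- v)" for v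
    by (cases "v \<ge> 0"; cases "\<bar>v\<bar> \<le> 1") (auto simp: majorant_def h_def indicator_def)
  then have "(\<integral>\<^sup>+v. ennreal (norm (majorant \<rho> v)) \<partial>lborel) \<le> (\<integral>\<^sup>+v. h v + h (- v) \<partial>lborel)"
    by (intro nn_integral_mono)
  also have "\<dots> = (\<integral>\<^sup>+v. h v \<partial>lborel) + (\<integral>\<^sup>+v. h (- v) \<partial>lborel)"
    by (intro nn_integral_add) auto
  also have "\<dots> < \<infinity>" using hI unfolding hI' by (simp add: ennreal_add_less_top)
  finally show ?thesis by (intro integrableI_bounded) auto
qed

text \<open>
  Both bounds in scaled form. Integrating the right-hand side over the line gives a factor \<open>1 / n\<close>, so
  the tail has mean modulus of order \<open>n powr - r\<close>.
\<close>

lemma kernel_tail_bound: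
  assumes n: "n \<ge> 1" and \<rho>: "0 < \<rho>" "\<rho> \<le> 1/2" "\<rho> \<le> r" and x: "x \<noteq> 0" "\<bar>x\<bar> \<le> pi"
  shows "norm (kernel_tail n r x) \<le> (48 + 32 * r) * real n powr (1 - r) * majorant \<rho> (real n * x)"
proof (cases "\<bar>real n * x\<bar> \<le> 1")
  case True
  then have x1: "\<bar>x\<bar> \<le> 1 / n" using n by (simp add: abs_mult field_simps)
  have "norm (kernel_tail n r x) \<le> 12 * real n powr (\<rho> - r) * \<bar>x\<bar> powr (\<rho> - 1)"
    by (rule kernel_tail_bound_near[OF n \<rho> x(1) x1])
  also have "\<dots> = 12 * real n powr (1 - r) * majorant \<rho> (real n * x)"
    using True n by (simp add: majorant_def abs_mult powr_mult powr_diff field_simps)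
  also have "\<dots> \<le> (48 + 32 * r) * real n powr (1 - r) * majorant \<rho> (real n * x)"
    using \<rho> by (intro mult_right_mono majorant_nonneg) auto
  finally show ?thesis .
next
  case False
  have n1: "norm (1 - cis x) \<ge> \<bar>x\<bar> / 4" by (rule norm_one_minus_cis[OF x(2)])
  then have c1: "cis x \<noteq> 1" using x by auto
  have "(\<bar>x\<bar> / 4) ^ 2 * norm (kernel_tail n r x) \<le> norm (1 - cis x) ^ 2 * norm (kernel_tail n r x)"
    using n1 by (intro mult_right_mono power_mono) auto
  also have "\<dots> \<le> (2 * r + 3) * real n powr (- r - 1)"
    by (rule kernel_tail_bound_far) (use n \<rho> c1 in auto)
  finally have "norm (kernel_tail n r x) \<le> 16 * ((2 * r + 3) * real n powr (- r - 1)) / x\<^sup>2"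
    using x by (simp add: field_simps)
  also have "real n powr (- r - 1) = real n powr (1 - r) * real n powr (- 2)"
    unfolding powr_add[symmetric] by (rule arg_cong[where f = "\<lambda>e. real n powr e"]) simp
  also have "16 * ((2 * r + 3) * (real n powr (1 - r) * real n powr (- 2))) / x\<^sup>2
     = (48 + 32 * r) * real n powr (1 - r) * (real n powr (- 2) * \<bar>x\<bar> powr (- 2))"
  proof -
    have "\<bar>x\<bar> powr (- 2) = 1 / x\<^sup>2" using x by (simp add: powr_minus_divide)
    then show ?thesis by (simp add: algebra_simps add_divide_distrib)
  qed
  also have "real n powr (- 2) * \<bar>x\<bar> powr (- 2) = majorant \<rho> (real n * x)"
    using False by (simp add: majorant_def abs_mult powr_mult)
  finally show ?thesis .
qed

lemma bernoulli_kernel_measurable [measurable]: "(\<lambda>x. bernoulli_kernel r x \<alpha>) \<in> borel_measurable borel"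
  unfolding bernoulli_kernel_def by measurable

text \<open>
  The difference of a point of the period and an interior point lies in the open interval from \<open>- 2 * pi\<close> to \<open>2 * pi\<close>, and
  one of its three translates lies in \<open>{- pi..pi}\<close>. Adding the majorant over all three avoids a case
  distinction under the integral.
\<close>

lemma kernel_tail_bound_wrapped:
  assumes n: "n \<ge> 1" and \<rho>: "0 < \<rho>" "\<rho> \<le> 1/2" "\<rho> \<le> r" and u: "\<bar>u\<bar> < 2 * pi" "u \<noteq> 0"
  shows "norm (kernel_tail n r u) \<le> (48 + 32 * r) * real n powr (1 - r) *
     (majorant \<rho> (real n * (u - 2 * pi)) + majorant \<rho> (real n * u) + majorant \<rho> (real n * (u + 2 * pi)))"
proof -
  have "cis (u - 2 * pi) = cis u" "cis (u + 2 * pi) = cis u"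
    by (simp_all flip: cis_mult cis_divide)
  then have p: "kernel_tail n r (u - 2 * pi) = kernel_tail n r u" "kernel_tail n r (u + 2 * pi) = kernel_tail n r u"
    by (simp_all add: kernel_tail_def)
  let ?A = "(48 + 32 * r) * real n powr (1 - r)"
  have A: "?A \<ge> 0" using \<rho> by simp
  note pp = mult_nonneg_nonneg[OF A majorant_nonneg]
  consider "u > pi" | "\<bar>u\<bar> \<le> pi" | "u < - pi" by linarith
  then have "norm (kernel_tail n r u) \<le> ?A * majorant \<rho> (real n * (u - 2 * pi)) + ?A * majorant \<rho> (real n * u) + ?A * majorant \<rho> (real n * (u + 2 * pi))"
  proof cases
    case 1
    have "norm (kernel_tail n r u) \<le> ?A * majorant \<rho> (real n * (u - 2 * pi))"
      unfolding p(1)[symmetric] by (rule kernel_tail_bound[OF n \<rho>]) (use 1 u in auto)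
    then show ?thesis
      using pp[of \<rho> "real n * (u - 2 * pi)"] pp[of \<rho> "real n * u"] pp[of \<rho> "real n * (u + 2 * pi)"] by linarith
  next
    case 2
    have "norm (kernel_tail n r (u)) \<le> ?A * majorant \<rho> (real n * (u))"
      by (rule kernel_tail_bound[OF n \<rho>]) (use 2 u in auto)
    then show ?thesis
      using pp[of \<rho> "real n * (u - 2 * pi)"] pp[of \<rho> "real n * u"] pp[of \<rho> "real n * (u + 2 * pi)"] by linarith
  next
    case 3
    have "norm (kernel_tail n r u) \<le> ?A * majorant \<rho> (real n * (u + 2 * pi))"
      unfolding p(2)[symmetric] by (rule kernel_tail_bound[OF n \<rho>]) (use 3 u in auto)
    then show ?thesis
      using pp[of \<rho> "real n * (u - 2 * pi)"] pp[of \<rho> "real n * u"] pp[of \<rho> "real n * (u + 2 * pi)"] by linarith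
  qed
  then show ?thesis by (simp only: distrib_left)
qed

lemma majorant_affine_integral:
  assumes "\<rho> > 0" "n \<ge> 1"
  shows "integrable lborel (\<lambda>y. majorant \<rho> (real n * (c - y)))"
    and "(LINT y|lborel. majorant \<rho> (real n * (c - y))) = (LINT v|lborel. majorant \<rho> v) / n"
proof -
  have e: "majorant \<rho> (real n * (c - y)) = majorant \<rho> (real n * c + (- real n) * y)" for y by (simp add: algebra_simps)
  show "integrable lborel (\<lambda>y. majorant \<rho> (real n * (c - y)))"
    unfolding e using assms by (intro lborel_integrable_real_affine integrable_majorant) auto
  show "(LINT y|lborel. majorant \<rho> (real n * (c - y))) = (LINT v|lborel. majorant \<rho> v) / n"
    unfolding e using lborel_integral_real_affine[of "- real n" "majorant \<rho>" "real n * c"] assms by simp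
qed

text \<open>
  The points of an open set at which a continuous function exceeds \<open>\<epsilon>\<close> form an open set, and an open
  null set is empty.
\<close>

lemma AE_le_closure:
  fixes H :: "'a::euclidean_space \<Rightarrow> real"
  assumes c: "continuous_on UNIV H" and U: "open U" and ae: "AE x in lebesgue. x \<in> U \<longrightarrow> H x \<le> \<epsilon>"
    and x: "x \<in> closure U"
  shows "H x \<le> \<epsilon>"
proof -
  have o: "open {x \<in> U. \<epsilon> < H x}"
    using U open_Collect_less[OF continuous_on_const c, of \<epsilon>] by (auto simp: Collect_conj_eq intro: open_Int)
  have "negligible {x \<in> U. \<epsilon> < H x}"
  proof -
    have "{x \<in> U. \<epsilon> < H x} \<in> sets lebesgue" using borel_open[OF o] by (intro sets_completionI_sets) simp
    moreover have "AE x in lebesgue. x \<notin> {x \<in> U. \<epsilon> < H x}" using ae by eventually_elim auto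
    ultimately show ?thesis unfolding negligible_iff_null_sets by (simp only: AE_iff_null_sets)
  qed
  then have "{x \<in> U. \<epsilon> < H x} = {}" using open_not_negligible[OF o] by blast
  then have "U \<subseteq> {x. H x \<le> \<epsilon>}" by force
  then have "closure U \<subseteq> {x. H x \<le> \<epsilon>}"
    by (intro closure_minimal closed_Collect_le c continuous_on_const)
  then show ?thesis using x by blast
qed

lemma borel_measurable_lebesgue_on:
  "f \<in> borel_measurable borel \<Longrightarrow> f \<in> borel_measurable (lebesgue_on S)"
  by (intro measurable_restrict_space1 measurable_completion) simp

lemma integrable_lborel_lebesgue_on:
  fixes f :: "'a::euclidean_space \<Rightarrow> real"
  assumes f: "integrable lborel f" "\<And>x. f x \<ge> 0" and S: "S \<in> sets lebesgue"
  shows "integrable (lebesgue_on S) f" "(LINT x|lebesgue_on S. f x) \<le> (LINT x|lborel. f x)"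
proof -
  have m: "f \<in> lborel \<rightarrow>\<^sub>M borel" using f(1) by (rule borel_measurable_integrable)
  have i: "integrable lebesgue f" using f(1) integrable_completion[OF m] by simp
  have i': "integrable lebesgue (\<lambda>x. indicator S x *\<^sub>R f x)"
    by (rule integrable_mult_indicator[OF S i])
  show "integrable (lebesgue_on S) f"
    using i' S by (subst integrable_restrict_space) auto
  have "(LINT x|lebesgue_on S. f x) = (LINT x|lebesgue. indicator S x *\<^sub>R f x)"
    using S by (subst integral_restrict_space) auto
  also have "\<dots> \<le> (LINT x|lebesgue. f x)"
    by (intro integral_mono i i') (auto simp: f(2) indicator_def)
  also have "\<dots> = (LINT x|lborel. f x)" by (rule integral_completion[OF m])
  finally show "(LINT x|lebesgue_on S. f x) \<le> (LINT x|lborel. f x)" .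
qed

text \<open>
  Replacing the Bernoulli kernel by its polynomial part turns the convolution with the bounded density
  \<open>\<phi>\<close> into a trigonometric polynomial; the rest is at most the mean modulus of the kernel tail. The
  bound is first obtained where the representation holds, then everywhere since both sides are
  continuous and periodic.
\<close>

lemma sobolev_trig_approximation:
  assumes r: "r > 0"
  shows "\<exists>C\<ge>0. \<forall>(F :: real \<Rightarrow> complex) (\<phi> :: real \<Rightarrow> complex) \<alpha> n. n \<ge> 1 \<longrightarrow> continuous_on UNIV F \<longrightarrow> (\<forall>t. F (t + 2 * pi) = F t) \<longrightarrow>
    \<phi> \<in> borel_measurable (lebesgue_on {0..2 * pi}) \<longrightarrow> (AE y in lebesgue_on {0..2 * pi}. norm (\<phi> y) \<le> 1) \<longrightarrow>
    (AE x in lebesgue_on {0..2 * pi}. F x =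
       (LINT y|lebesgue_on {0..2 * pi}. \<phi> y * of_real (bernoulli_kernel r (x - y) \<alpha>)) / (2 * pi)) \<longrightarrow>
    (\<exists>p. trig1 n p \<and> (\<forall>x. norm (F x - p x) \<le> C * real n powr (- r)))"
proof -
  define \<rho> where "\<rho> = min r (1 / 2)"
  have \<rho>: "0 < \<rho>" "\<rho> \<le> 1 / 2" "\<rho> \<le> r" using r by (auto simp: \<rho>_def)
  define \<Psi> where "\<Psi> = (LINT v|lborel. majorant \<rho> v)"
  have \<Psi>: "\<Psi> \<ge> 0" unfolding \<Psi>_def by (intro Bochner_Integration.integral_nonneg) (simp add: majorant_nonneg)
  define A where "A = 48 + 32 * r"
  define C where "C = 6 * A * \<Psi> / (2 * pi)"
  have A0: "A \<ge> 0" using r by (simp add: A_def)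
  show ?thesis
  proof (intro exI[of _ C] conjI allI impI)
    show "C \<ge> 0" using A0 \<Psi> by (simp add: C_def)
    fix F \<phi> :: "real \<Rightarrow> complex" and \<alpha> :: real and n :: nat
    let ?L = "lebesgue_on {0..2 * pi}"
    assume n: "n \<ge> 1" and c: "continuous_on UNIV F" and per: "\<forall>t. F (t + 2 * pi) = F t"
      and \<phi>m [measurable]: "\<phi> \<in> borel_measurable ?L" and \<phi>1: "AE y in ?L. norm (\<phi> y) \<le> 1"
      and rep: "AE x in ?L. F x = (LINT y|?L. \<phi> y * of_real (bernoulli_kernel r (x - y) \<alpha>)) / (2 * pi)"
    interpret L: finite_measure ?L
      by (rule finite_measure_lebesgue_on) simp
    obtain b where b: "\<And>x. complex_of_real (kernel_poly n r \<alpha> x) = (\<Sum>k\<in>{- int n..int n}. b k * cis (of_int k * x))"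
      using trig1_kernel_poly[of n r \<alpha>] unfolding trig1_def by blast
    define \<Phi> where "\<Phi> k = (LINT y|?L. \<phi> y * cis (- of_int k * y))" for k :: int
    have cm: "(\<lambda>y. cis (a * y)) \<in> borel_measurable ?L" for a
      by (intro borel_measurable_lebesgue_on borel_measurable_continuous_onI continuous_intros)
    have \<phi>i: "integrable ?L (\<lambda>y. \<phi> y * cis (- of_int k * y))" for k
    proof (rule L.integrable_const_bound[where B = 1])
      show "(\<lambda>y. \<phi> y * cis (- of_int k * y)) \<in> borel_measurable ?L"
        by (intro borel_measurable_times \<phi>m cm)
    qed (use \<phi>1 in \<open>simp add: norm_mult\<close>)
    define p where "p x = (\<Sum>k\<in>{- int n..int n}. (b k * \<Phi> k / (2 * pi)) * cis (of_int k * x))" for x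
    have tp: "trig1 n p" unfolding p_def[abs_def] by (intro trig1_sum trig1_cis) auto
    have Pe: "\<phi> y * of_real (kernel_poly n r \<alpha> (x - y)) =
        (\<Sum>k\<in>{- int n..int n}. (b k * cis (of_int k * x)) * (\<phi> y * cis (- of_int k * y)))" for x y
    proof -
      have "cis (of_int k * (x - y)) = cis (of_int k * x) * cis (- of_int k * y)" for k
        by (simp add: cis_mult algebra_simps)
      then show ?thesis unfolding b sum_distrib_left by (intro sum.cong refl) simp
    qed
    have Pi: "integrable ?L (\<lambda>y. \<phi> y * of_real (kernel_poly n r \<alpha> (x - y)))" for x
      unfolding Pe by (intro Bochner_Integration.integrable_sum integrable_mult_right \<phi>i)
    have PI: "(LINT y|?L. \<phi> y * of_real (kernel_poly n r \<alpha> (x - y))) / (2 * pi) = p x" for x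
    proof -
      have "(LINT y|?L. \<phi> y * of_real (kernel_poly n r \<alpha> (x - y))) =
          (\<Sum>k\<in>{- int n..int n}. (LINT y|?L. (b k * cis (of_int k * x)) * (\<phi> y * cis (- of_int k * y))))"
        unfolding Pe by (rule Bochner_Integration.integral_sum) (intro integrable_mult_right \<phi>i)
      also have "\<dots> = (\<Sum>k\<in>{- int n..int n}. (b k * cis (of_int k * x)) * \<Phi> k)"
        unfolding \<Phi>_def integral_mult_right_zero ..
      finally show ?thesis by (simp add: p_def sum_divide_distrib mult_ac)
    qed
    define R where "R x y = bernoulli_kernel r (x - y) \<alpha> - kernel_poly n r \<alpha> (x - y)" for x y
    have Rm: "(\<lambda>y. complex_of_real (R x y)) \<in> borel_measurable ?L" for x
    proof (rule borel_measurable_lebesgue_on)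
      have xm: "(\<lambda>y. x - y) \<in> borel_measurable borel" by measurable
      have 1: "(\<lambda>y. bernoulli_kernel r (x - y) \<alpha>) \<in> borel_measurable borel"
        by (rule measurable_compose[OF xm bernoulli_kernel_measurable])
      have "(\<lambda>u. complex_of_real (kernel_poly n r \<alpha> u)) \<in> borel_measurable borel"
        by (intro borel_measurable_continuous_onI trig1_continuous[OF trig1_kernel_poly])
      from measurable_compose[OF xm this]
      have 2: "(\<lambda>y. complex_of_real (kernel_poly n r \<alpha> (x - y))) \<in> borel_measurable borel" .
      show "(\<lambda>y. complex_of_real (R x y)) \<in> borel_measurable borel"
        unfolding R_def of_real_diff using 1 2 by measurable
    qed
    \<comment> \<open>A majorant of the kernel tail at \<open>x - y\<close>; the factor \<open>2\<close> is that of the cosine series.\<close>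
    define D where "D x y = 2 * A * real n powr (1 - r) * (majorant \<rho> (real n * ((x - 2 * pi) - y)) + majorant \<rho> (real n * (x - y)) + majorant \<rho> (real n * ((x + 2 * pi) - y)))" for x y
    have D0: "D x y \<ge> 0" for x y unfolding D_def using A0 by (intro mult_nonneg_nonneg add_nonneg_nonneg majorant_nonneg) auto
    note ps = majorant_affine_integral[OF \<rho>(1) n]
    have Di: "integrable lborel (D x)" for x
      unfolding D_def by (intro integrable_mult_right Bochner_Integration.integrable_add ps(1))
    have DI: "(LINT y|lborel. D x y) = 6 * A * \<Psi> * real n powr (- r)" for x
    proof -
      have "(LINT y|lborel. D x y) = 2 * A * real n powr (1 - r) * (\<Psi> / n + \<Psi> / n + \<Psi> / n)"
        unfolding D_def by (simp add: Bochner_Integration.integral_add ps \<Psi>_def)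
      then show ?thesis using n by (simp add: powr_diff powr_minus field_simps)
    qed
    have bound: "norm (F x - p x) \<le> C * real n powr (- r)"
      if x: "x \<in> {0..2*pi}" and F: "F x = (LINT y|?L. \<phi> y * of_real (bernoulli_kernel r (x - y) \<alpha>)) / (2 * pi)" for x
    proof -
      \<comment> \<open>For these \<open>y\<close> the difference \<open>x - y\<close> is no multiple of \<open>2 * pi\<close>, so the splitting of the kernel applies.\<close>
      have "AE y in lborel. y \<noteq> 0 \<and> y \<noteq> 2 * pi \<and> y \<noteq> x"
        using AE_lborel_singleton[of 0] AE_lborel_singleton[of "2 * pi"] AE_lborel_singleton[of x] by eventually_elim auto
      then have "AE y in lebesgue. y \<noteq> 0 \<and> y \<noteq> 2 * pi \<and> y \<noteq> x" by (rule AE_completion)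
      then have "AE y in lebesgue. y \<in> {0..2*pi} \<longrightarrow> y \<noteq> x \<and> y > 0 \<and> y < 2 * pi" by eventually_elim auto
      then have "AE y in ?L. y \<noteq> x \<and> y > 0 \<and> y < 2 * pi" by (subst AE_restrict_space_iff) auto
      then have le: "AE y in ?L. norm (\<phi> y * of_real (R x y)) \<le> norm (D x y)"
        using \<phi>1
      proof eventually_elim
        case (elim y)
        then have u: "\<bar>x - y\<bar> < 2 * pi" "x - y \<noteq> 0" using x by auto
        have c1: "cis (x - y) \<noteq> 1"
        proof
          assume "cis (x - y) = 1"
          then have "cos (x - y) = 1" by (metis cis.sel(1) one_complex.sel(1))
          then obtain j :: int where j: "x - y = of_int j * 2 * pi" unfolding cos_one_2pi_int by blast
          then have "\<bar>real_of_int j\<bar> * (2 * pi) < 1 * (2 * pi)" using u by (simp add: abs_mult)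
          then have "\<bar>real_of_int j\<bar> < 1" using pi_gt_zero by (subst (asm) mult_less_cancel_right_pos) auto
          then have "j = 0" by linarith
          then show False using j u by simp
        qed
        have "norm (\<phi> y * of_real (R x y)) \<le> 1 * \<bar>R x y\<bar>"
          unfolding norm_mult norm_of_real using elim by (intro mult_right_mono) auto
        also have "\<dots> = \<bar>2 * Re (cis (- \<alpha> * pi / 2) * kernel_tail n r (x - y))\<bar>"
          unfolding R_def bernoulli_kernel_split[OF n r c1] by simp
        also have "\<dots> \<le> 2 * norm (cis (- \<alpha> * pi / 2) * kernel_tail n r (x - y))"
          using abs_Re_le_cmod[of "cis (- \<alpha> * pi / 2) * kernel_tail n r (x - y)"] by simp
        also have "\<dots> = 2 * norm (kernel_tail n r (x - y))" by (simp add: norm_mult)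
        also have "\<dots> \<le> D x y"
          using kernel_tail_bound_wrapped[OF n \<rho> u] by (simp add: D_def A_def algebra_simps)
        finally show ?case by simp
      qed
      have DL: "integrable ?L (D x)" "(LINT y|?L. D x y) \<le> (LINT y|lborel. D x y)"
        using integrable_lborel_lebesgue_on[OF Di D0] by auto
      have Ri: "integrable ?L (\<lambda>y. \<phi> y * of_real (R x y))"
        by (rule Bochner_Integration.integrable_bound[OF DL(1) _ le]) (use Rm in measurable)
      have "norm (LINT y|?L. \<phi> y * of_real (R x y)) \<le> (LINT y|?L. D x y)"
      proof -
        have "norm (LINT y|?L. \<phi> y * of_real (R x y)) \<le> (LINT y|?L. norm (\<phi> y * of_real (R x y)))"
          by (rule integral_norm_bound)
        also have "\<dots> \<le> (LINT y|?L. D x y)"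
          using le by (intro integral_mono_AE integrable_norm Ri DL(1)) (simp add: D0)
        finally show ?thesis .
      qed
      also have "\<dots> \<le> 6 * A * \<Psi> * real n powr (- r)" using DL(2) unfolding DI .
      finally have RI: "norm (LINT y|?L. \<phi> y * of_real (R x y)) \<le> 6 * A * \<Psi> * real n powr (- r)" .
      have "\<phi> y * of_real (bernoulli_kernel r (x - y) \<alpha>) = \<phi> y * of_real (kernel_poly n r \<alpha> (x - y)) + \<phi> y * of_real (R x y)" for y
        by (simp add: R_def algebra_simps)
      then have "F x = p x + (LINT y|?L. \<phi> y * of_real (R x y)) / (2 * pi)"
        unfolding F PI[symmetric] by (simp add: Bochner_Integration.integral_add[OF Pi Ri] add_divide_distrib)
      then have "norm (F x - p x) = norm (LINT y|?L. \<phi> y * of_real (R x y)) / (2 * pi)"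
        by (simp add: norm_divide)
      also have "\<dots> \<le> 6 * A * \<Psi> * real n powr (- r) / (2 * pi)"
        using RI by (intro divide_right_mono) auto
      finally show ?thesis by (simp add: C_def)
    qed
    have "AE x in lebesgue. x \<in> {0..2*pi} \<longrightarrow> F x = (LINT y|?L. \<phi> y * of_real (bernoulli_kernel r (x - y) \<alpha>)) / (2 * pi)"
      using rep by (subst (asm) AE_restrict_space_iff) auto
    then have ae: "AE x in lebesgue. x \<in> {0<..<2*pi} \<longrightarrow> norm (F x - p x) \<le> C * real n powr (- r)"
      by eventually_elim (use bound in auto)
    have "norm (F x - p x) \<le> C * real n powr (- r)" if "x \<in> {0..2*pi}" for x
      by (rule AE_le_closure[OF _ _ ae])
        (use that in \<open>auto intro!: continuous_intros c trig1_continuous[OF tp]\<close>)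
    moreover have "norm (F (x + 2 * pi) - p (x + 2 * pi)) = norm (F x - p x)" for x
      using per trig1_periodic[OF tp] by simp
    ultimately have "norm (F x - p x) \<le> C * real n powr (- r)" for x
      using periodic_reduce[of "\<lambda>x. norm (F x - p x)" x] by metis
    then show "\<exists>p. trig1 n p \<and> (\<forall>x. norm (F x - p x) \<le> C * real n powr (- r))"
      using tp by blast
  qed
qed

section \<open>Korobov formulas on products and the recovery operators\<close>

definition character :: "int ^ 'n \<Rightarrow> real ^ 'n \<Rightarrow> complex" where
  "character k x = cis (\<Sum>j\<in>UNIV. real_of_int (k $ j) * x $ j)"

lemma cis_sum: "finite A \<Longrightarrow> cis (\<Sum>i\<in>A. f i) = (\<Prod>i\<in>A. cis (f i))"
  by (induction A rule: finite_induct) (simp_all flip: cis_mult)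

lemma character_prod: "character k x = (\<Prod>j\<in>UNIV. cis (of_int (k $ j) * x $ j))"
  unfolding character_def by (simp add: cis_sum)

lemma continuous_character [continuous_intros]: "continuous_on S (character k)"
  unfolding character_def by (intro continuous_intros)

lemma character_mem_trig_poly: "k \<in> hyperbolic_cross N \<Longrightarrow> character k \<in> trig_poly N"
  unfolding trig_poly_def character_def cis_conv_exp
  by (auto simp: fun_eq_iff if_distrib[of "\<lambda>c. c * _"] finite_hyperbolic_cross cong: if_cong
      intro!: exI[of _ "\<lambda>k'. if k' = k then 1 else 0"])

text \<open>
  Equality would force the real part of the character, which never exceeds \<open>1\<close>, to be \<open>1\<close> on the whole
  torus; but if \<open>k $ j \<noteq> 0\<close> it is \<open>- 1\<close> at the point \<open>pi / \<bar>k $ j\<bar>\<close> of the \<open>j\<close>-th axis.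
\<close>

lemma integral_character_neq:
  fixes k :: "int ^ 'n"
  assumes "k \<noteq> 0"
  shows "(LINT x|lebesgue_on torus. character k x) \<noteq> (2 * pi) ^ CARD('n)"
proof
  let ?a = "0 :: real ^ 'n" and ?b = "\<chi> i. 2 * pi :: real ^ 'n"
  assume eq: "(LINT x|lebesgue_on torus. character k x) = (2 * pi) ^ CARD('n)"
  have int: "character k integrable_on torus" by (intro integrable_continuous continuous_intros)
  have "(LINT x|lebesgue_on torus. character k x) = integral torus (character k)"
    by (rule lebesgue_integral_eq_integral[OF continuous_imp_integrable[OF continuous_character]]) simp
  then have "integral torus (\<lambda>x. Re (character k x)) = (2 * pi) ^ CARD('n)"
  proof -
    assume i: "(LINT x|lebesgue_on torus. character k x) = integral torus (character k)"
    have "integral torus (character k) = complex_of_real ((2 * pi) ^ CARD('n))" using eq i by simp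
    then have "Re (integral torus (character k)) = (2 * pi) ^ CARD('n)" by (simp only: Re_complex_of_real)
    then show ?thesis using integral_linear[OF int bounded_linear_Re] by (simp add: o_def)
  qed
  moreover have "measure lborel (torus :: (real ^ 'n) set) = (2 * pi) ^ CARD('n)"
    using content_cbox_cart[of ?a ?b] by (simp add: interval_ne_empty_cart)
  ultimately have "integral torus (\<lambda>x. 1 - Re (character k x)) = 0"
    by (subst Henstock_Kurzweil_Integration.integral_diff)
      (auto intro!: integrable_continuous continuous_intros simp: integral_const)
  moreover have "continuous_on torus (\<lambda>x. 1 - Re (character k x))" by (intro continuous_intros)
  ultimately have z: "1 - Re (character k x) = 0" if "x \<in> torus" for x
    using integral_cbox_eq_0_iff[of ?a ?b "\<lambda>x. 1 - Re (character k x)"] that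
    by (auto simp: interval_ne_empty_cart character_def)
  obtain j where j: "k $ j \<noteq> 0" using assms by (auto simp: vec_eq_iff)
  define x where "x = axis j (pi / \<bar>real_of_int (k $ j)\<bar>)"
  have "\<bar>k $ j\<bar> \<ge> 1" using j by linarith
  then have "1 \<le> \<bar>real_of_int (k $ j)\<bar>" by linarith
  then have "pi / \<bar>real_of_int (k $ j)\<bar> \<le> pi / 1" by (intro divide_left_mono) auto
  then have "pi / \<bar>real_of_int (k $ j)\<bar> \<le> 2 * pi" using pi_ge_zero by linarith
  then have "x \<in> torus" using j by (auto simp: x_def mem_box_cart axis_def)
  moreover have "(\<Sum>i\<in>UNIV. real_of_int (k $ i) * x $ i) = real_of_int (k $ j) * (pi / \<bar>real_of_int (k $ j)\<bar>)"
    by (simp add: x_def axis_def if_distrib[of "\<lambda>c. _ * c"] cong: if_cong)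
  moreover have "\<dots> = pi \<or> \<dots> = - pi" using j by (cases "k $ j > 0") (auto simp: field_simps)
  ultimately show False using z[of x] by (auto simp: character_def)
qed

text \<open>
  At the nodes the character takes the powers of one \<open>m\<close>-th root of unity, so the formula gives \<open>1\<close> or
  \<open>0\<close> according to whether this root is \<open>1\<close>. For \<open>k \<noteq> 0\<close> exactness excludes the value \<open>1\<close>, as
  the mean of the character differs from \<open>1\<close>.
\<close>

lemma korobov_character:
  fixes k :: "int ^ 'n"
  assumes m: "m \<ge> 1" and ex: "korobov_exact m h N" and k: "k \<in> hyperbolic_cross N"
  shows "korobov m (character k) h = (if k = 0 then 1 else 0)"
proof -
  define \<omega> where "\<omega> = cis (2 * pi * (\<Sum>j\<in>UNIV. real_of_int (k $ j) * real_of_int (h $ j)) / m)"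
  have node: "character k (korobov_node m h \<nu>) = \<omega> ^ \<nu>" for \<nu>
  proof -
    have "cis (of_int (k $ j) * (2 * pi * frac (real \<nu> * real_of_int (h $ j) / real m))) =
        cis (2 * pi * (of_int (k $ j) * (real \<nu> * of_int (h $ j) / real m)))" for j
    proof -
      let ?y = "real \<nu> * real_of_int (h $ j) / real m"
      have e: "of_int (k $ j) * (2 * pi * frac ?y) =
        2 * pi * (of_int (k $ j) * ?y) - 2 * pi * of_int (k $ j * \<lfloor>?y\<rfloor>)"
        by (simp add: frac_def algebra_simps)
      have "cis (2 * pi * of_int (k $ j * \<lfloor>?y\<rfloor>)) = 1" by (intro cis_multiple_2pi) simp
      then show ?thesis unfolding e by (simp flip: cis_divide)
    qed
    then have "character k (korobov_node m h \<nu>) = (\<Prod>j\<in>UNIV. cis (2 * pi * (of_int (k $ j) * (real \<nu> * of_int (h $ j) / real m))))"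
      by (simp add: character_prod korobov_node_def)
    also have "\<dots> = cis (\<Sum>j\<in>UNIV. 2 * pi * (of_int (k $ j) * (real \<nu> * of_int (h $ j) / real m)))"
      by (simp add: cis_sum)
    also have "(\<Sum>j\<in>UNIV. 2 * pi * (of_int (k $ j) * (real \<nu> * of_int (h $ j) / real m))) =
        real \<nu> * (2 * pi * (\<Sum>j\<in>UNIV. real_of_int (k $ j) * real_of_int (h $ j)) / m)"
      by (simp add: sum_distrib_left sum_divide_distrib mult_ac)
    finally show ?thesis unfolding \<omega>_def Complex.DeMoivre .
  qed
  have \<omega>m: "\<omega> ^ m = 1"
  proof -
    have "\<omega> ^ m = cis (2 * pi * of_int (\<Sum>j\<in>UNIV. k $ j * h $ j))"
      using m unfolding \<omega>_def Complex.DeMoivre by simp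
    also have "\<dots> = 1" by (intro cis_multiple_2pi Ints_of_int)
    finally show ?thesis .
  qed
  have kor: "korobov m (character k) h = (\<Sum>\<nu>=1..m. \<omega> ^ \<nu>) / of_nat m"
    by (simp add: korobov_def node)
  show ?thesis
  proof (cases "k = 0")
    case True
    then have "\<omega> = 1" by (simp add: \<omega>_def)
    then have "korobov m (character k) h = 1" using m by (simp add: kor)
    then show ?thesis using True by simp
  next
    case False
    have "\<omega> \<noteq> 1"
    proof
      assume "\<omega> = 1"
      then have "korobov m (character k) h = 1" using m by (simp add: kor)
      moreover have "korobov m (character k) h = (LINT x|lebesgue_on torus. character k x) / (2 * pi) ^ CARD('n)"
        using ex character_mem_trig_poly[OF k] unfolding korobov_exact_def by blast
      ultimately show False using integral_character_neq[OF False] by (simp add: field_simps)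
    qed
    have "(1 - \<omega>) * (\<Sum>\<nu><m. \<omega> ^ \<nu>) = 0" using one_diff_power_eq[of \<omega> m] \<omega>m by simp
    then have "(\<Sum>\<nu><m. \<omega> ^ \<nu>) = 0" using \<open>\<omega> \<noteq> 1\<close> by simp
    moreover have "(\<Sum>\<nu>=1..m. \<omega> ^ \<nu>) = \<omega> * (\<Sum>\<nu><m. \<omega> ^ \<nu>)"
      by (simp add: sum_distrib_left sum.atLeast1_atMost_eq)
    ultimately show ?thesis using False by (simp add: kor)
  qed
qed

lemma korobov_sum: "korobov m (\<lambda>x. \<Sum>a\<in>A. c a * F a x) h = (\<Sum>a\<in>A. c a * korobov m (F a) h)"
  unfolding korobov_def
  by (simp add: sum_divide_distrib sum_distrib_left) (rule sum.swap)

text \<open>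
  The frequencies of a product of univariate polynomials of degrees \<open>D i\<close> fill a box. The box lies in
  the hyperbolic cross when the product of the degrees is at most \<open>N\<close>, so the formula extracts the
  constant coefficient, which is the product of the means.
\<close>

lemma korobov_prod:
  fixes h :: "int ^ 'n" and D :: "'n \<Rightarrow> nat"
  assumes m: "m \<ge> 1" and ex: "korobov_exact m h N"
    and D: "\<And>i. D i \<ge> 1" "(\<Prod>i\<in>UNIV. D i) \<le> N" and p: "\<And>i. trig1 (D i) (p i)"
  shows "korobov m (\<lambda>x. \<Prod>i\<in>UNIV. p i (x $ i)) h = (\<Prod>i\<in>UNIV. mean (p i))"
proof -
  have "\<forall>i. \<exists>c. \<forall>x. p i x = (\<Sum>k\<in>{- int (D i)..int (D i)}. c k * cis (of_int k * x))"
    using p unfolding trig1_def by blast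
  then obtain c where c: "\<And>i x. p i x = (\<Sum>k\<in>{- int (D i)..int (D i)}. c i k * cis (of_int k * x))"
    by metis
  let ?P = "PiE UNIV (\<lambda>i. {- int (D i)..int (D i)})"
  have fin: "finite ?P" by (intro finite_PiE) auto
  have mean_p: "mean (p i) = c i 0" for i
  proof -
    have "mean (p i) = (\<Sum>k\<in>{- int (D i)..int (D i)}. c i k * mean (\<lambda>t. cis (of_int k * t)))"
      unfolding c by (subst mean_sum) (auto simp: mean_cmult intro!: continuous_intros)
    then show ?thesis by (simp add: mean_cis if_distrib[of "\<lambda>z. _ * z"] cong: if_cong)
  qed
  have "(\<Prod>i\<in>UNIV. p i (x $ i)) = (\<Sum>\<kappa>\<in>?P. (\<Prod>i\<in>UNIV. c i (\<kappa> i)) * character (\<chi> i. \<kappa> i) x)" for x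
    unfolding c by (subst prod_sum_PiE) (auto simp: character_prod prod.distrib)
  then have "korobov m (\<lambda>x. \<Prod>i\<in>UNIV. p i (x $ i)) h = (\<Sum>\<kappa>\<in>?P. (\<Prod>i\<in>UNIV. c i (\<kappa> i)) * korobov m (character (\<chi> i. \<kappa> i)) h)"
    by (simp only: korobov_sum)
  also have "\<dots> = (\<Sum>\<kappa>\<in>?P. if \<kappa> = (\<lambda>i. 0) then (\<Prod>i\<in>UNIV. c i 0) else 0)"
  proof (rule sum.cong[OF refl])
    fix \<kappa> assume \<kappa>: "\<kappa> \<in> ?P"
    have "(\<Prod>i\<in>UNIV. max \<bar>\<kappa> i\<bar> 1) \<le> (\<Prod>i\<in>UNIV. int (D i))"
    proof (rule prod_mono)
      fix i show "0 \<le> max \<bar>\<kappa> i\<bar> 1 \<and> max \<bar>\<kappa> i\<bar> 1 \<le> int (D i)"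
        using PiE_mem[OF \<kappa>, of i] D(1)[of i] by auto
    qed
    also have "\<dots> \<le> int N" using D(2) by (simp flip: of_nat_prod)
    finally have "(\<chi> i. \<kappa> i) \<in> hyperbolic_cross N" by (simp add: hyperbolic_cross_def)
    from korobov_character[OF m ex this]
    show "(\<Prod>i\<in>UNIV. c i (\<kappa> i)) * korobov m (character (\<chi> i. \<kappa> i)) h = (if \<kappa> = (\<lambda>i. 0) then (\<Prod>i\<in>UNIV. c i 0) else 0)"
      by (auto simp: vec_eq_iff fun_eq_iff)
  qed
  also have "\<dots> = (\<Prod>i\<in>UNIV. c i 0)" using fin by (auto simp: sum.delta')
  finally show ?thesis by (simp add: mean_p)
qed

text \<open>
  The modulus of the kernel is at most a product of positive univariate polynomials of mean \<open>3\<close>, and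
  their sum over the nodes is evaluated exactly by the cubature formula.
\<close>

lemma V_bounded:
  fixes s :: "nat ^ 'n"
  assumes m: "m \<ge> 1" and ex: "korobov_exact m h N" and s: "(\<Prod>i\<in>UNIV. 3 * 2 ^ (s $ i)) \<le> N"
    and B: "\<And>x. norm (f x) \<le> B"
  shows "norm (V m h s f x) \<le> 3 ^ CARD('n) * B"
proof -
  have B0: "B \<ge> 0" using B[of 0] norm_ge_zero order_trans by blast
  define K :: "'n \<Rightarrow> real \<Rightarrow> real" where "K i u = 2 * fejer (2 * 2 ^ (s $ i)) u + fejer (2 ^ (s $ i)) u" for i u
  have K0: "K i u \<ge> 0" for i u unfolding K_def by (intro add_nonneg_nonneg mult_nonneg_nonneg fejer_nonneg) auto
  have KT: "trig1 (3 * 2 ^ (s $ i)) (\<lambda>u. of_real (K i u))" for i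
  proof -
    have 1: "trig1 (3 * 2 ^ (s $ i)) (\<lambda>u. of_real (fejer (2 * 2 ^ (s $ i)) u))"
      by (rule trig1_fejer) simp
    have 2: "trig1 (3 * 2 ^ (s $ i)) (\<lambda>u. of_real (fejer (2 ^ (s $ i)) u))"
      by (rule trig1_fejer) simp
    show ?thesis unfolding K_def using trig1_add[OF trig1_cmult[OF 1, of 2] 2] by simp
  qed
  have Km: "mean (\<lambda>u. of_real (K i u)) = 3" for i
  proof -
    have "mean (\<lambda>u. of_real (K i u)) = mean (\<lambda>u. 2 * of_real (fejer (2 * 2 ^ (s $ i)) u) + of_real (fejer (2 ^ (s $ i)) u))"
      by (simp add: K_def)
    also have "\<dots> = 2 * 1 + 1"
      by (subst mean_add) (simp_all add: mean_cmult mean_fejer continuous_intros continuous_fejer)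
    finally show ?thesis by simp
  qed
  let ?w = "korobov_node m h"
  have "norm (\<Sum>\<nu>=1..m. f (?w \<nu>) * vallee_poussin (\<chi> i. 2 ^ (s $ i)) (x - ?w \<nu>))
     \<le> (\<Sum>\<nu>=1..m. B * (\<Prod>i\<in>UNIV. K i (x $ i - ?w \<nu> $ i)))"
  proof (rule sum_norm_le)
    fix \<nu>
    have "norm (vallee_poussin (\<chi> i. 2 ^ (s $ i)) (x - ?w \<nu>)) \<le> (\<Prod>i\<in>UNIV. K i (x $ i - ?w \<nu> $ i))"
      unfolding vallee_poussin_def prod_norm[symmetric] K_def
      by (intro prod_mono) (auto intro: norm_vallee_poussin1_le)
    then show "norm (f (?w \<nu>) * vallee_poussin (\<chi> i. 2 ^ (s $ i)) (x - ?w \<nu>)) \<le> B * (\<Prod>i\<in>UNIV. K i (x $ i - ?w \<nu> $ i))"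
      unfolding norm_mult by (intro mult_mono B B0) auto
  qed
  then have "norm (V m h s f x) \<le> (\<Sum>\<nu>=1..m. B * (\<Prod>i\<in>UNIV. K i (x $ i - ?w \<nu> $ i))) / m"
    unfolding V_def using m by (simp add: norm_divide divide_right_mono)
  also have "\<dots> = B * ((\<Sum>\<nu>=1..m. \<Prod>i\<in>UNIV. K i (x $ i - ?w \<nu> $ i)) / m)" by (simp add: sum_distrib_left)
  also have "(\<Sum>\<nu>=1..m. \<Prod>i\<in>UNIV. K i (x $ i - ?w \<nu> $ i)) / m = Re (korobov m (\<lambda>y. \<Prod>i\<in>UNIV. complex_of_real (K i (x $ i - y $ i))) h)"
  proof -
    have "korobov m (\<lambda>y. \<Prod>i\<in>UNIV. complex_of_real (K i (x $ i - y $ i))) h =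
        complex_of_real ((\<Sum>\<nu>=1..m. \<Prod>i\<in>UNIV. K i (x $ i - ?w \<nu> $ i)) / m)"
      unfolding korobov_def by simp
    then show ?thesis by (simp only: Re_complex_of_real)
  qed
  also have "korobov m (\<lambda>y. \<Prod>i\<in>UNIV. complex_of_real (K i (x $ i - y $ i))) h = (\<Prod>i\<in>(UNIV :: 'n set). mean (\<lambda>u. of_real (K i (x $ i - u))))"
    by (rule korobov_prod[OF m ex _ s trig1_reflect(1)[OF KT]]) simp
  also have "\<dots> = 3 ^ CARD('n)"
    by (simp add: trig1_reflect(2)[OF KT] Km)
  finally show ?thesis by (simp add: mult.commute)
qed

text \<open>
  Multiplying the kernel, of degree less than \<open>2 * 2 ^ s\<close> in each variable, by the character raises the
  degree to at most \<open>3 * 2 ^ s\<close>, within the reach of the cubature formula. Hence the sum over the nodes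
  is the genuine convolution with the de la Vallee Poussin kernel, which fixes the character.
\<close>

lemma V_character:
  fixes s :: "nat ^ 'n"
  assumes m: "m \<ge> 1" and ex: "korobov_exact m h N" and s: "(\<Prod>i\<in>UNIV. 3 * 2 ^ (s $ i)) \<le> N"
    and k: "\<And>i. \<bar>k $ i\<bar> \<le> 2 ^ (s $ i)"
  shows "V m h s (character k) x = character k x"
proof -
  have cont: "continuous_on UNIV (\<lambda>u. cis (of_int (- j) * u) * vallee_poussin1 n u)" for j n
    by (intro continuous_intros continuous_vallee_poussin1)
  define q where "q i u = cis (of_int (k $ i) * (x $ i)) * (cis (of_int (- k $ i) * u) * vallee_poussin1 (2 ^ (s $ i)) u)" for i u
  have q: "trig1 (3 * 2 ^ (s $ i)) (q i)" for i
  proof -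
    have "trig1 (2 ^ (s $ i)) (\<lambda>u. 1 * cis (of_int (- k $ i) * u))"
      by (rule trig1_cis) (use k[of i] in simp)
    from trig1_mult[OF this trig1_vallee_poussin1[of "2 ^ (s $ i)"]]
    have "trig1 (2 ^ (s $ i) + (2 * 2 ^ (s $ i) - 1)) (\<lambda>u. cis (of_int (- k $ i) * u) * vallee_poussin1 (2 ^ (s $ i)) u)" by (simp only: mult_1_left)
    then have "trig1 (3 * 2 ^ (s $ i)) (\<lambda>u. cis (of_int (- k $ i) * u) * vallee_poussin1 (2 ^ (s $ i)) u)"
      by (rule trig1_mono) simp
    then show ?thesis unfolding q_def by (rule trig1_cmult)
  qed
  have qm: "mean (q i) = cis (of_int (k $ i) * (x $ i))" for i
  proof -
    have "mean (q i) = cis (of_int (k $ i) * (x $ i)) * 1"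
      unfolding q_def mean_cmult by (subst mean_cis_vallee_poussin1) (use k[of i] in auto)
    then show ?thesis by simp
  qed
  have e: "character k y * vallee_poussin (\<chi> i. 2 ^ (s $ i)) (x - y) = (\<Prod>i\<in>UNIV. q i (x $ i - y $ i))" for y
  proof -
    have "cis (of_int (k $ i) * y $ i) = cis (of_int (k $ i) * (x $ i)) * cis (of_int (- k $ i) * (x $ i - y $ i))" for i
      by (simp add: cis_mult algebra_simps)
    then show ?thesis
      unfolding character_prod vallee_poussin_def q_def prod.distrib[symmetric]
      by (intro prod.cong refl) (simp del: of_int_minus)
  qed
  have "V m h s (character k) x = korobov m (\<lambda>y. \<Prod>i\<in>UNIV. q i (x $ i - y $ i)) h"
    unfolding V_def korobov_def e ..
  also have "\<dots> = (\<Prod>i\<in>UNIV. mean (\<lambda>u. q i (x $ i - u)))"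
    by (rule korobov_prod[OF m ex _ s trig1_reflect(1)[OF q]]) simp
  also have "\<dots> = character k x"
    by (simp add: trig1_reflect(2)[OF q] qm character_prod)
  finally show ?thesis .
qed

section \<open>Both function classes along coordinate lines\<close>

lemma axis_add: "axis j (a + b) = axis j a + (axis j b :: real ^ 'n)"
  by (simp add: axis_def vec_eq_iff)

lemma axis_0 [simp]: "axis j 0 = 0"
  by (simp add: axis_def vec_eq_iff)

lemma axis_shift_eq: "(x :: real ^ 'n) + axis j (y - x $ j) = (\<chi> i. if i = j then y else x $ i)"
  by (simp add: axis_def vec_eq_iff)

lemma continuous_axis [continuous_intros]: "continuous_on S G \<Longrightarrow> continuous_on S (\<lambda>t. axis j (G t) :: real ^ 'n)"
  unfolding axis_def
proof (intro continuous_on_vec_lambda)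
  fix i assume "continuous_on S G"
  then show "continuous_on S (\<lambda>t. if i = j then G t else 0)" by (cases "i = j") simp_all
qed

lemma line_continuous: "continuous_on UNIV f \<Longrightarrow> continuous_on S (\<lambda>t. f (x + axis j (c + t)))" for f :: "real ^ 'n \<Rightarrow> complex"
  by (rule continuous_on_compose2[of UNIV f]) (auto intro!: continuous_intros)

lemma line_periodic: "periodic_torus f \<Longrightarrow> f (x + axis j (t + 2 * pi)) = f (x + axis j t)"
  unfolding axis_add add.assoc[symmetric] by (simp add: periodic_torus_def)

text \<open>
  The coordinates are moved into the period one at a time.
\<close>

lemma periodic_torus_reduce:
  fixes g :: "real ^ 'n \<Rightarrow> 'a"
  assumes per: "\<And>x j. g (x + axis j (2 * pi)) = g x"
  obtains y where "y \<in> torus" "g x = g y"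
proof -
  have "\<exists>y. g x = g y \<and> (\<forall>i\<in>J. y $ i \<in> {0..2 * pi})" if "finite J" for J :: "'n set"
    using that
  proof (induction J rule: finite_induct)
    case (insert j J)
    then obtain y where y: "g x = g y" "\<forall>i\<in>J. y $ i \<in> {0..2 * pi}" by blast
    define H where "H t = g (y + axis j (t - y $ j))" for t
    have "H (t + 2 * pi) = H t" for t
      unfolding H_def using per[of "y + axis j (t - y $ j)" j]
      by (simp add: add.assoc diff_add_eq flip: axis_add)
    then obtain s where s: "s \<in> {0..2 * pi}" "H (y $ j) = H s" by (rule periodic_reduce)
    have "H (y $ j) = g y" by (simp add: H_def axis_shift_eq)
    moreover have "\<forall>i\<in>insert j J. (y + axis j (s - y $ j)) $ i \<in> {0..2 * pi}"
      using s(1) y(2) unfolding axis_shift_eq by simp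
    ultimately show ?case using y(1) s(2) unfolding H_def by metis
  qed auto
  from this[of UNIV] obtain y where "g x = g y" "\<forall>i. y $ i \<in> {0..2 * pi}" by auto
  then show ?thesis by (intro that[of y]) (auto simp: mem_box_cart)
qed

lemma AE_torus_imp_all:
  fixes H :: "real ^ 'n \<Rightarrow> real"
  assumes c: "continuous_on UNIV H" and per: "\<And>x j. H (x + axis j (2 * pi)) = H x"
    and ae: "AE x in lebesgue. x \<in> torus \<longrightarrow> H x \<le> \<epsilon>"
  shows "H x \<le> \<epsilon>"
proof -
  obtain y where y: "y \<in> torus" "H x = H y" using periodic_torus_reduce[of H, OF per] .
  let ?U = "box 0 (\<chi> i. 2 * pi) :: (real ^ 'n) set"
  have "0 + axis undefined 0 \<in> ?U \<or> (\<chi> i. pi) \<in> ?U" by (auto simp: mem_box_cart)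
  then have "?U \<noteq> {}" by blast
  then have cl: "closure ?U = torus" by simp
  have "AE x in lebesgue. x \<in> ?U \<longrightarrow> H x \<le> \<epsilon>"
    using ae by eventually_elim (use box_subset_cbox in blast)
  then have "H y \<le> \<epsilon>" by (rule AE_le_closure[OF c open_box]) (use y cl in simp)
  then show ?thesis using y by simp
qed

lemma difference_line: "(diff1 h ^^ l) (\<lambda>t. f (x + axis j t)) t = (difference j h ^^ l) f (x + axis j t)"
proof (induction l arbitrary: t)
  case (Suc l)
  then show ?case by (simp add: diff1_def difference_def axis_add add.assoc)
qed simp

lemma difference_C_torus:
  fixes f :: "real ^ 'n \<Rightarrow> complex"
  assumes "f \<in> C_torus" shows "(difference j h ^^ l) f \<in> C_torus"
proof (induction l)
  case (Suc l)
  let ?g = "(difference j h ^^ l) f"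
  have g: "periodic_torus ?g" "continuous_on UNIV ?g" using Suc by (auto simp: C_torus_def)
  have "continuous_on UNIV (\<lambda>x. ?g (x + axis j h) - ?g x)"
    by (intro continuous_intros continuous_on_compose2[OF g(2)] g(2)) auto
  moreover have "?g (x + axis i (2 * pi) + axis j h) = ?g (x + axis j h)" for x i
  proof -
    have "x + axis i (2 * pi) + axis j h = (x + axis j h) + axis i (2 * pi)" by (simp add: add_ac)
    then show ?thesis using g(1) unfolding periodic_torus_def by metis
  qed
  ultimately show ?case using g(1) by (simp add: C_torus_def periodic_torus_def difference_def[abs_def])
qed (use assms in simp)

lemma Linf_norm_le_AE:
  assumes "Linf_norm f \<le> ereal c"
  shows "AE x in lebesgue. x \<in> torus \<longrightarrow> norm (f x) \<le> c"
proof -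
  have "AE x in lebesgue_on torus. ereal (norm (f x)) \<le> Linf_norm f"
    unfolding Linf_norm_def by (rule esssup_AE)
  then have "AE x in lebesgue_on torus. norm (f x) \<le> c"
  proof eventually_elim
    case (elim x)
    then have "ereal (norm (f x)) \<le> ereal c" using assms by (rule order_trans)
    then show ?case by simp
  qed
  then show ?thesis by (subst (asm) AE_restrict_space_iff) auto
qed

text \<open>
  The convolution with the univariate kernel in the variable \<open>x $ j\<close>. The sign of \<open>t\<close> is
  immaterial because the kernel is even.
\<close>

definition vp_op :: "'n \<Rightarrow> nat \<Rightarrow> (real ^ 'n \<Rightarrow> complex) \<Rightarrow> real ^ 'n \<Rightarrow> complex" where
  "vp_op j n f x = mean (\<lambda>t. f (x + axis j t) * vallee_poussin1 n t)"

text \<open>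
  The difference of a continuous function is continuous, so the essential bound in the definition of
  the class holds at every point and restricts to each coordinate line.
\<close>

lemma nikolskii_direction:
  fixes r :: "real ^ 'n"
  assumes "r $ j > 0"
  shows "\<exists>C\<ge>0. \<forall>f n x. f \<in> C_torus \<longrightarrow> f \<in> nikolskii_H r \<longrightarrow> n \<ge> 1 \<longrightarrow>
    norm (f x - vp_op j n f x) \<le> C * real n powr (- r $ j)"
proof -
  let ?l = "nat \<lfloor>r $ j\<rfloor> + 1"
  obtain C where C: "C \<ge> 0" "\<And>F n. n \<ge> 1 \<Longrightarrow> continuous_on UNIV F \<Longrightarrow> (\<And>t. F (t + 2 * pi) = F t) \<Longrightarrow>
    (\<And>h x. norm ((diff1 h ^^ ?l) F x) \<le> \<bar>h\<bar> powr (r $ j)) \<Longrightarrow>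
    \<exists>p. trig1 n p \<and> (\<forall>x. norm (F x - p x) \<le> C * real n powr (- r $ j))"
    using jackson_trig_approximation[OF assms, of ?l] by auto
  show ?thesis
  proof (intro exI[of _ "4 * C"] conjI allI impI)
    show "4 * C \<ge> 0" using C by simp
    fix f :: "real ^ 'n \<Rightarrow> complex" and n :: nat and x
    assume f: "f \<in> C_torus" and H: "f \<in> nikolskii_H r" and n: "n \<ge> 1"
    have per: "periodic_torus f" and cont: "continuous_on UNIV f" using f by (auto simp: C_torus_def)
    let ?F = "\<lambda>t. f (x + axis j t)"
    have cF: "continuous_on UNIV ?F" using line_continuous[OF cont, where S = UNIV and x = x and j = j and c = 0] by simp
    have "norm ((diff1 h ^^ ?l) ?F t) \<le> \<bar>h\<bar> powr (r $ j)" for h t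
    proof -
      let ?D = "(difference j h ^^ ?l) f"
      have D: "periodic_torus ?D" "continuous_on UNIV ?D"
        using difference_C_torus[OF f, where j = j and h = h and l = ?l] by (auto simp: C_torus_def)
      have "Linf_norm ?D \<le> ereal (\<bar>h\<bar> powr (r $ j))" using H by (auto simp: nikolskii_H_def)
      from AE_torus_imp_all[OF _ _ Linf_norm_le_AE[OF this], of "x + axis j t"]
      show ?thesis using D unfolding difference_line by (auto simp: periodic_torus_def intro: continuous_intros)
    qed
    from C(2)[OF n cF line_periodic[OF per] this]
    obtain p where p: "trig1 n p" "\<And>t. norm (?F t - p t) \<le> C * real n powr (- r $ j)" by blast
    have "norm (?F 0 - mean (\<lambda>t. ?F t * vallee_poussin1 n t)) \<le> 4 * (C * real n powr (- r $ j))"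
      by (rule vallee_poussin_near_best[OF cF p(1) n p(2)])
    then show "norm (f x - vp_op j n f x) \<le> 4 * C * real n powr (- r $ j)"
      by (simp add: vp_op_def axis_def zero_vec_def[symmetric] flip: zero_vec_def)
  qed
qed

lemma continuous_vp_op:
  assumes "continuous_on UNIV f" shows "continuous_on UNIV (vp_op j n f)"
proof -
  have "continuous_on (UNIV \<times> cbox 0 (2 * pi)) (\<lambda>(x, t). f (x + axis j t) * vallee_poussin1 n t)"
    unfolding split_beta
    by (intro continuous_intros continuous_on_compose2[OF assms] continuous_on_compose2[OF continuous_vallee_poussin1[of UNIV n]]) auto
  from integral_continuous_on_param[OF this]
  show ?thesis unfolding vp_op_def[abs_def] mean_def by (auto intro!: continuous_intros)
qed

lemma periodic_vp_op: "periodic_torus f \<Longrightarrow> periodic_torus (vp_op j n f)"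
proof -
  assume "periodic_torus f"
  then have "f (x + axis i (2 * pi) + axis j t) = f (x + axis j t)" for x i t
  proof -
    have "x + axis i (2 * pi) + axis j t = (x + axis j t) + axis i (2 * pi)" by (simp add: add_ac)
    then show ?thesis using \<open>periodic_torus f\<close> unfolding periodic_torus_def by metis
  qed
  then show ?thesis unfolding periodic_torus_def vp_op_def by simp
qed

lemma AE_lborel_translate:
  fixes P :: "'a::euclidean_space \<Rightarrow> bool"
  assumes "AE x in lborel. P x" shows "AE x in lborel. P (x + a)"
proof -
  obtain N where N: "N \<in> null_sets lborel" "{x. \<not> P x} \<subseteq> N"
    using assms by (auto simp: eventually_ae_filter)
  have Nb [measurable]: "N \<in> sets borel" using N by auto
  have "AE x in distr lborel borel ((+) a). x \<notin> N"
    unfolding lborel_distr_plus using N(1) by (rule AE_not_in)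
  then have "AE x in lborel. a + x \<notin> N" by (subst (asm) AE_distr_iff) auto
  then show ?thesis by eventually_elim (use N(2) in \<open>auto simp: add.commute\<close>)
qed

text \<open>
  Each translate of a null set is null, so by Tonelli the pairs \<open>(x, t)\<close> for which \<open>x + axis j t\<close> falls
  into the exceptional set form a null set. Moving along \<open>axis j\<close> instead of splitting off a coordinate
  makes a product decomposition of the space unnecessary.
\<close>

lemma AE_lines:
  fixes P :: "real ^ 'n \<Rightarrow> bool"
  assumes "AE x in lebesgue. P x"
  shows "AE x in lborel. AE t in lborel. P (x + axis j t)"
proof -
  have "AE x in lborel. P x" using assms by (simp add: AE_completion_iff)
  then obtain N where N: "N \<in> null_sets lborel" "{x. \<not> P x} \<subseteq> N"
    by (auto simp: eventually_ae_filter)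
  have Nb [measurable]: "N \<in> sets borel" using N by auto
  have "AE x in lborel. x + axis j t \<notin> N" for t
    using AE_lborel_translate[OF AE_not_in[OF N(1)]] .
  then have "AE t in lborel. AE x in lborel. x + axis j t \<notin> N" by simp
  moreover have "(AE x in lborel. AE t in lborel. x + axis j t \<notin> N) \<longleftrightarrow> (AE t in lborel. AE x in lborel. x + axis j t \<notin> N)"
  proof (rule pair_sigma_finite.AE_commute)
    show "pair_sigma_finite (lborel :: (real ^ 'n) measure) (lborel :: real measure)" ..
    have "(\<lambda>z. fst z + axis j (snd z)) \<in> borel_measurable (borel :: ((real ^ 'n) \<times> real) measure)"
      by (intro borel_measurable_continuous_onI continuous_intros)
    then have [measurable]: "(\<lambda>z :: (real ^ 'n) \<times> real. fst z + axis j (snd z)) \<in> borel_measurable (lborel \<Otimes>\<^sub>M lborel)"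
      by (simp add: lborel_prod)
    show "{z \<in> space (lborel \<Otimes>\<^sub>M lborel). fst z + axis j (snd z) \<notin> N} \<in> sets ((lborel :: (real ^ 'n) measure) \<Otimes>\<^sub>M (lborel :: real measure))"
      by measurable
  qed
  ultimately have "AE x in lborel. AE t in lborel. x + axis j t \<notin> N" by blast
  then show ?thesis
  proof eventually_elim
    case (elim x)
    then show ?case by eventually_elim (use N(2) in auto)
  qed
qed

lemma AE_coordinate_lines:
  fixes P :: "real ^ 'n \<Rightarrow> bool"
  assumes "AE x in lebesgue. x \<in> torus \<longrightarrow> P x"
  shows "AE x in lebesgue. x \<in> torus \<longrightarrow> (AE y in lebesgue_on {0..2 * pi}. P (\<chi> i. if i = j then y else x $ i))"
proof -
  have "AE x in lborel. x \<in> torus \<longrightarrow> (AE y in lebesgue_on {0..2 * pi}. P (\<chi> i. if i = j then y else x $ i))"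
    using AE_lines[OF assms, of j]
  proof eventually_elim
    case (elim x)
    show ?case
    proof
      assume x: "x \<in> torus"
      have "AE y in lborel. x + axis j (y + - (x $ j)) \<in> torus \<longrightarrow> P (x + axis j (y + - (x $ j)))"
        by (rule AE_lborel_translate[OF elim])
      then have "AE y in lebesgue. x + axis j (y - x $ j) \<in> torus \<longrightarrow> P (x + axis j (y - x $ j))"
        by (intro AE_completion) simp
      then have "AE y in lebesgue. y \<in> {0..2 * pi} \<longrightarrow> P (\<chi> i. if i = j then y else x $ i)"
        unfolding axis_shift_eq
        by eventually_elim (use x in \<open>auto simp: mem_box_cart\<close>)
      then show "AE y in lebesgue_on {0..2 * pi}. P (\<chi> i. if i = j then y else x $ i)"
        by (subst AE_restrict_space_iff) auto
    qed
  qed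
  then show ?thesis by (rule AE_completion)
qed

text \<open>
  The restriction of a Lebesgue measurable function to a line may fail to be measurable; a Borel
  function that agrees with it almost everywhere restricts well to every line.
\<close>

lemma borel_representative:
  fixes \<phi> :: "real ^ 'n \<Rightarrow> complex"
  assumes "\<phi> \<in> borel_measurable (lebesgue_on torus)"
  obtains \<phi>' where "\<phi>' \<in> borel_measurable borel" "AE x in lebesgue. x \<in> torus \<longrightarrow> \<phi> x = \<phi>' x"
proof -
  let ?\<phi> = "\<lambda>x. if x \<in> torus then \<phi> x else 0"
  have "?\<phi> \<in> borel_measurable lebesgue"
    using assms by (subst (asm) measurable_restrict_space_iff[where c = 0]) auto
  then have m: "(\<lambda>x. Re (?\<phi> x)) \<in> borel_measurable lebesgue" "(\<lambda>x. Im (?\<phi> x)) \<in> borel_measurable lebesgue"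
    by (auto intro: borel_measurable_Re borel_measurable_Im)
  obtain a where a: "a \<in> borel_measurable lborel" "AE x in lborel. Re (?\<phi> x) = a x"
    using completion_ex_borel_measurable_real[OF m(1)] by blast
  obtain b where b: "b \<in> borel_measurable lborel" "AE x in lborel. Im (?\<phi> x) = b x"
    using completion_ex_borel_measurable_real[OF m(2)] by blast
  have "AE x in lborel. x \<in> torus \<longrightarrow> \<phi> x = Complex (a x) (b x)"
    using a(2) b(2) by eventually_elim (auto simp: complex_eq_iff)
  moreover have "(\<lambda>x. Complex (a x) (b x)) \<in> borel_measurable borel"
    using a(1) b(1) unfolding Complex_eq by measurable
  ultimately show ?thesis by (intro that) (auto intro: AE_completion)
qed

text \<open>
  On almost every line in direction \<open>j\<close> the density is measurable and bounded by \<open>1\<close> and the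
  representation holds almost everywhere, so the univariate estimate applies there. The resulting
  inequality extends to all points by continuity.
\<close>

lemma sobolev_direction:
  fixes r :: "real ^ 'n"
  assumes "r $ j > 0"
  shows "\<exists>C\<ge>0. \<forall>f n x. f \<in> C_torus \<longrightarrow> (\<exists>\<alpha>. f \<in> sobolev_W r \<alpha>) \<longrightarrow> n \<ge> 1 \<longrightarrow>
    norm (f x - vp_op j n f x) \<le> C * real n powr (- r $ j)"
proof -
  let ?L = "lebesgue_on {0..2 * pi}"
  obtain C where C: "C \<ge> 0" "\<And>F \<phi> \<alpha> n. n \<ge> 1 \<Longrightarrow> continuous_on UNIV F \<Longrightarrow> (\<And>t. F (t + 2 * pi) = F t) \<Longrightarrow>
    \<phi> \<in> borel_measurable ?L \<Longrightarrow> AE y in ?L. norm (\<phi> y) \<le> 1 \<Longrightarrow>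
    AE x in ?L. F x = (LINT y|?L. \<phi> y * complex_of_real (bernoulli_kernel (r $ j) (x - y) \<alpha>)) / (2 * pi) \<Longrightarrow>
    \<exists>p. trig1 n p \<and> (\<forall>x. norm (F x - p x) \<le> C * real n powr (- r $ j))"
    using sobolev_trig_approximation[OF assms] by auto
  show ?thesis
  proof (intro exI[of _ "4 * C"] conjI allI impI)
    show "4 * C \<ge> 0" using C by simp
    fix f :: "real ^ 'n \<Rightarrow> complex" and n :: nat and x
    assume f: "f \<in> C_torus" and W: "\<exists>\<alpha>. f \<in> sobolev_W r \<alpha>" and n: "n \<ge> 1"
    have per: "periodic_torus f" and cont: "continuous_on UNIV f" using f by (auto simp: C_torus_def)
    obtain \<alpha> where "f \<in> sobolev_W r \<alpha>" using W by blast
    then obtain \<phi> where \<phi>: "\<phi> \<in> borel_measurable (lebesgue_on torus)" "Linf_norm \<phi> \<le> 1"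
      and rep: "AE x in lebesgue_on torus. f x = (LINT y|?L. \<phi> (\<chi> i. if i = j then y else x $ i) *
                of_real (bernoulli_kernel (r $ j) (x $ j - y) (\<alpha> $ j))) / (2 * pi)"
      unfolding sobolev_W_def by blast
    obtain \<phi>' where \<phi>': "\<phi>' \<in> borel_measurable borel" "AE x in lebesgue. x \<in> torus \<longrightarrow> \<phi> x = \<phi>' x"
      using borel_representative[OF \<phi>(1)] .
    have b: "AE x in lebesgue. x \<in> torus \<longrightarrow> norm (\<phi> x) \<le> 1"
      using \<phi>(2) by (intro Linf_norm_le_AE) (simp add: one_ereal_def)
    have rep': "AE x in lebesgue. x \<in> torus \<longrightarrow> f x = (LINT y|?L. \<phi> (\<chi> i. if i = j then y else x $ i) *
                of_real (bernoulli_kernel (r $ j) (x $ j - y) (\<alpha> $ j))) / (2 * pi)"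
      using rep by (subst (asm) AE_restrict_space_iff) auto
    define E where "E = C * real n powr (- r $ j)"
    have "AE x in lebesgue. x \<in> torus \<longrightarrow> norm (f x - vp_op j n f x) \<le> 4 * E"
      using AE_coordinate_lines[OF \<phi>'(2), of j] AE_coordinate_lines[OF b, of j] AE_coordinate_lines[OF rep', of j]
    proof eventually_elim
      case (elim x)
      show ?case
      proof
        assume x: "x \<in> torus"
        let ?u = "\<lambda>y. \<chi> i. if i = j then y else x $ i"
        have cu: "continuous_on UNIV ?u"
          unfolding axis_shift_eq[symmetric] by (intro continuous_intros)
        have "(\<lambda>y. \<phi>' (?u y)) \<in> borel_measurable borel"
          by (rule measurable_compose[OF borel_measurable_continuous_onI[OF cu] \<phi>'(1)])
        then have m': "(\<lambda>y. \<phi>' (?u y)) \<in> borel_measurable lebesgue" by (intro measurable_completion) simp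
        have ae: "AE y in lebesgue. y \<in> {0..2 * pi} \<longrightarrow> \<phi> (?u y) = \<phi>' (?u y)"
          using elim(1) x by (subst (asm) AE_restrict_space_iff) auto
        have "(\<lambda>y. if y \<in> {0..2 * pi} then \<phi>' (?u y) else 0) \<in> borel_measurable lebesgue"
          using m' by (intro measurable_If_set) auto
        then have "(\<lambda>y. if y \<in> {0..2 * pi} then \<phi> (?u y) else 0) \<in> borel_measurable lebesgue"
          by (rule borel_measurable_AE) (use ae in eventually_elim, auto)
        then have m: "(\<lambda>y. \<phi> (?u y)) \<in> borel_measurable ?L"
          by (subst measurable_restrict_space_iff[where c = 0]) auto
        let ?F = "\<lambda>y. f (?u y)"
        have cF: "continuous_on UNIV ?F" by (rule continuous_on_compose2[OF cont cu]) simp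
        have pF: "?F (t + 2 * pi) = ?F t" for t
          unfolding axis_shift_eq[symmetric] using line_periodic[OF per, of x j "t - x $ j"] by (simp add: algebra_simps)
        have "AE y in ?L. norm (\<phi> (?u y)) \<le> 1" using elim(2) x by blast
        moreover have "AE y in ?L. ?F y = (LINT y'|?L. \<phi> (?u y') * complex_of_real (bernoulli_kernel (r $ j) (y - y') (\<alpha> $ j))) / (2 * pi)"
        proof -
          have "(\<chi> i. if i = j then y' else ?u y $ i) = ?u y'" for y y' by (simp add: vec_eq_iff)
          then show ?thesis using elim(3) x by simp
        qed
        ultimately obtain p where p: "trig1 n p" "\<And>y. norm (?F y - p y) \<le> E"
          using C(2)[OF n cF pF m] unfolding E_def by blast
        let ?F' = "\<lambda>t. f (x + axis j t)"
        have F': "?F' t = ?F (t + x $ j)" for t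
          unfolding axis_shift_eq[symmetric] by simp
        have cF': "continuous_on UNIV ?F'" using line_continuous[OF cont, where S = UNIV and x = x and j = j and c = 0] by simp
        have "norm (?F' 0 - mean (\<lambda>t. ?F' t * vallee_poussin1 n t)) \<le> 4 * E"
          by (rule vallee_poussin_near_best[OF cF' trig1_shift[OF p(1), of "x $ j"] n]) (simp only: F' p(2))
        then show "norm (f x - vp_op j n f x) \<le> 4 * E" by (simp add: vp_op_def)
      qed
    qed
    moreover have "continuous_on UNIV (\<lambda>x. norm (f x - vp_op j n f x))"
      by (intro continuous_intros cont continuous_vp_op)
    moreover have "norm (f (x + axis i (2 * pi)) - vp_op j n f (x + axis i (2 * pi))) = norm (f x - vp_op j n f x)" for x i
      using per periodic_vp_op[OF per, of j n] by (simp add: periodic_torus_def)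
    ultimately have "norm (f x - vp_op j n f x) \<le> 4 * E" by (intro AE_torus_imp_all[where H = "\<lambda>x. norm (f x - vp_op j n f x)"])
    then show "norm (f x - vp_op j n f x) \<le> 4 * C * real n powr (- r $ j)" by (simp add: E_def mult.assoc)
  qed
qed

section \<open>From single variables to all variables\<close>

text \<open>
  Sums of terms that are exponentials, of frequency at most \<open>M i\<close>, in the variables \<open>x $ i\<close> with
  \<open>i \<in> J\<close>, with coefficients that are continuous periodic functions of the remaining variables.
  For \<open>J = UNIV\<close> the coefficients are constant. The inductive form serves because only linear
  operators are applied to such sums.
\<close>

inductive_set partial_trig :: "'n set \<Rightarrow> ('n \<Rightarrow> nat) \<Rightarrow> (real ^ 'n \<Rightarrow> complex) set" for J M where
  base: "c \<in> C_torus \<Longrightarrow> (\<And>i x t. i \<in> J \<Longrightarrow> c (x + axis i t) = c x) \<Longrightarrow>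
     (\<And>i. i \<in> J \<Longrightarrow> \<bar>k $ i\<bar> \<le> int (M i)) \<Longrightarrow> (\<And>i. i \<notin> J \<Longrightarrow> k $ i = 0) \<Longrightarrow>
     (\<lambda>x. c x * character k x) \<in> partial_trig J M"
| zero: "(\<lambda>x. 0) \<in> partial_trig J M"
| add: "p \<in> partial_trig J M \<Longrightarrow> q \<in> partial_trig J M \<Longrightarrow> (\<lambda>x. p x + q x) \<in> partial_trig J M"

lemma partial_trig_sum:
  "(\<And>a. a \<in> A \<Longrightarrow> F a \<in> partial_trig J M) \<Longrightarrow> (\<lambda>x. \<Sum>a\<in>A. F a x) \<in> partial_trig J M"
  by (induction A rule: infinite_finite_induct) (auto intro: partial_trig.zero partial_trig.add)

lemma character_add: "character k (x + y) = character k x * character k y"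
  by (simp add: character_def cis_mult sum.distrib algebra_simps)

lemma character_axis: "character k (axis j t) = cis (of_int (k $ j) * t)"
  by (simp add: character_def axis_def if_distrib[of "\<lambda>c. _ * c"] cong: if_cong)

lemma periodic_character: "periodic_torus (character k)"
proof -
  have "cis (of_int (k $ j) * (2 * pi)) = 1" for j using cis_periodic[of "k $ j" 0] by simp
  then show ?thesis unfolding periodic_torus_def character_add character_axis by simp
qed

lemma partial_trig_C_torus: "p \<in> partial_trig J M \<Longrightarrow> p \<in> C_torus"
proof (induction rule: partial_trig.induct)
  case (base c k)
  then show ?case using periodic_character[of k]
    by (auto simp: C_torus_def periodic_torus_def intro!: continuous_intros)
qed (auto simp: C_torus_def periodic_torus_def intro!: continuous_intros)

lemma continuous_vp_op_integrand:
  "f \<in> C_torus \<Longrightarrow> continuous_on UNIV (\<lambda>t. f (x + axis j t) * vallee_poussin1 n t)"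
  using line_continuous[where S = UNIV and x = x and j = j and c = 0 and f = f]
  by (auto simp: C_torus_def intro!: continuous_intros continuous_vallee_poussin1)

lemma vp_op_add:
  assumes "p \<in> C_torus" "q \<in> C_torus"
  shows "vp_op j n (\<lambda>x. p x + q x) x = vp_op j n p x + vp_op j n q x"
  unfolding vp_op_def distrib_right by (intro mean_add continuous_vp_op_integrand assms)

lemma vp_op_diff:
  assumes "p \<in> C_torus" "q \<in> C_torus"
  shows "vp_op j n (\<lambda>x. p x - q x) x = vp_op j n p x - vp_op j n q x"
  unfolding vp_op_def left_diff_distrib by (intro mean_diff continuous_vp_op_integrand assms)

lemma vp_op_bounded:
  assumes "f \<in> C_torus" "n \<ge> 1" "\<And>x. norm (f x) \<le> B"
  shows "norm (vp_op j n f x) \<le> 3 * B"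
proof -
  have "continuous_on UNIV (\<lambda>t. f (x + axis j t))"
    using assms(1) line_continuous[where S = UNIV and x = x and j = j and c = 0 and f = f] by (auto simp: C_torus_def)
  then show ?thesis unfolding vp_op_def by (rule norm_vallee_poussin_mean_le) (use assms in auto)
qed

text \<open>
  The \<open>j\<close>-th convolution of \<open>c x * character k x\<close> is a combination of Fourier coefficients \<open>G a\<close> of
  \<open>c\<close> in the variable \<open>x $ j\<close>. Translation in this variable multiplies \<open>G a\<close> by an exponential, so
  \<open>G a\<close> is that exponential times a function that does not depend on \<open>x $ j\<close>, and the exponential
  goes into the character.
\<close>

lemma vp_op_partial_trig:
  fixes p :: "real ^ 'n \<Rightarrow> complex"
  assumes p: "p \<in> partial_trig J M" and j: "j \<notin> J" and n: "2 * n - 1 \<le> M j"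
  shows "vp_op j n p \<in> partial_trig (insert j J) M"
  using p
proof (induction rule: partial_trig.induct)
  case zero
  have "vp_op j n (\<lambda>x. 0) = (\<lambda>x. 0)" by (simp add: vp_op_def[abs_def])
  then show ?case by (simp add: partial_trig.zero)
next
  case (add p q)
  have "vp_op j n (\<lambda>x. p x + q x) = (\<lambda>x. vp_op j n p x + vp_op j n q x)"
    using add by (intro ext vp_op_add partial_trig_C_torus)
  then show ?case using add by (simp add: partial_trig.add)
next
  case (base c k)
  have per: "periodic_torus c" and cont: "continuous_on UNIV c" using base(1) by (auto simp: C_torus_def)
  obtain v where v: "\<And>t. vallee_poussin1 n t = (\<Sum>a\<in>{- int (2*n-1)..int (2*n-1)}. v a * cis (of_int a * t))"
    using trig1_vallee_poussin1[of n] unfolding trig1_def by blast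
  define G where "G a x = mean (\<lambda>t. cis (of_int a * t) * c (x + axis j t))" for a :: int and x
  have line: "continuous_on UNIV (\<lambda>t. c (x + axis j t))" for x
    using line_continuous[OF cont, where S = UNIV and x = x and j = j and c = 0] by simp
  have Gc: "continuous_on UNIV (G a)" for a
  proof -
    have "continuous_on (UNIV \<times> cbox 0 (2 * pi)) (\<lambda>(x, t). cis (of_int a * t) * c (x + axis j t))"
      unfolding split_beta by (intro continuous_intros continuous_on_compose2[OF cont]) auto
    from integral_continuous_on_param[OF this]
    show ?thesis unfolding G_def[abs_def] mean_def by (auto intro!: continuous_intros)
  qed
  have comm: "x + axis i u + axis j t = (x + axis j t) + axis i u" for x :: "real ^ 'n" and i u t
    by (simp add: add_ac)
  have Gper: "G a (x + axis i (2 * pi)) = G a x" for a x i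
    using per unfolding G_def comm by (simp add: periodic_torus_def)
  have Gj: "G a (x + axis j u) = cis (- of_int a * u) * G a x" for a x u
  proof -
    let ?p = "\<lambda>t. cis (of_int a * t) * c (x + axis j t)"
    have "?p (t + 2 * pi) = ?p t" for t by (simp only: cis_periodic line_periodic[OF per])
    moreover have "continuous_on UNIV ?p" by (intro continuous_intros line)
    ultimately have "mean (\<lambda>t. ?p (t + u)) = mean ?p" by (intro mean_shift)
    moreover have "?p (t + u) = cis (of_int a * u) * (cis (of_int a * t) * c (x + axis j u + axis j t))" for t
    proof -
      have "x + axis j (t + u) = x + axis j u + axis j t" by (simp add: axis_add add_ac)
      then show ?thesis by (simp add: algebra_simps flip: cis_mult)
    qed
    ultimately have "cis (of_int a * u) * G a (x + axis j u) = G a x"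
      unfolding G_def by (simp only: mean_cmult)
    then have "cis (- of_int a * u) * (cis (of_int a * u) * G a (x + axis j u)) = cis (- of_int a * u) * G a x" by simp
    then show ?thesis unfolding mult.assoc[symmetric] cis_mult by simp
  qed
  \<comment> \<open>The Fourier coefficient with its dependence on \<open>x $ j\<close> cancelled.\<close>
  define c' where "c' a x = v a * (cis (of_int a * x $ j) * G a x)" for a x
  have ca: "c' a \<in> C_torus" for a
  proof -
    have "cis (of_int a * (x + axis i (2 * pi)) $ j) = cis (of_int a * x $ j)" for x :: "real ^ 'n" and i
      by (cases "i = j") (simp_all add: axis_def cis_periodic)
    then show ?thesis unfolding C_torus_def periodic_torus_def c'_def[abs_def] using Gc
      by (auto simp: Gper intro!: continuous_intros simp del: vector_add_component)
  qed
  have inv: "c' a (x + axis i t) = c' a x" if "i \<in> insert j J" for a i x t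
  proof (cases "i = j")
    case True
    have "cis (of_int a * (x + axis j t) $ j) * cis (- of_int a * t) = cis (of_int a * x $ j)"
      by (simp add: cis_mult axis_def algebra_simps)
    then show ?thesis unfolding True c'_def Gj by (simp only: mult.assoc[symmetric])
  next
    case False
    then have "i \<in> J" using that by simp
    then have "G a (x + axis i t) = G a x" unfolding G_def comm using base(2) by simp
    then show ?thesis unfolding c'_def using False by (simp add: axis_def)
  qed
  have kj: "k $ j = 0" using base(4) j by simp
  define k' where "k' a = (\<chi> i. if i = j then - a else k $ i)" for a :: int
  have chk: "character (k' a) x = cis (- of_int a * x $ j) * character k x" for a x
  proof -
    have "character (k' a) x = cis (of_int (- a) * x $ j) * (\<Prod>i\<in>UNIV - {j}. cis (of_int (k $ i) * x $ i))"
      unfolding character_prod k'_def by (simp add: prod.remove[of UNIV j])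
    also have "(\<Prod>i\<in>UNIV - {j}. cis (of_int (k $ i) * x $ i)) = character k x"
      unfolding character_prod using kj by (simp add: prod.remove[of UNIV j])
    finally show ?thesis by simp
  qed
  have "vp_op j n (\<lambda>x. c x * character k x) x = (\<Sum>a\<in>{- int (2*n-1)..int (2*n-1)}. c' a x * character (k' a) x)" for x
  proof -
    have "vp_op j n (\<lambda>x. c x * character k x) x = mean (\<lambda>t. \<Sum>a\<in>{- int (2*n-1)..int (2*n-1)}.
        (v a * character k x) * (cis (of_int a * t) * c (x + axis j t)))"
      unfolding vp_op_def v character_add character_axis kj
      by (simp add: sum_distrib_left mult_ac)
    also have "\<dots> = (\<Sum>a\<in>{- int (2*n-1)..int (2*n-1)}. (v a * character k x) * G a x)"
      unfolding G_def by (subst mean_sum) (auto simp: mean_cmult intro!: continuous_intros line)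
    also have "\<dots> = (\<Sum>a\<in>{- int (2*n-1)..int (2*n-1)}. c' a x * character (k' a) x)"
    proof (rule sum.cong[OF refl])
      fix a
      have "cis (of_int a * x $ j) * cis (- of_int a * x $ j) = 1" by (simp add: cis_mult)
      then show "(v a * character k x) * G a x = c' a x * character (k' a) x"
        unfolding c'_def chk by (simp only: mult_ac) (simp only: mult.assoc[symmetric], simp add: mult_ac)
    qed
    finally show ?thesis .
  qed
  then have "vp_op j n (\<lambda>x. c x * character k x) = (\<lambda>x. \<Sum>a\<in>{- int (2*n-1)..int (2*n-1)}. c' a x * character (k' a) x)" ..
  also have "\<dots> \<in> partial_trig (insert j J) M"
  proof (intro partial_trig_sum partial_trig.base ca inv)
    fix a i assume a: "a \<in> {- int (2 * n - 1)..int (2 * n - 1)}" and i: "i \<in> insert j J"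
    then show "\<bar>k' a $ i\<bar> \<le> int (M i)" using n base(3)[of i] by (auto simp: k'_def)
  next
    fix a i assume "i \<notin> insert j J"
    then show "k' a $ i = 0" using base(4)[of i] by (auto simp: k'_def)
  qed
  finally show ?case .
qed

text \<open>
  Convolve in one variable after the other. The new error is the error of \<open>f\<close> itself in the new
  direction plus the image of the old error under an operator of norm \<open>3\<close>, so only approximation of
  \<open>f\<close> along single coordinates enters.
\<close>

lemma exists_partial_trig:
  assumes f: "f \<in> C_torus" and n: "\<And>j. n j \<ge> 1" "\<And>j. 2 * n j - 1 \<le> M j"
    and e: "\<And>j x. norm (f x - vp_op j (n j) f x) \<le> \<epsilon> j" and J: "finite J"
  shows "\<exists>p\<in>partial_trig J M. \<forall>x. norm (f x - p x) \<le> 4 ^ card J * (\<Sum>j\<in>J. \<epsilon> j)"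
  using J
proof (induction J rule: finite_induct)
  case empty
  have "(\<lambda>x. f x * character 0 x) \<in> partial_trig {} M" using f by (intro partial_trig.base) auto
  then show ?case by (intro bexI) (auto simp: character_def)
next
  case (insert j J)
  then obtain p where p: "p \<in> partial_trig J M" "\<And>x. norm (f x - p x) \<le> 4 ^ card J * (\<Sum>j\<in>J. \<epsilon> j)" by blast
  have pC: "p \<in> C_torus" by (rule partial_trig_C_torus[OF p(1)])
  have d: "(\<lambda>x. f x - p x) \<in> C_torus"
    using f pC by (auto simp: C_torus_def periodic_torus_def intro!: continuous_intros)
  have e0: "\<epsilon> i \<ge> 0" for i using e[of _ i] norm_ge_zero order_trans by blast
  let ?S = "\<Sum>j\<in>J. \<epsilon> j"
  have S0: "?S \<ge> 0" by (intro sum_nonneg e0)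
  have "norm (f x - vp_op j (n j) p x) \<le> 4 ^ card (insert j J) * (\<Sum>j\<in>insert j J. \<epsilon> j)" for x
  proof -
    have "f x - vp_op j (n j) p x = (f x - vp_op j (n j) f x) + vp_op j (n j) (\<lambda>x. f x - p x) x"
      by (simp add: vp_op_diff[OF f pC])
    also have "norm \<dots> \<le> \<epsilon> j + 3 * (4 ^ card J * ?S)"
      by (intro norm_triangle_le add_mono e vp_op_bounded d n p(2))
    also have "\<dots> \<le> 4 ^ Suc (card J) * \<epsilon> j + 4 ^ Suc (card J) * ?S"
    proof (intro add_mono)
      have "1 * \<epsilon> j \<le> 4 ^ Suc (card J) * \<epsilon> j" by (intro mult_right_mono e0 one_le_power) auto
      then show "\<epsilon> j \<le> 4 ^ Suc (card J) * \<epsilon> j" by simp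
      show "3 * (4 ^ card J * ?S) \<le> 4 ^ Suc (card J) * ?S" using S0 by simp
    qed
    finally show ?thesis using insert by (simp add: distrib_left)
  qed
  then show ?case using vp_op_partial_trig[OF p(1) insert(2) n(2)] by blast
qed

text \<open>
  A coefficient that is invariant in all coordinate directions is constant, so this is reproduction of
  characters.
\<close>

lemma V_partial_trig:
  fixes s :: "nat ^ 'n"
  assumes m: "m \<ge> 1" and ex: "korobov_exact m h N" and s: "(\<Prod>i\<in>UNIV. 3 * 2 ^ (s $ i)) \<le> N"
    and p: "p \<in> partial_trig UNIV (\<lambda>i. 2 ^ (s $ i))"
  shows "V m h s p x = p x"
  using p
proof (induction rule: partial_trig.induct)
  case (base c k)
  have c: "c y = c 0" for y
  proof -
    have "c (0 + (\<Sum>i\<in>J. axis i (y $ i))) = c 0" if "finite J" for J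
      using that
    proof (induction J rule: finite_induct)
      case (insert j J)
      then show ?case using base(2)[of j "\<Sum>i\<in>J. axis i (y $ i)" "y $ j"] by (simp add: add.commute)
    qed simp
    moreover have "(\<Sum>i\<in>UNIV. axis i (y $ i)) = y"
      by (simp add: vec_eq_iff axis_def if_distrib[of "\<lambda>c. _ * c"] cong: if_cong)
    ultimately show ?thesis by (metis add_0 finite)
  qed
  define c0 where "c0 = c 0"
  have c0: "c y = c0" for y using c unfolding c0_def .
  have "V m h s (\<lambda>x. c0 * character k x) x = c0 * V m h s (character k) x"
    unfolding V_def by (simp add: sum_distrib_left mult.assoc)
  moreover have "V m h s (character k) x = character k x"
    by (rule V_character[OF m ex s]) (use base(3) in auto)
  ultimately show ?case by (simp add: c0)
next
  case zero then show ?case by (simp add: V_def)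
next
  case (add p q)
  then show ?case by (simp add: V_def distrib_right sum.distrib add_divide_distrib)
qed

lemma V_diff: "V m h s (\<lambda>x. f x - p x) x = V m h s f x - V m h s p x"
  by (simp add: V_def left_diff_distrib sum_subtractf diff_divide_distrib)

section \<open>The choice of the exponents and the rate\<close>

lemma class_direction:
  fixes r :: "real ^ 'n"
  assumes "r $ j > 0"
  shows "\<exists>C\<ge>0. \<forall>f n x. f \<in> C_torus \<longrightarrow> (\<exists>\<alpha>. f \<in> sobolev_W r \<alpha>) \<or> f \<in> nikolskii_H r \<longrightarrow> n \<ge> 1 \<longrightarrow>
    norm (f x - vp_op j n f x) \<le> C * real n powr (- r $ j)"
proof -
  obtain A where A: "A \<ge> 0" "\<And>f n x. f \<in> C_torus \<Longrightarrow> \<exists>\<alpha>. f \<in> sobolev_W r \<alpha> \<Longrightarrow> n \<ge> 1 \<Longrightarrow>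
    norm (f x - vp_op j n f x) \<le> A * real n powr (- r $ j)"
    using sobolev_direction[of r j, OF assms] by blast
  obtain B where B: "B \<ge> 0" "\<And>f n x. f \<in> C_torus \<Longrightarrow> f \<in> nikolskii_H r \<Longrightarrow> n \<ge> 1 \<Longrightarrow>
    norm (f x - vp_op j n f x) \<le> B * real n powr (- r $ j)"
    using nikolskii_direction[of r j, OF assms] by blast
  show ?thesis
  proof (intro exI[of _ "max A B"] conjI allI impI)
    fix f n x
    assume f: "f \<in> C_torus" "(\<exists>\<alpha>. f \<in> sobolev_W r \<alpha>) \<or> f \<in> nikolskii_H r" "(n::nat) \<ge> 1"
    have "A * real n powr (- r $ j) \<le> max A B * real n powr (- r $ j)"
      "B * real n powr (- r $ j) \<le> max A B * real n powr (- r $ j)" by (intro mult_right_mono; simp)+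
    then show "norm (f x - vp_op j n f x) \<le> max A B * real n powr (- r $ j)"
      using f(2) A(2)[OF f(1) _ f(3), of x] B(2)[OF f(1) _ f(3), of x] by (meson order_trans)
  qed (use A in simp)
qed

lemma sup_norm_le:
  assumes "\<And>x. norm (f x) \<le> K" shows "sup_norm f \<le> K"
proof -
  have "(0 :: real ^ 'n) \<in> torus" by (simp add: mem_box_cart)
  then show ?thesis unfolding sup_norm_def using assms by (intro cSUP_least) blast+
qed

lemma g_pos:
  fixes r :: "real ^ 'n"
  assumes "\<forall>j. r $ j > 0" shows "g r > 0"
  unfolding g_def using assms by (intro positive_imp_inverse_positive sum_pos) auto

text \<open>
  The real numbers \<open>t i = l * g r / r $ i\<close> have sum \<open>l\<close>, because \<open>g r\<close> is the reciprocal of the sum of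
  the \<open>1 / r $ i\<close>, and make all products \<open>t i * r $ i\<close> equal. Rounding down all but one
  and giving the remainder to that one keeps the sum and loses at most \<open>1\<close> in each entry.
\<close>

lemma balanced_exponents:
  fixes r :: "real ^ 'n"
  assumes r: "\<forall>j. r $ j > 0"
  obtains s :: "nat ^ 'n" where "(\<Sum>i\<in>UNIV. s $ i) = l" "\<And>i. real (s $ i) * r $ i \<ge> real l * g r - r $ i"
proof -
  define t where "t i = real l * g r / r $ i" for i
  have t0: "t i \<ge> 0" for i unfolding t_def using r g_pos[OF r] by (simp add: less_imp_le)
  have ts: "(\<Sum>i\<in>UNIV. t i) = real l"
  proof -
    have "(\<Sum>i\<in>UNIV. t i) = real l * g r * (\<Sum>i\<in>UNIV. 1 / r $ i)"
      unfolding t_def by (simp add: sum_distrib_left)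
    then show ?thesis using g_pos[OF r] by (simp add: g_def)
  qed
  define j0 :: 'n where "j0 = undefined"
  define s where "s = (\<chi> i. if i = j0 then l - (\<Sum>k\<in>UNIV - {j0}. nat \<lfloor>t k\<rfloor>) else nat \<lfloor>t i\<rfloor>)"
  have split: "real l = t j0 + (\<Sum>k\<in>UNIV - {j0}. t k)"
    using ts by (simp add: sum.remove[of UNIV j0])
  have "real (\<Sum>k\<in>UNIV - {j0}. nat \<lfloor>t k\<rfloor>) = (\<Sum>k\<in>UNIV - {j0}. real (nat \<lfloor>t k\<rfloor>))" by simp
  also have "\<dots> \<le> (\<Sum>k\<in>UNIV - {j0}. t k)" by (intro sum_mono) (use t0 in simp)
  finally have le: "real (\<Sum>k\<in>UNIV - {j0}. nat \<lfloor>t k\<rfloor>) \<le> (\<Sum>k\<in>UNIV - {j0}. t k)" .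
  then have le': "(\<Sum>k\<in>UNIV - {j0}. nat \<lfloor>t k\<rfloor>) \<le> l" using split t0[of j0] by linarith
  have "(\<Sum>i\<in>UNIV. s $ i) = s $ j0 + (\<Sum>k\<in>UNIV - {j0}. s $ k)" by (rule sum.remove) auto
  also have "(\<Sum>k\<in>UNIV - {j0}. s $ k) = (\<Sum>k\<in>UNIV - {j0}. nat \<lfloor>t k\<rfloor>)" by (intro sum.cong) (auto simp: s_def)
  finally have 1: "(\<Sum>i\<in>UNIV. s $ i) = l" using le' by (simp add: s_def)
  have 2: "real (s $ i) \<ge> t i - 1" for i
  proof (cases "i = j0")
    case True
    have "real (s $ j0) = real l - real (\<Sum>k\<in>UNIV - {j0}. nat \<lfloor>t k\<rfloor>)" using le' by (simp add: s_def of_nat_diff)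
    then show ?thesis unfolding True using le split by linarith
  next
    case False
    then have "s $ i = nat \<lfloor>t i\<rfloor>" by (simp add: s_def)
    then show ?thesis by linarith
  qed
  have "real (s $ i) * r $ i \<ge> real l * g r - r $ i" for i
  proof -
    have "(t i - 1) * r $ i \<le> real (s $ i) * r $ i" using 2 r by (intro mult_right_mono) (auto simp: less_imp_le)
    moreover have "(t i - 1) * r $ i = real l * g r - r $ i"
      using r[rule_format, of i] by (simp add: t_def left_diff_distrib)
    ultimately show ?thesis by simp
  qed
  with 1 show ?thesis by (rule that)
qed

lemma GREATEST_power_bounds:
  fixes D :: real
  assumes N: "D \<le> real N" and D: "D \<ge> 1" and l: "l = (GREATEST l'. (2::real) ^ l' \<le> real N / D)"
  shows "2 ^ l * D \<le> real N" "real N < 2 * D * 2 ^ l"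
proof -
  let ?P = "\<lambda>l'. (2::real) ^ l' \<le> real N / D"
  have 0: "?P 0" using N D by simp
  have b: "k \<le> N" if "?P k" for k
  proof -
    have "real k < 2 ^ k" by (rule of_nat_less_two_power)
    also have "\<dots> \<le> real N / D" by (rule that)
    also have "\<dots> \<le> real N / 1" using D by (intro divide_left_mono) auto
    finally show ?thesis by simp
  qed
  have "?P l" unfolding l by (rule GreatestI_nat[where P = ?P and k = 0 and b = N]) (use 0 b in auto)
  then show "2 ^ l * D \<le> real N" using D by (simp add: field_simps)
  have "\<not> ?P (Suc l)"
  proof
    assume "?P (Suc l)"
    then have "Suc l \<le> l" unfolding l by (rule Greatest_le_nat[where P = ?P and b = N]) (use b in auto)
    then show False by simp
  qed
  then show "real N < 2 * D * 2 ^ l" using D by (simp add: field_simps)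
qed

text \<open>
  The convolution of order \<open>n\<close> has degree \<open>2 * n - 1\<close>, so for degree \<open>2 ^ a\<close> the order is halved. For
  \<open>a = 0\<close> truncated subtraction gives order \<open>1\<close> and degree \<open>1\<close>, which is still admissible.
\<close>

lemma halved_power_bounds:
  defines "n \<equiv> \<lambda>a::nat. 2 ^ (a - 1)"
  shows "n a \<ge> 1" "2 * n a - 1 \<le> (2 ^ a :: nat)" "2 ^ a \<le> 2 * n a"
  by (cases a; simp add: n_def)+

text \<open>
  For balanced \<open>s\<close> the recovery operator reproduces the polynomial obtained from \<open>f\<close> by successive
  convolutions, and it has norm at most \<open>3 ^ CARD('n)\<close>. So its error is at most \<open>1 + 3 ^ CARD('n)\<close> times
  the approximation error, and each direction contributes a multiple of \<open>2 powr (- l * g r)\<close>.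
\<close>

lemma recovery_bound:
  fixes r :: "real ^ 'n"
  assumes r: "\<forall>j. r $ j > 0"
  shows "\<exists>K\<ge>0. \<forall>m h N l f. m \<ge> 1 \<longrightarrow> korobov_exact m h N \<longrightarrow> 3 ^ CARD('n) * 2 ^ l \<le> N \<longrightarrow>
    f \<in> C_torus \<longrightarrow> (\<exists>\<alpha>. f \<in> sobolev_W r \<alpha>) \<or> f \<in> nikolskii_H r \<longrightarrow>
    (\<exists>s :: nat ^ 'n. (\<Sum>i\<in>UNIV. s $ i) = l \<and> (\<forall>x. norm (f x - V m h s f x) \<le> K * 2 powr (- real l * g r)))"
proof -
  have "\<forall>j. \<exists>C\<ge>0. \<forall>f n x. f \<in> C_torus \<longrightarrow> (\<exists>\<alpha>. f \<in> sobolev_W r \<alpha>) \<or> f \<in> nikolskii_H r \<longrightarrow> n \<ge> 1 \<longrightarrow>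
    norm (f x - vp_op j n f x) \<le> C * real n powr (- r $ j)"
    using class_direction r by blast
  then obtain c where c: "\<And>j. c j \<ge> 0" "\<And>j f n x. f \<in> C_torus \<Longrightarrow> (\<exists>\<alpha>. f \<in> sobolev_W r \<alpha>) \<or> f \<in> nikolskii_H r \<Longrightarrow> n \<ge> 1 \<Longrightarrow>
    norm (f x - vp_op j n f x) \<le> c j * real n powr (- r $ j)"
    by metis
  define S where "S = (\<Sum>j\<in>UNIV. c j * 4 powr (r $ j))"
  have S0: "S \<ge> 0" unfolding S_def by (intro sum_nonneg mult_nonneg_nonneg c) auto
  define K where "K = (1 + 3 ^ CARD('n)) * (4 ^ CARD('n) * S)"
  show ?thesis
  proof (intro exI[of _ K] conjI allI impI)
    show "K \<ge> 0" using S0 by (simp add: K_def)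
    fix m N l :: nat and h :: "int ^ 'n" and f :: "real ^ 'n \<Rightarrow> complex"
    assume m: "m \<ge> 1" and ex: "korobov_exact m h N" and lN: "3 ^ CARD('n) * 2 ^ l \<le> N"
      and f: "f \<in> C_torus" and cl: "(\<exists>\<alpha>. f \<in> sobolev_W r \<alpha>) \<or> f \<in> nikolskii_H r"
    obtain s :: "nat ^ 'n" where s: "(\<Sum>i\<in>UNIV. s $ i) = l" "\<And>i. real (s $ i) * r $ i \<ge> real l * g r - r $ i"
      using balanced_exponents[OF r] by blast
    define n where "n j = (2::nat) ^ (s $ j - 1)" for j
    have n: "n j \<ge> 1" "2 * n j - 1 \<le> 2 ^ (s $ j)" "2 ^ (s $ j) \<le> 2 * n j" for j
      unfolding n_def by (rule halved_power_bounds)+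
    define R where "R = 2 powr (- real l * g r)"
    have eps: "norm (f x - vp_op j (n j) f x) \<le> c j * (4 powr (r $ j) * R)" for j x
    proof -
      have rj: "r $ j > 0" using r by blast
      have "real (n j) powr (- r $ j) \<le> (2 powr (real (s $ j) - 1)) powr (- r $ j)"
      proof (rule powr_mono2')
        have "real (2 ^ (s $ j)) \<le> real (2 * n j)" using n(3) of_nat_mono by blast
        then show "2 powr (real (s $ j) - 1) \<le> real (n j)" by (simp add: powr_diff powr_realpow)
      qed (use rj in auto)
      also have "\<dots> = 2 powr (r $ j - real (s $ j) * r $ j)" by (simp add: powr_powr algebra_simps)
      also have "\<dots> \<le> 2 powr (2 * r $ j + - real l * g r)" using s(2)[of j] by (intro powr_mono) auto
      also have "\<dots> = 4 powr (r $ j) * R"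
        using powr_powr[of 2 2 "r $ j"] unfolding R_def powr_add by simp
      finally have "c j * real (n j) powr (- r $ j) \<le> c j * (4 powr (r $ j) * R)" by (intro mult_left_mono c)
      then show ?thesis using c(2)[OF f cl n(1)[of j], where j = j and x = x] by simp
    qed
    obtain p where p: "p \<in> partial_trig UNIV (\<lambda>i. 2 ^ (s $ i))"
        "\<And>x. norm (f x - p x) \<le> 4 ^ CARD('n) * (\<Sum>j\<in>UNIV. c j * (4 powr (r $ j) * R))"
      using exists_partial_trig[of f n "\<lambda>i. 2 ^ (s $ i)" "\<lambda>j. c j * (4 powr (r $ j) * R)" UNIV, OF f n(1,2) eps] by auto
    define E where "E = 4 ^ CARD('n) * (S * R)"
    have pE: "norm (f x - p x) \<le> E" for x
      using p(2)[of x] unfolding E_def S_def sum_distrib_right by (simp add: mult.assoc)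
    have sN: "(\<Prod>i\<in>UNIV. 3 * 2 ^ (s $ i)) \<le> N"
      using lN by (simp add: prod.distrib power_sum[symmetric] s(1))
    have "norm (f x - V m h s f x) \<le> K * R" for x
    proof -
      have "f x - V m h s f x = (f x - p x) - V m h s (\<lambda>x. f x - p x) x"
        by (simp add: V_diff V_partial_trig[OF m ex sN p(1)])
      also have "norm \<dots> \<le> E + 3 ^ CARD('n) * E"
        by (intro norm_triangle_le_diff add_mono pE V_bounded[OF m ex sN])
      finally show ?thesis by (simp add: K_def E_def algebra_simps)
    qed
    then show "\<exists>s :: nat ^ 'n. (\<Sum>i\<in>UNIV. s $ i) = l \<and> (\<forall>x. norm (f x - V m h s f x) \<le> K * 2 powr (- real l * g r))"
      using s(1) unfolding R_def by blast
  qed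
qed

theorem proposition4p4:
  fixes r :: "real ^ 'n"
  assumes "\<forall>j. r $ j > 0"
  shows "\<exists>C>0. \<forall>(m::nat) (N::nat) (h :: int ^ 'n) (l::nat).
    m \<ge> 1 \<longrightarrow> korobov_exact m h N \<longrightarrow> N \<ge> 2 * 3 ^ CARD('n) \<longrightarrow>
    l = (GREATEST l'. (2::real) ^ l' \<le> real N / 3 ^ CARD('n)) \<longrightarrow>
    (\<forall>f \<in> C_torus. (\<exists>\<alpha>. f \<in> sobolev_W r \<alpha>) \<or> f \<in> nikolskii_H r \<longrightarrow>
      (\<forall>s. optimal_s m h l f s \<longrightarrow>
        sup_norm (\<lambda>x. f x - V m h s f x) \<le> C * real N powr (- g r)))"
proof -
  obtain K where K: "K \<ge> 0" and rec: "\<And>m h N l f. m \<ge> 1 \<Longrightarrow> korobov_exact m h N \<Longrightarrow> 3 ^ CARD('n) * 2 ^ l \<le> N \<Longrightarrow>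
    f \<in> C_torus \<Longrightarrow> (\<exists>\<alpha>. f \<in> sobolev_W r \<alpha>) \<or> f \<in> nikolskii_H r \<Longrightarrow>
    \<exists>s :: nat ^ 'n. (\<Sum>i\<in>UNIV. s $ i) = l \<and> (\<forall>x. norm (f x - V m h s f x) \<le> K * 2 powr (- real l * g r))"
    using recovery_bound[OF assms] by blast
  define D :: real where "D = 3 ^ CARD('n)"
  have D: "D \<ge> 1" unfolding D_def by (rule one_le_power) simp
  have g0: "g r > 0" by (rule g_pos[OF assms])
  define C where "C = (K + 1) * (2 * D) powr (g r)"
  show ?thesis
  proof (intro exI[of _ C] conjI allI impI ballI)
    show "C > 0" using K D by (simp add: C_def)
    fix m N :: nat and h :: "int ^ 'n" and l :: nat and f :: "real ^ 'n \<Rightarrow> complex" and s :: "nat ^ 'n"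
    assume m: "m \<ge> 1" and ex: "korobov_exact m h N" and N: "N \<ge> 2 * 3 ^ CARD('n)"
      and l: "l = (GREATEST l'. (2::real) ^ l' \<le> real N / 3 ^ CARD('n))"
      and f: "f \<in> C_torus" and cl: "(\<exists>\<alpha>. f \<in> sobolev_W r \<alpha>) \<or> f \<in> nikolskii_H r" and s: "optimal_s m h l f s"
    have "real (2 * 3 ^ CARD('n)) \<le> real N" using N of_nat_mono by blast
    then have N2: "2 * D \<le> real N" by (simp add: D_def)
    note lb = GREATEST_power_bounds[OF _ D l[folded D_def]]
    have l1: "2 ^ l * D \<le> real N" and l2: "real N < 2 * D * 2 ^ l"
      using lb N2 D by auto
    have "real (3 ^ CARD('n) * 2 ^ l) \<le> real N" using l1 by (simp add: D_def mult.commute)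
    then have lN: "3 ^ CARD('n) * 2 ^ l \<le> N" unfolding of_nat_le_iff .
    obtain s' :: "nat ^ 'n" where s': "(\<Sum>i\<in>UNIV. s' $ i) = l"
      "\<And>x. norm (f x - V m h s' f x) \<le> K * 2 powr (- real l * g r)"
      using rec[OF m ex lN f cl] by blast
    have "sup_norm (\<lambda>x. f x - V m h s f x) \<le> sup_norm (\<lambda>x. f x - V m h s' f x)"
      using s s'(1) unfolding optimal_s_def is_arg_min_linorder by blast
    also have "\<dots> \<le> K * 2 powr (- real l * g r)" by (rule sup_norm_le[OF s'(2)])
    also have "\<dots> \<le> (K + 1) * 2 powr (- real l * g r)" by (intro mult_right_mono) auto
    also have "2 powr (- real l * g r) = (2 ^ l) powr (- g r)"
      by (simp add: powr_realpow[symmetric] powr_powr)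
    also have "\<dots> \<le> (real N / (2 * D)) powr (- g r)"
      using l2 N2 D g0 by (intro powr_mono2') (auto simp: field_simps)
    also have "\<dots> = (2 * D) powr (g r) * real N powr (- g r)"
      using D N2 by (simp add: powr_divide powr_minus field_simps)
    finally show "sup_norm (\<lambda>x. f x - V m h s f x) \<le> C * real N powr (- g r)"
      using K by (simp add: C_def mult.assoc mult_left_mono)
  qed
qed

end
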